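(* Let $\Gamma$ be a planar path with geodesic curvature bounded in absolute value by some $\kappa_{max}>0$, let $d>0$ satisfy $d\,\kappa_{max}<1$, and consider a car-type vehicle together with the point fixed at distance $d$ in front of it (the target point). Set $a:=\frac{3}{16}$, let $\beta>8$ be a constant and let $D>0$ be an arbitrary constant fixed a priori. Choose the control laws $$u_1=C_1\sigma(y_1),\qquad u_2=-D\,\sigma\Big(\frac{k_1}{D}\xi+\frac{k_2}{D}\eta+\frac{C_2}{D}\sigma(y_2)\Big)$$ with $$k_1=a k_2^2,\qquad C_2=\frac{1}{2\beta k_2},\qquad C_1=\frac{aC_2}{4k_2}.$$ Then, for all $k_2>0$ large enough (in particular such that $\frac{1}{k_2D}$ is sufficiently small), the target point tracks $\Gamma$ asymptotically; that is, the closed-loop error system $$(\Sigma)\quad\begin{cases}\dot y_1=-C_1\sigma(y_1)+(\cos\xi-1)+\mu y_2,\\ \dot y_2=\sin\xi-\mu y_1,\\ \dot\xi=\eta-\kappa_r C_1\sigma(y_1),\\ \dot\eta=-D\,\sigma\big(\frac{k_1}{D}\xi+\frac{k_2}{D}\eta+\frac{C_2}{D}\sigma(y_2)\big),\end{cases}\qquad \mu:=\kappa_r\,(1+C_1\sigma(y_1)),$$ with state $(y_1,y_2,\xi,\eta)\in\mathbb{R}^4$, is globally asymptotically stable with respect to the origin.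
   Context: Saturation: $\sigma(x)=x/\max(1,|x|)$ for $x\in\mathbb{R}$. Reference path: $\Gamma(t)=(p_r(t),q_r(t))$ is parameterized as a virtual vehicle with velocity $u(t)$: $\dot p_r=u\cos\psi_r$, $\dot q_r=u\sin\psi_r$, $\dot\psi_r=u\kappa_r$, $\dot\kappa_r=u\rho_r$. Here $\kappa_r(t)=\kappa_r^*(s(t))$, where $\kappa_r^*$ is the geodesic curvature as a function of arclength $s(t)=s_0+\int_0^t u$, and $|\kappa_r(t)|\le\kappa_{max}$ for all $t\ge 0$. Vehicle: $\dot x=V_x\cos\psi$, $\dot y=V_x\sin\psi$, $\dot\psi=V_x\kappa$, $\dot\kappa=V_x\rho_0$, with $V_x$ continuous in time and $0<V_{min}\le V_x(t)\le V_{max}$; $\rho_0$ is the control. Target point: $p=x+d\cos\psi$, $q=y+d\sin\psi$. It travels at speed $v_d=V_x\sqrt{1+(\kappa d)^2}$ with heading $\theta=\psi+\arctan(\kappa d)$ and curvature $\omega=\dot\theta/v_d$; set $\rho=\dot\omega/v_d$. Thus $\dot p=v_d\cos\theta$, $\dot q=v_d\sin\theta$, $\dot\theta=v_d\omega$, $\dot\omega=v_d\rho$. Errors: $e_p=p-p_r$, $e_q=q-q_r$, $\xi=\theta-\psi_r$, $\eta=\omega-\kappa_r$, and $y_1=e_p\cos\psi_r+e_q\sin\psi_r$, $y_2=-e_p\sin\psi_r+e_q\cos\psi_r$. The controls $u,\rho$ are written $u=v_d(1+u_1)$, $\rho=\rho_r(1+u_1)+u_2$, with new controls $u_1,u_2$.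 In the system $(\Sigma)$ the dot denotes differentiation with respect to the rescaled time $s$ defined by $ds=v_d\,dt$; with this convention the errors satisfy $\dot y_1=-u_1+(\cos\xi-1)+(1+u_1)\kappa_r y_2$, $\dot y_2=\sin\xi-(1+u_1)\kappa_r y_1$, $\dot\xi=\eta-\kappa_r u_1$, $\dot\eta=u_2$, which gives $(\Sigma)$ under the chosen control laws. The system is time-varying through $\kappa_r$, of which only the bound $|\kappa_r|\le\kappa_{max}$ is used. *)

theory Defs
  imports "HOL-Analysis.Analysis"
begin

definition sat :: "real \<Rightarrow> real" where
  "sat x = x / max 1 \<bar>x\<bar>"

definition solution_from ::
  "(real \<Rightarrow> 'a \<Rightarrow> 'a) \<Rightarrow> real \<Rightarrow> (real \<Rightarrow> 'a::real_normed_vector) \<Rightarrow> bool" where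
  "solution_from f t0 x \<longleftrightarrow>
     (\<forall>t\<ge>t0. (x has_vector_derivative f t (x t)) (at t within {t0..}))"

text \<open>Forward completeness, Lyapunov stability and global attractivity, for every initial time.
  As in the usual notion without the adjective ``uniform'', \<open>\<delta>\<close> may depend on \<open>t0\<close>.\<close>

definition globally_asymptotically_stable ::
  "(real \<Rightarrow> 'a \<Rightarrow> 'a::real_normed_vector) \<Rightarrow> bool" where
  "globally_asymptotically_stable f \<longleftrightarrow>
     (\<forall>t0\<ge>0.
        (\<forall>x0. \<exists>x. solution_from f t0 x \<and> x t0 = x0) \<and>
        (\<forall>\<epsilon>>0. \<exists>\<delta>>0. \<forall>x. solution_from f t0 x \<and> norm (x t0) < \<delta> \<longrightarrow> (\<forall>t\<ge>t0. norm (x t) < \<epsilon>)) \<and>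
        (\<forall>x. solution_from f t0 x \<longrightarrow> (x \<longlongrightarrow> 0) at_top))"

definition control_u1 :: "real \<Rightarrow> real \<Rightarrow> real" where
  "control_u1 C1 y1 = C1 * sat y1"

definition control_u2 :: "real \<Rightarrow> real \<Rightarrow> real \<Rightarrow> real \<Rightarrow> real \<Rightarrow> real \<Rightarrow> real \<Rightarrow> real" where
  "control_u2 D k1 k2 C2 y2 \<xi> \<eta> = - D * sat (k1 / D * \<xi> + k2 / D * \<eta> + C2 / D * sat y2)"

text \<open>The system \<open>(\<Sigma>)\<close>; its time variable is the rescaled time \<open>ds = v_d dt\<close>,
  and \<open>\<kappa>r\<close> is the reference curvature as a function of that time.\<close>

definition error_system ::
  "real \<Rightarrow> real \<Rightarrow> real \<Rightarrow> real \<Rightarrow> real \<Rightarrow> (real \<Rightarrow> real)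
     \<Rightarrow> real \<Rightarrow> real \<times> real \<times> real \<times> real \<Rightarrow> real \<times> real \<times> real \<times> real" where
  "error_system D k1 k2 C1 C2 \<kappa>r = (\<lambda>t (y1, y2, \<xi>, \<eta>).
     let \<mu> = \<kappa>r t * (1 + C1 * sat y1) in
     (- C1 * sat y1 + (cos \<xi> - 1) + \<mu> * y2,
      sin \<xi> - \<mu> * y1,
      \<eta> - \<kappa>r t * C1 * sat y1,
      - D * sat (k1 / D * \<xi> + k2 / D * \<eta> + C2 / D * sat y2)))"

text \<open>A planar path, as functions of arclength: position, heading, geodesic curvature,
  and the derivative of the curvature.\<close>

record planar_path =
  path_p :: "real \<Rightarrow> real"
  path_q :: "real \<Rightarrow> real"
  path_heading :: "real \<Rightarrow> real"
  path_curv :: "real \<Rightarrow> real"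
  path_curv_rate :: "real \<Rightarrow> real"

definition arclength_path :: "real \<Rightarrow> planar_path \<Rightarrow> bool" where
  "arclength_path s0 \<Gamma> \<longleftrightarrow>
     (\<forall>s\<ge>s0.
        (path_p \<Gamma> has_real_derivative cos (path_heading \<Gamma> s)) (at s within {s0..}) \<and>
        (path_q \<Gamma> has_real_derivative sin (path_heading \<Gamma> s)) (at s within {s0..}) \<and>
        (path_heading \<Gamma> has_real_derivative path_curv \<Gamma> s) (at s within {s0..}) \<and>
        (path_curv \<Gamma> has_real_derivative path_curv_rate \<Gamma> s) (at s within {s0..}))"

text \<open>The signals of a run, as functions of the original time \<open>t\<close>. The vehicle signals are
  \<open>V\<^sub>x, x, y, \<psi>, \<kappa>, \<rho>\<^sub>0\<close>; \<open>target_curv\<close> is the target-point curvature \<open>\<omega>\<close>; \<open>ref_arc\<close> is the arclength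
  \<open>s(t)\<close> reached by the virtual vehicle on the reference path.\<close>

record motion =
  veh_speed :: "real \<Rightarrow> real"
  veh_x :: "real \<Rightarrow> real"
  veh_y :: "real \<Rightarrow> real"
  veh_heading :: "real \<Rightarrow> real"
  veh_curv :: "real \<Rightarrow> real"
  veh_control :: "real \<Rightarrow> real"
  target_curv :: "real \<Rightarrow> real"
  ref_arc :: "real \<Rightarrow> real"

definition vehicle :: "real \<Rightarrow> real \<Rightarrow> motion \<Rightarrow> bool" where
  "vehicle Vmin Vmax m \<longleftrightarrow>
     continuous_on {0..} (veh_speed m) \<and>
     (\<forall>t\<ge>0.
        Vmin \<le> veh_speed m t \<and> veh_speed m t \<le> Vmax \<and>
        (veh_x m has_real_derivative veh_speed m t * cos (veh_heading m t)) (at t within {0..}) \<and>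
        (veh_y m has_real_derivative veh_speed m t * sin (veh_heading m t)) (at t within {0..}) \<and>
        (veh_heading m has_real_derivative veh_speed m t * veh_curv m t) (at t within {0..}) \<and>
        (veh_curv m has_real_derivative veh_speed m t * veh_control m t) (at t within {0..}))"

definition target_p :: "real \<Rightarrow> motion \<Rightarrow> real \<Rightarrow> real" where
  "target_p d m t = veh_x m t + d * cos (veh_heading m t)"

definition target_q :: "real \<Rightarrow> motion \<Rightarrow> real \<Rightarrow> real" where
  "target_q d m t = veh_y m t + d * sin (veh_heading m t)"

definition target_speed :: "real \<Rightarrow> motion \<Rightarrow> real \<Rightarrow> real" where
  "target_speed d m t = veh_speed m t * sqrt (1 + (veh_curv m t * d)\<^sup>2)"

definition target_heading :: "real \<Rightarrow> motion \<Rightarrow> real \<Rightarrow> real" where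
  "target_heading d m t = veh_heading m t + arctan (veh_curv m t * d)"

definition err_p :: "planar_path \<Rightarrow> real \<Rightarrow> motion \<Rightarrow> real \<Rightarrow> real" where
  "err_p \<Gamma> d m t = target_p d m t - path_p \<Gamma> (ref_arc m t)"

definition err_q :: "planar_path \<Rightarrow> real \<Rightarrow> motion \<Rightarrow> real \<Rightarrow> real" where
  "err_q \<Gamma> d m t = target_q d m t - path_q \<Gamma> (ref_arc m t)"

definition err_y1 :: "planar_path \<Rightarrow> real \<Rightarrow> motion \<Rightarrow> real \<Rightarrow> real" where
  "err_y1 \<Gamma> d m t = err_p \<Gamma> d m t * cos (path_heading \<Gamma> (ref_arc m t))
                  + err_q \<Gamma> d m t * sin (path_heading \<Gamma> (ref_arc m t))"

definition err_y2 :: "planar_path \<Rightarrow> real \<Rightarrow> motion \<Rightarrow> real \<Rightarrow> real" where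
  "err_y2 \<Gamma> d m t = - err_p \<Gamma> d m t * sin (path_heading \<Gamma> (ref_arc m t))
                  + err_q \<Gamma> d m t * cos (path_heading \<Gamma> (ref_arc m t))"

definition err_xi :: "planar_path \<Rightarrow> real \<Rightarrow> motion \<Rightarrow> real \<Rightarrow> real" where
  "err_xi \<Gamma> d m t = target_heading d m t - path_heading \<Gamma> (ref_arc m t)"

definition err_eta :: "planar_path \<Rightarrow> motion \<Rightarrow> real \<Rightarrow> real" where
  "err_eta \<Gamma> m t = target_curv m t - path_curv \<Gamma> (ref_arc m t)"

text \<open>The loop is closed by \<open>u = v_d (1 + u\<^sub>1)\<close> and \<open>\<rho> = \<rho>\<^sub>r (1 + u\<^sub>1) + u\<^sub>2\<close>, where \<open>u\<close> is the derivative
  of \<open>s(t)\<close>, \<open>\<omega> = \<theta>' / v_d\<close> and \<open>\<rho> = \<omega>' / v_d\<close>. The control \<open>\<rho>\<^sub>0\<close> is fixed implicitly by these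
  equations, through the dependence of \<open>\<theta>'\<close> on \<open>\<rho>\<^sub>0\<close>.\<close>

definition closed_loop ::
  "planar_path \<Rightarrow> real \<Rightarrow> real \<Rightarrow> real \<Rightarrow> real \<Rightarrow> real \<Rightarrow> real \<Rightarrow> real \<Rightarrow> motion \<Rightarrow> bool" where
  "closed_loop \<Gamma> s0 d D k1 k2 C1 C2 m \<longleftrightarrow>
     ref_arc m 0 = s0 \<and>
     (\<forall>t\<ge>0.
        let u1 = control_u1 C1 (err_y1 \<Gamma> d m t);
            u2 = control_u2 D k1 k2 C2 (err_y2 \<Gamma> d m t) (err_xi \<Gamma> d m t) (err_eta \<Gamma> m t);
            \<rho> = path_curv_rate \<Gamma> (ref_arc m t) * (1 + u1) + u2
        in
        (ref_arc m has_real_derivative target_speed d m t * (1 + u1)) (at t within {0..}) \<and>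
        (target_heading d m has_real_derivative target_speed d m t * target_curv m t)
          (at t within {0..}) \<and>
        (target_curv m has_real_derivative target_speed d m t * \<rho>) (at t within {0..}))"

definition tracks_asymptotically :: "planar_path \<Rightarrow> real \<Rightarrow> motion \<Rightarrow> bool" where
  "tracks_asymptotically \<Gamma> d m \<longleftrightarrow>
     (err_p \<Gamma> d m \<longlongrightarrow> 0) at_top \<and> (err_q \<Gamma> d m \<longlongrightarrow> 0) at_top \<and>
     (err_xi \<Gamma> d m \<longlongrightarrow> 0) at_top \<and> (err_eta \<Gamma> m \<longlongrightarrow> 0) at_top"

end

theory Submission
  imports Defs
begin

text \<open>
  All estimates allow a time factor \<open>v \<ge> vm > 0\<close> in front of the vector field, so that they cover
  both \<open>(\<Sigma>)\<close>, with \<open>v = 1\<close>, and the vehicle in its original time, with \<open>v = v_d\<close>.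

  Rescaled by \<open>X = k\<^sup>2 \<xi> / D\<close> and \<open>H = k \<eta> / D\<close>, the steering loop is a saturated double integrator
  \<open>X' = H - \<delta>\<close>, \<open>H' = - sat (a X + H + d)\<close> in which \<open>\<delta>\<close> and \<open>d\<close> are of size \<open>1 / (k D)\<close>, whatever
  \<open>y1\<close>, \<open>y2\<close> and \<open>\<kappa>r\<close> do. The classical Lyapunov function of the double integrator plus the cross term
  \<open>- H arctan z / 10\<close>, where \<open>z = a X + H\<close>, is strict, so \<open>(\<xi>, \<eta>)\<close> reaches in finite time a small
  neighbourhood of the origin, which is invariant and in which the control is not saturated.

  There \<open>k1 \<xi> = - (\<eta> + k \<xi>)' - k \<kappa>r C1 sat y1 - C2 sat y2\<close>. In the derivative of \<open>(y1\<^sup>2 + y2\<^sup>2) / 2\<close> the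
  rotation by \<open>\<mu>\<close> cancels, and substituting this identity into the term \<open>y2 \<xi>\<close> gives the dissipation
  \<open>- (C2 / k1) y2 sat y2\<close>, a total derivative, and a term \<open>\<kappa>r y2 sat y1\<close>; the latter is not small for
  large \<open>y2\<close>, but \<open>\<kappa>r y2\<close> is nearly \<open>y1'\<close>, so that it is nearly a total derivative of a primitive of
  \<open>sat y1\<close>. Moving the total derivatives to the left yields a strict Lyapunov function.
\<close>

section \<open>Saturation and scalar differential inequalities\<close>

lemma sat_clamp: "sat x = max (- 1) (min 1 x)"
  by (auto simp: sat_def max_def min_def abs_if)

lemma abs_sat_le_one: "\<bar>sat x\<bar> \<le> 1"
  by (simp add: sat_clamp)

lemma sat_eq: "\<bar>x\<bar> \<le> 1 \<Longrightarrow> sat x = x"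
  by (simp add: sat_clamp)

lemma sat_eq_if_abs_less_one: "\<bar>sat x\<bar> < 1 \<Longrightarrow> sat x = x"
  by (auto simp: sat_clamp max_def min_def split: if_splits)

lemma sat_lipschitz: "\<bar>sat x - sat y\<bar> \<le> \<bar>x - y\<bar>"
  by (simp add: sat_clamp)

lemma sat_sq_le: "(sat x)\<^sup>2 \<le> x * sat x"
proof -
  consider "x \<le> -1" | "\<bar>x\<bar> \<le> 1" | "x \<ge> 1" by linarith
  then show ?thesis
    by cases (auto simp: sat_clamp power2_eq_square)
qed

lemma sat_nonneg: "0 \<le> x * sat x"
  using sat_sq_le[of x] zero_le_power2[of "sat x"] by linarith

text \<open>Lets a linear factor be paid for by the dissipation \<open>x * sat x\<close>, which is
  only quadratic near the origin, at the price of a constant.\<close>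

lemma abs_le_mult_sat: "\<bar>x\<bar> \<le> x * sat x + 1"
proof -
  consider "x \<le> -1" | "\<bar>x\<bar> \<le> 1" | "x \<ge> 1" by linarith
  then show ?thesis
  proof cases
    case 2
    then show ?thesis using sat_nonneg[of x] by linarith
  qed (auto simp: sat_clamp)
qed

lemma continuous_on_sat [continuous_intros]:
  "continuous_on S f \<Longrightarrow> continuous_on S (\<lambda>x. sat (f x))"
  unfolding sat_clamp by (intro continuous_intros)

text \<open>The antiderivative of \<open>sat\<close> that vanishes at the origin (the Huber
  function): \<open>x\<^sup>2 / 2\<close> for |x| \<le> 1 and |x| - 1/2 beyond. A single formula for
  both ranges avoids case distinctions at the corners.\<close>

definition sat_prim :: "real \<Rightarrow> real" where
  "sat_prim x = x * sat x - (sat x)\<^sup>2 / 2"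

lemma sat_prim_ge: "(sat x)\<^sup>2 / 2 \<le> sat_prim x"
  using sat_sq_le[of x] by (simp add: sat_prim_def)

lemma sat_prim_nonneg: "0 \<le> sat_prim x"
  using sat_prim_ge[of x] zero_le_power2[of "sat x"] by linarith

lemma sat_prim_le: "sat_prim x \<le> x\<^sup>2 / 2"
proof -
  have "0 \<le> (x - sat x)\<^sup>2" by simp
  then show ?thesis by (simp add: sat_prim_def power2_eq_square algebra_simps)
qed

text \<open>\<open>sat_prim\<close> is convex with gradient \<open>sat\<close>, so the remainder is
  nonnegative; exchanging the two points bounds it by the product of the increments of
  \<open>sat\<close> and of the argument, and \<open>sat\<close> is 1-Lipschitz. A quadratic
  remainder gives differentiability also at the corners.\<close>

lemma sat_prim_taylor: "\<bar>sat_prim y - sat_prim x - sat x * (y - x)\<bar> \<le> (y - x)\<^sup>2"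
proof -
  \<comment> \<open>The overshoot \<open>y - sat y\<close> is nonzero only when \<open>sat y\<close>
    is the endpoint of [-1, 1] on that side, and no value of \<open>sat\<close> lies beyond an
    endpoint.\<close>
  have lower: "0 \<le> (y - sat y) * (sat y - sat x)" for x y :: real
  proof -
    consider "y \<le> -1" | "\<bar>y\<bar> \<le> 1" | "y \<ge> 1" by linarith
    then show ?thesis
    proof cases
      case 1
      then have "sat y = -1" by (simp add: sat_clamp)
      then show ?thesis using 1 abs_sat_le_one[of x] by (simp add: mult_nonpos_nonpos abs_le_iff)
    next
      case 3
      then have "sat y = 1" by (simp add: sat_clamp)
      then show ?thesis using 3 abs_sat_le_one[of x] by (simp add: abs_le_iff)
    qed (simp add: sat_eq)
  qed
  have conv: "0 \<le> sat_prim y - sat_prim x - sat x * (y - x)" for x y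
  proof -
    have "sat_prim y - sat_prim x - sat x * (y - x)
        = (y - sat y) * (sat y - sat x) + (sat y - sat x)\<^sup>2 / 2"
      by (simp add: sat_prim_def power2_eq_square algebra_simps add_divide_distrib diff_divide_distrib)
    then show ?thesis using lower[of y x] by simp
  qed
  have "sat_prim y - sat_prim x - sat x * (y - x) \<le> (sat y - sat x) * (y - x)"
    using conv[of x y] by (simp add: algebra_simps)
  also have "\<dots> \<le> \<bar>sat y - sat x\<bar> * \<bar>y - x\<bar>"
    by (metis abs_ge_self abs_mult)
  also have "\<dots> \<le> \<bar>y - x\<bar> * \<bar>y - x\<bar>"
    by (intro mult_right_mono sat_lipschitz) simp
  finally show ?thesis using conv[of y x] by (simp add: power2_eq_square)
qed

lemma DERIV_sat_prim: "(sat_prim has_real_derivative sat x) (at x)"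
proof -
  have "((\<lambda>y. (sat_prim y - sat_prim x) / (y - x) - sat x) \<longlongrightarrow> 0) (at x)"
  proof (rule Lim_null_comparison)
    show "((\<lambda>y. \<bar>y - x\<bar>) \<longlongrightarrow> 0) (at x)"
      by (rule tendsto_eq_intros refl | simp)+
    show "\<forall>\<^sub>F y in at x. norm ((sat_prim y - sat_prim x) / (y - x) - sat x) \<le> \<bar>y - x\<bar>"
      unfolding eventually_at_filter
    proof (intro always_eventually allI impI)
      fix y :: real assume "y \<noteq> x"
      then have "(sat_prim y - sat_prim x) / (y - x) - sat x
          = (sat_prim y - sat_prim x - sat x * (y - x)) / (y - x)"
        by (simp add: field_simps)
      also have "norm \<dots> \<le> (y - x)\<^sup>2 / \<bar>y - x\<bar>"
        unfolding real_norm_def abs_divide by (intro divide_right_mono sat_prim_taylor) simp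
      also have "\<dots> = \<bar>y - x\<bar>"
        using \<open>y \<noteq> x\<close> by (metis abs_zero divide_eq_eq diff_eq_diff_eq diff_self power2_abs power2_eq_square
            abs_eq_0 right_minus_eq)
      finally show "norm ((sat_prim y - sat_prim x) / (y - x) - sat x) \<le> \<bar>y - x\<bar>" .
    qed
  qed
  then have "((\<lambda>y. (sat_prim y - sat_prim x) / (y - x)) \<longlongrightarrow> sat x) (at x)"
    by (rule LIM_zero_cancel)
  then show ?thesis by (simp add: has_field_derivative_iff)
qed

text \<open>If \<open>f\<close> exceeded \<open>c\<close>, it would have to climb after its last
  visit to the sublevel set, where its derivative is nonpositive; the mean value theorem forbids
  this. No sign is asked of the derivative at or below the level \<open>c\<close>, which suits
  functions that decay only outside a neighbourhood.\<close>

lemma sublevel_invariant: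
  fixes f :: "real \<Rightarrow> real"
  assumes der: "\<And>t. t0 \<le> t \<Longrightarrow> (f has_real_derivative f' t) (at t within {t0..})"
    and neg: "\<And>t. t0 \<le> t \<Longrightarrow> c < f t \<Longrightarrow> f' t \<le> 0"
    and "f t0 \<le> c" "t0 \<le> t"
  shows "f t \<le> c"
proof (rule ccontr)
  assume "\<not> f t \<le> c"
  then have ft: "c < f t" by simp
  have cont: "continuous_on {t0..} f"
    using der DERIV_continuous_on by (metis atLeast_iff)
  define A where "A = {s \<in> {t0..t}. f s \<in> {..c}}"
  have "closed A"
  proof -
    have "A = {t0..t} \<inter> f -` {..c}" by (auto simp: A_def)
    moreover have "continuous_on {t0..t} f" by (rule continuous_on_subset[OF cont]) auto
    ultimately show ?thesis by (simp add: continuous_closed_preimage)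
  qed
  moreover have "t0 \<in> A" "bdd_above A" using assms by (auto simp: A_def)
  ultimately have SA: "Sup A \<in> A" by (intro closed_contains_Sup) auto
  define s where "s = Sup A"
  have s: "t0 \<le> s" "s \<le> t" "f s \<le> c" using SA by (auto simp: A_def s_def)
  have "s < t" using s ft by (metis less_eq_real_def not_le)
  have above: "c < f r" if "s < r" "r \<le> t" for r
  proof (rule ccontr)
    assume "\<not> c < f r"
    then have "r \<in> A" using that s by (auto simp: A_def)
    then have "r \<le> s" unfolding s_def using \<open>bdd_above A\<close> by (rule cSup_upper)
    then show False using that by simp
  qed
  have "\<exists>l z. s < z \<and> z < t \<and> DERIV f z :> l \<and> f t - f s = (t - s) * l"
  proof (rule MVT[OF \<open>s < t\<close>])
    show "continuous_on {s..t} f" by (rule continuous_on_subset[OF cont]) (use s in auto)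
    fix x assume x: "s < x" "x < t"
    have "at x within {t0..} = at x"
      by (rule at_within_interior) (use x s in auto)
    then show "f differentiable at x"
      using der[of x] x s real_differentiable_def by auto
  qed
  then obtain l z where z: "s < z" "z < t" "DERIV f z :> l" "f t - f s = (t - s) * l" by blast
  have "at z within {t0..} = at z"
    by (rule at_within_interior) (use z s in auto)
  then have "l = f' z" using der[of z] z s by (auto intro: DERIV_unique)
  then have "l \<le> 0" using neg[of z] above[of z] z s by auto
  then have "f t \<le> f s" using z(4) \<open>s < t\<close> by (smt (verit) mult_nonneg_nonpos)
  then show False using s ft by simp
qed

text \<open>As long as \<open>f\<close> stays above \<open>c\<close> it decreases at least at the
  rate \<open>m\<close>, which cannot last forever; once the sublevel set is entered,
  \<open>sublevel_invariant\<close> keeps \<open>f\<close> there.\<close>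

lemma sublevel_reached:
  fixes f :: "real \<Rightarrow> real"
  assumes der: "\<And>t. t0 \<le> t \<Longrightarrow> (f has_real_derivative f' t) (at t within {t0..})"
    and neg: "\<And>t. t0 \<le> t \<Longrightarrow> c < f t \<Longrightarrow> f' t \<le> - m" and "0 < m"
  obtains T where "t0 \<le> T" "\<And>t. T \<le> t \<Longrightarrow> f t \<le> c"
proof -
  have "\<exists>T\<ge>t0. f T \<le> c"
  proof (rule ccontr)
    assume "\<not> (\<exists>T\<ge>t0. f T \<le> c)"
    then have above: "\<And>t. t0 \<le> t \<Longrightarrow> c < f t" by (meson not_le)
    define g where "g t = f t + m * (t - t0)" for t
    have "g t \<le> f t0" if "t0 \<le> t" for t
    proof (rule sublevel_invariant[where f = g and ?t0.0 = t0 and f' = "\<lambda>t. f' t + m"])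
      fix s assume s: "t0 \<le> s"
      show "(g has_real_derivative f' s + m) (at s within {t0..})"
        unfolding g_def by (auto intro!: derivative_eq_intros der s)
      show "f' s + m \<le> 0" using neg[OF s above[OF s]] by simp
    qed (use that in \<open>auto simp: g_def\<close>)
    \<comment> \<open>By this time the linear decrease amounts to |f t0 - c|, which brings
      \<open>f\<close> down to \<open>c\<close> or below.\<close>
    from this[of "t0 + \<bar>f t0 - c\<bar> / m"] above[of "t0 + \<bar>f t0 - c\<bar> / m"] \<open>0 < m\<close>
    show False by (simp add: g_def)
  qed
  then obtain T where T: "t0 \<le> T" "f T \<le> c" by blast
  have "f t \<le> c" if "T \<le> t" for t
  proof (rule sublevel_invariant[where f = f and ?t0.0 = T and f' = f'])
    fix s assume "T \<le> s"
    then show "(f has_real_derivative f' s) (at s within {T..})"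
      using der[of s] T by (auto intro: DERIV_subset)
    assume "c < f s" then show "f' s \<le> 0" using neg[of s] \<open>T \<le> s\<close> T \<open>0 < m\<close> by linarith
  qed (use T that in auto)
  with T show thesis using that by blast
qed

section \<open>Dissipation of the perturbed saturated double integrator\<close>

lemma abs_arctan_le_sat: "\<bar>arctan z\<bar> \<le> 2 * \<bar>sat z\<bar>"
proof (cases "\<bar>z\<bar> \<le> 1")
  case True
  then show ?thesis using abs_arctan_le[of z] by (simp add: sat_eq)
next
  case False
  then have "\<bar>sat z\<bar> = 1" by (auto simp: sat_clamp)
  moreover have "\<bar>arctan z\<bar> \<le> 2"
    using arctan_bounded[of z] pi_less_4 by (auto simp: abs_le_iff)
  ultimately show ?thesis by simp
qed

text \<open>The left side is the derivative of the function later called \<open>fast_lyap\<close>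
  along \<open>z' = 3/16 (H - \<delta>) - sat (z + d)\<close>, \<open>H' = - sat (z + d)\<close>.
  Without the cross term it controls only \<open>sat z\<close>; the cross term adds
  \<open>- (3/160) H\<^sup>2 / (1 + z\<^sup>2)\<close>. The disturbance terms are linear in |H| with
  the weight \<open>1 / (1 + z\<^sup>2)\<close>, or linear in |sat z|, and Young's inequality
  absorbs them.\<close>

lemma double_integrator_dissipation:
  fixes z H d \<delta> \<epsilon> :: real
  assumes d: "\<bar>d\<bar> \<le> \<epsilon>" and \<delta>: "\<bar>\<delta>\<bar> \<le> \<epsilon>" and \<epsilon>: "\<epsilon> \<le> 1"
  shows "3/16 * H * (sat z - sat (z + d)) - 3/16 * \<delta> * sat z - sat z * sat (z + d)
      + 1/10 * sat (z + d) * arctan z - 1/10 * H * (1 / (1 + z\<^sup>2) * (3/16 * (H - \<delta>) - sat (z + d)))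
    \<le> - (1/200) * ((sat z)\<^sup>2 + H\<^sup>2 / (1 + z\<^sup>2)) + 96 * \<epsilon>\<^sup>2"
proof -
  define q where "q = 1 / (1 + z\<^sup>2)"
  define s where "s = \<bar>sat z\<bar>"
  define n where "n = \<bar>H\<bar>"
  define e where "e = sat (z + d) - sat z"
  have \<epsilon>0: "0 \<le> \<epsilon>" using d by linarith
  have q: "0 < q" "q \<le> 1" by (auto simp: q_def add_pos_nonneg)
  have sn: "0 \<le> s" "0 \<le> n" by (auto simp: s_def n_def)
  have e1: "\<bar>e\<bar> \<le> \<epsilon>" using sat_lipschitz[of "z + d" z] d by (simp add: e_def)
  \<comment> \<open>The plain bound \<open>e1\<close> would leave a term linear in |H| without the
    weight \<open>q\<close>, which the dissipation \<open>q * n\<^sup>2\<close> could not absorb for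
    large |z|. But for |z| > 2 both arguments are saturated on the same side and the difference
    vanishes, while |z| \<le> 2 means 1 \<le> 5 q.\<close>
  have e2: "\<bar>e\<bar> \<le> 5 * \<epsilon> * q"
  proof (cases "\<bar>z\<bar> \<le> 2")
    case True
    then have "z\<^sup>2 \<le> 2\<^sup>2" by (metis abs_le_square_iff abs_numeral)
    then have "1 \<le> 5 * q" by (simp add: q_def add_pos_nonneg field_simps)
    then have "\<epsilon> * 1 \<le> \<epsilon> * (5 * q)" using \<epsilon>0 by (intro mult_left_mono)
    then show ?thesis using e1 by simp
  next
    case False
    then have "e = 0" using d \<epsilon> by (auto simp: e_def sat_clamp min_def max_def abs_if split: if_splits)
    then show ?thesis using q \<epsilon>0 by simp
  qed
  have g: "\<bar>arctan z\<bar> \<le> 2 * s" using abs_arctan_le_sat by (simp add: s_def)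
  have se: "\<bar>sat (z + d)\<bar> \<le> s + \<epsilon>" using e1 by (simp add: e_def s_def)
  have t1: "3/16 * H * (sat z - sat (z + d)) \<le> 15/16 * (\<epsilon> * (q * n))"
  proof -
    have "3/16 * (H * (sat z - sat (z + d))) \<le> 3/16 * (n * \<bar>e\<bar>)"
      by (intro mult_left_mono) (auto simp: n_def e_def abs_mult[symmetric] abs_minus_commute algebra_simps intro: abs_ge_self order_trans[OF abs_ge_self])
    also have "\<dots> \<le> 3/16 * (n * (5 * \<epsilon> * q))"
      by (intro mult_left_mono e2 sn) auto
    finally show ?thesis by (simp add: algebra_simps)
  qed
  have t2: "- (3/16 * \<delta> * sat z) \<le> 3/16 * (\<epsilon> * s)"
  proof -
    have "- (\<delta> * sat z) \<le> \<bar>\<delta>\<bar> * s" unfolding s_def abs_mult[symmetric] by simp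
    also have "\<dots> \<le> \<epsilon> * s" by (intro mult_right_mono \<delta> sn)
    finally show ?thesis by simp
  qed
  have t3: "- (sat z * sat (z + d)) \<le> - s\<^sup>2 + \<epsilon> * s"
  proof -
    have "- (sat z * sat (z + d)) = - s\<^sup>2 - sat z * e"
      by (simp add: e_def s_def power2_eq_square algebra_simps)
    moreover have "- (sat z * e) \<le> s * \<bar>e\<bar>" unfolding s_def abs_mult[symmetric] by simp
    moreover have "s * \<bar>e\<bar> \<le> s * \<epsilon>" by (intro mult_left_mono e1 sn)
    ultimately show ?thesis by (simp add: mult.commute)
  qed
  have t4: "1/10 * sat (z + d) * arctan z \<le> 1/5 * s\<^sup>2 + 1/5 * (\<epsilon> * s)"
  proof -
    have "sat (z + d) * arctan z \<le> \<bar>sat (z + d)\<bar> * \<bar>arctan z\<bar>" unfolding abs_mult[symmetric] by simp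
    also have "\<dots> \<le> (s + \<epsilon>) * (2 * s)" by (intro mult_mono se g) (use sn \<epsilon>0 in auto)
    finally show ?thesis by (simp add: power2_eq_square algebra_simps)
  qed
  have t5: "- (1/10 * H * (q * (3/16 * (H - \<delta>) - sat (z + d))))
      \<le> - (3/160) * (q * n\<^sup>2) + 3/160 * (\<epsilon> * (q * n)) + 1/10 * (q * n * s) + 1/10 * (\<epsilon> * (q * n))"
  proof -
    have "H * \<delta> \<le> n * \<epsilon>"
    proof -
      have "H * \<delta> \<le> n * \<bar>\<delta>\<bar>" unfolding n_def abs_mult[symmetric] by simp
      also have "\<dots> \<le> n * \<epsilon>" by (intro mult_left_mono \<delta> sn)
      finally show ?thesis .
    qed
    moreover have "H * sat (z + d) \<le> n * (s + \<epsilon>)"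
    proof -
      have "H * sat (z + d) \<le> n * \<bar>sat (z + d)\<bar>" unfolding n_def abs_mult[symmetric] by simp
      also have "\<dots> \<le> n * (s + \<epsilon>)" by (intro mult_left_mono se sn)
      finally show ?thesis .
    qed
    moreover have "H * H = n * n" by (simp add: n_def)
    moreover have "- (1/10 * H * (3/16 * (H - \<delta>) - sat (z + d)))
        = - (3/160) * (H * H) + 3/160 * (H * \<delta>) + 1/10 * (H * sat (z + d))"
      by (simp add: field_simps)
    ultimately have "- (1/10 * H * (3/16 * (H - \<delta>) - sat (z + d)))
        \<le> - (3/160) * (n * n) + 3/160 * (n * \<epsilon>) + 1/10 * (n * (s + \<epsilon>))"
      by linarith
    from mult_left_mono[OF this, of q] q show ?thesis
      by (simp add: power2_eq_square field_simps)
  qed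
  \<comment> \<open>The Young weights in \<open>m1\<close>, \<open>m2\<close> and \<open>m3\<close>
    are tuned to the final sum: -3/160 + 7/800 + 1/200 = -1/200 for \<open>q * n\<^sup>2\<close>,
    and 121/2 + 35 \<le> 96 for \<open>\<epsilon>\<^sup>2\<close>; the coefficient of
    \<open>s\<^sup>2\<close> ends near -1/2, well below -1/200.\<close>
  have m1: "q * n * s \<le> 7/80 * (q * n\<^sup>2) + 20/7 * s\<^sup>2"
  proof -
    have "0 \<le> (7 / 40 * n - s)\<^sup>2" by simp
    then have "n * s \<le> 7/80 * n\<^sup>2 + 20/7 * s\<^sup>2" by (simp add: power2_eq_square algebra_simps)
    then have "q * (n * s) \<le> q * (7/80 * n\<^sup>2 + 20/7 * s\<^sup>2)" using q by (intro mult_left_mono) auto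
    moreover have "q * (20/7 * s\<^sup>2) \<le> 20/7 * s\<^sup>2" using q by (intro mult_left_le_one_le) auto
    ultimately show ?thesis by (simp add: algebra_simps)
  qed
  have m2: "11/10 * (\<epsilon> * (q * n)) \<le> 1/200 * (q * n\<^sup>2) + 121/2 * \<epsilon>\<^sup>2"
  proof -
    have "0 \<le> (n - 110 * \<epsilon>)\<^sup>2" by simp
    then have "11/10 * (\<epsilon> * n) \<le> 1/200 * n\<^sup>2 + 121/2 * \<epsilon>\<^sup>2" by (simp add: power2_eq_square algebra_simps)
    then have "q * (11/10 * (\<epsilon> * n)) \<le> q * (1/200 * n\<^sup>2 + 121/2 * \<epsilon>\<^sup>2)" using q by (intro mult_left_mono) auto
    moreover have "q * (121/2 * \<epsilon>\<^sup>2) \<le> 121/2 * \<epsilon>\<^sup>2" using q by (intro mult_left_le_one_le) auto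
    ultimately show ?thesis by (simp add: algebra_simps)
  qed
  have m3: "7/5 * (\<epsilon> * s) \<le> 7/500 * s\<^sup>2 + 35 * \<epsilon>\<^sup>2"
  proof -
    have "0 \<le> (s - 50 * \<epsilon>)\<^sup>2" by simp
    then show ?thesis by (simp add: power2_eq_square algebra_simps)
  qed
  have pos: "0 \<le> \<epsilon> * (q * n)" "0 \<le> \<epsilon> * s" "0 \<le> q * n\<^sup>2" "0 \<le> s\<^sup>2" "0 \<le> \<epsilon>\<^sup>2"
    using \<epsilon>0 q sn by auto
  have "3/16 * H * (sat z - sat (z + d)) - 3/16 * \<delta> * sat z - sat z * sat (z + d)
      + 1/10 * sat (z + d) * arctan z - 1/10 * H * (q * (3/16 * (H - \<delta>) - sat (z + d)))
    \<le> - (1/200) * (s\<^sup>2 + q * n\<^sup>2) + 96 * \<epsilon>\<^sup>2"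
    using t1 t2 t3 t4 t5 m1 m2 m3 pos by argo
  then show ?thesis by (simp add: q_def s_def n_def)
qed

section \<open>The steering loop as a perturbed saturated double integrator\<close>

text \<open>The weight 3/32 is a/2 for a = 3/16, so that the products of \<open>H\<close> and
  \<open>sat z\<close> cancel in the derivative. The arctangent, unlike \<open>z\<close> itself, is
  bounded and still strictly increasing: the cross term is dominated by the other two and yet
  dissipates \<open>H\<close> at every \<open>z\<close>.\<close>

definition fast_lyap :: "real \<Rightarrow> real \<Rightarrow> real" where
  "fast_lyap z H = 3/32 * H\<^sup>2 + sat_prim z - 1/10 * (H * arctan z)"

lemma fast_lyap_upper: "fast_lyap z H \<le> 3/32 * H\<^sup>2 + z\<^sup>2 / 2 + 1/10 * (\<bar>H\<bar> * \<bar>z\<bar>)"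
proof -
  have "- (H * arctan z) \<le> \<bar>H\<bar> * \<bar>arctan z\<bar>" unfolding abs_mult[symmetric] by simp
  also have "\<dots> \<le> \<bar>H\<bar> * \<bar>z\<bar>" by (intro mult_left_mono abs_arctan_le) simp
  finally show ?thesis using sat_prim_le[of z] by (simp add: fast_lyap_def)
qed

lemma fast_lyap_lower: "1/25 * H\<^sup>2 + 3/10 * (sat z)\<^sup>2 \<le> fast_lyap z H"
proof -
  have "H * arctan z \<le> \<bar>H\<bar> * \<bar>arctan z\<bar>" unfolding abs_mult[symmetric] by simp
  also have "\<dots> \<le> \<bar>H\<bar> * (2 * \<bar>sat z\<bar>)" by (intro mult_left_mono abs_arctan_le_sat) simp
  finally have "H * arctan z \<le> 2 * (\<bar>H\<bar> * \<bar>sat z\<bar>)" by simp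
  moreover have "0 \<le> (\<bar>H\<bar> - 2 * \<bar>sat z\<bar>)\<^sup>2" by simp
  then have "4 * (\<bar>H\<bar> * \<bar>sat z\<bar>) \<le> H\<^sup>2 + 4 * (sat z)\<^sup>2"
    by (simp add: power2_diff power_mult_distrib)
  ultimately show ?thesis
    using sat_prim_ge[of z] zero_le_power2[of H] unfolding fast_lyap_def by linarith
qed

text \<open>The lower bound of \<open>fast_lyap\<close> sees only \<open>sat z\<close>; the
  smallness of \<open>R\<close> forces |sat z| < 1, so that \<open>z\<close> is not saturated and
  the bound passes to \<open>z\<close>.\<close>

lemma fast_lyap_small:
  assumes "fast_lyap z H \<le> R\<^sup>2" "0 \<le> R" "2 * R < 1"
  shows "\<bar>z\<bar> \<le> 2 * R" "\<bar>H\<bar> \<le> 5 * R"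
proof -
  have l: "1/25 * H\<^sup>2 + 3/10 * (sat z)\<^sup>2 \<le> R\<^sup>2" using fast_lyap_lower[of H z] assms by simp
  have "(sat z)\<^sup>2 \<le> 4 * R\<^sup>2"
    using l zero_le_power2[of H] zero_le_power2[of "sat z"] by linarith
  then have "(sat z)\<^sup>2 \<le> (2 * R)\<^sup>2" by (simp add: power_mult_distrib)
  then have s: "\<bar>sat z\<bar> \<le> 2 * R" using assms abs_le_square_iff[of "sat z" "2 * R"] by simp
  then have "sat z = z" using assms by (intro sat_eq_if_abs_less_one) simp
  then show "\<bar>z\<bar> \<le> 2 * R" using s by simp
  have "H\<^sup>2 \<le> 25 * R\<^sup>2" using l zero_le_power2[of "sat z"] by linarith
  then have "H\<^sup>2 \<le> (5 * R)\<^sup>2" by (simp add: power_mult_distrib)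
  then show "\<bar>H\<bar> \<le> 5 * R" using assms abs_le_square_iff[of H "5 * R"] by simp
qed

text \<open>If the dissipation \<open>W\<close> were below the threshold, \<open>z\<close> would be
  unsaturated and small, \<open>H\<close> would be small too, and \<open>fast_lyap\<close> would not
  exceed the same threshold. Hence \<open>W\<close> is at least
  \<open>40000 * \<epsilon>\<^sup>2\<close>, and 1/200 of it outweighs the disturbance by 200 - 96 =
  104.\<close>

lemma fast_lyap_decrease:
  fixes z H d \<delta> \<epsilon> :: real
  assumes d: "\<bar>d\<bar> \<le> \<epsilon>" and \<delta>: "\<bar>\<delta>\<bar> \<le> \<epsilon>" and \<epsilon>: "\<epsilon> \<le> 1/2000"
    and V: "(200 * \<epsilon>)\<^sup>2 < fast_lyap z H"
  shows "3/16 * H * (sat z - sat (z + d)) - 3/16 * \<delta> * sat z - sat z * sat (z + d)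
      + 1/10 * sat (z + d) * arctan z - 1/10 * H * (1 / (1 + z\<^sup>2) * (3/16 * (H - \<delta>) - sat (z + d)))
    \<le> - 104 * \<epsilon>\<^sup>2"
proof -
  define Q where "Q = (200 * \<epsilon>)\<^sup>2"
  have \<epsilon>0: "0 \<le> \<epsilon>" using d by linarith
  have "200 * \<epsilon> \<le> 1 / 10" using \<epsilon> by simp
  then have "(200 * \<epsilon>)\<^sup>2 \<le> (1/10)\<^sup>2" using \<epsilon>0 by (intro power_mono) auto
  then have Q1: "Q \<le> 1 / 100" by (simp add: Q_def power2_eq_square)
  define W where "W = (sat z)\<^sup>2 + H\<^sup>2 / (1 + z\<^sup>2)"
  have "Q \<le> W"
  proof (rule ccontr)
    assume "\<not> ?thesis"
    then have lt: "(sat z)\<^sup>2 + H\<^sup>2 / (1 + z\<^sup>2) < Q" by (simp add: W_def)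
    have "0 \<le> H\<^sup>2 / (1 + z\<^sup>2)" by simp
    then have s: "(sat z)\<^sup>2 < Q" using lt by linarith
    then have "(sat z)\<^sup>2 < 1\<^sup>2" using Q1 by simp
    then have "\<bar>sat z\<bar> < 1" by (metis abs_square_less_1 one_power2)
    then have "sat z = z" by (rule sat_eq_if_abs_less_one)
    then have z: "z\<^sup>2 < Q" using s by simp
    have "H\<^sup>2 / (1 + z\<^sup>2) < Q" using lt zero_le_power2[of "sat z"] by linarith
    then have "H\<^sup>2 \<le> Q * (1 + z\<^sup>2)" by (simp add: add_pos_nonneg divide_less_eq less_imp_le)
    also have "\<dots> \<le> Q * (101/100)" using z Q1 by (intro mult_left_mono) (auto simp: Q_def)
    finally have H: "H\<^sup>2 \<le> 101/100 * Q" by simp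
    have "0 \<le> (\<bar>H\<bar> - \<bar>z\<bar>)\<^sup>2" by simp
    then have "\<bar>H\<bar> * \<bar>z\<bar> \<le> (H\<^sup>2 + z\<^sup>2) / 2" by (simp add: power2_diff)
    then have "fast_lyap z H \<le> Q" using fast_lyap_upper[of z H] H z zero_le_power2[of z] by argo
    then show False using V by (simp add: Q_def)
  qed
  moreover have "Q = 40000 * \<epsilon>\<^sup>2" by (simp add: Q_def power_mult_distrib)
  ultimately have "- (1/200) * W + 96 * \<epsilon>\<^sup>2 \<le> - 104 * \<epsilon>\<^sup>2"
    by linarith
  moreover have "\<epsilon> \<le> 1" using \<epsilon> by simp
  ultimately show ?thesis
    using double_integrator_dissipation[OF d \<delta>, of H z] unfolding W_def by (meson order_trans)
qed

section \<open>The gains, their orders of magnitude and the two Lyapunov functions\<close>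

locale tracking_gains =
  fixes D k \<beta> \<kappa>m :: real
  assumes D_pos: "0 < D" and \<beta>_gt: "8 < \<beta>" and \<kappa>m_ge: "1 \<le> \<kappa>m"
    and k_ge: "20000 * \<beta> * \<kappa>m\<^sup>2 \<le> k" and kD_ge: "2000 * \<kappa>m \<le> k * D"
begin

definition k1 :: real where "k1 = 3/16 * k\<^sup>2"
definition C2 :: real where "C2 = 1 / (2 * \<beta> * k)"
definition C1 :: real where "C1 = 3/16 * C2 / (4 * k)"
text \<open>A common bound for the two disturbances of the rescaled steering loop;
  \<open>kD_ge\<close> makes it at most 1/2000.\<close>

definition \<epsilon> :: real where "\<epsilon> = \<kappa>m / (k * D)"

lemma k_ge_\<beta>: "20000 * \<beta> * \<kappa>m \<le> k" and k_ge_\<kappa>m: "160000 * \<kappa>m \<le> k" and k_big: "160000 \<le> k"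
  and k_ge_\<kappa>m2: "20000 * \<kappa>m\<^sup>2 \<le> k"
proof -
  have b: "0 < \<beta>" using \<beta>_gt by simp
  have "\<kappa>m * 1 \<le> \<kappa>m * \<kappa>m" using \<kappa>m_ge by (intro mult_left_mono) auto
  then have m: "\<kappa>m \<le> \<kappa>m\<^sup>2" by (simp add: power2_eq_square)
  have "20000 * \<beta> * \<kappa>m \<le> 20000 * \<beta> * \<kappa>m\<^sup>2" using m b by (intro mult_left_mono) auto
  then show 1: "20000 * \<beta> * \<kappa>m \<le> k" using k_ge by linarith
  have "8 * \<kappa>m \<le> \<beta> * \<kappa>m" using \<beta>_gt \<kappa>m_ge by (intro mult_right_mono) auto
  then show 2: "160000 * \<kappa>m \<le> k" using 1 by linarith
  then show "160000 \<le> k" using \<kappa>m_ge by linarith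
  have "1 * \<kappa>m\<^sup>2 \<le> \<beta> * \<kappa>m\<^sup>2" using \<beta>_gt by (intro mult_right_mono) auto
  then show "20000 * \<kappa>m\<^sup>2 \<le> k" using k_ge by linarith
qed

lemma k_pos: "0 < k" using k_big by simp

lemma \<beta>_pos: "0 < \<beta>" using \<beta>_gt by simp

lemma C1_eq: "C1 = 3 / (128 * \<beta> * k\<^sup>2)"
  using k_pos \<beta>_pos by (simp add: C1_def C2_def power2_eq_square field_simps)

lemma k1_pos: "0 < k1" and C2_pos: "0 < C2" and C1_pos: "0 < C1"
  using k_pos \<beta>_pos by (auto simp: k1_def C2_def C1_eq)

lemma C1_le_one: "C1 \<le> 1"
proof -
  have "1 * 1 \<le> \<beta> * k\<^sup>2"
    using \<beta>_gt k_big by (intro mult_mono) (auto simp: one_le_power)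
  then show ?thesis using k_pos \<beta>_pos by (simp add: C1_eq field_simps)
qed

lemma \<epsilon>_pos: "0 < \<epsilon>" using k_pos D_pos \<kappa>m_ge by (simp add: \<epsilon>_def)

lemma \<epsilon>_le: "\<epsilon> \<le> 1/2000"
  using kD_ge k_pos D_pos by (simp add: \<epsilon>_def field_simps)

lemma disturbance_y2_le: "\<bar>C2 / D * sat y\<bar> \<le> \<epsilon>"
proof -
  have "\<bar>C2 / D * sat y\<bar> \<le> C2 / D"
    using C2_pos D_pos abs_sat_le_one[of y] by (simp add: abs_mult divide_right_mono mult_left_le)
  also have "\<dots> = 1 / (2 * \<beta>) / (k * D)" by (simp add: C2_def)
  also have "\<dots> \<le> \<kappa>m / (k * D)"
  proof (rule divide_right_mono)
    have "1 / (2 * \<beta>) \<le> 1" using \<beta>_gt by simp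
    then show "1 / (2 * \<beta>) \<le> \<kappa>m" using \<kappa>m_ge by linarith
  qed (use k_pos D_pos in simp)
  finally show ?thesis by (simp add: \<epsilon>_def)
qed

lemma disturbance_y1_le:
  assumes "\<bar>\<kappa>\<bar> \<le> \<kappa>m"
  shows "\<bar>k / D * (\<kappa> * C1 * sat y)\<bar> \<le> \<epsilon>"
proof -
  have "\<bar>\<kappa> * C1 * sat y\<bar> \<le> \<kappa>m * C1 * 1"
    unfolding abs_mult using assms C1_pos abs_sat_le_one[of y] \<kappa>m_ge by (intro mult_mono) auto
  then have "\<bar>k / D * (\<kappa> * C1 * sat y)\<bar> \<le> k / D * (\<kappa>m * C1)"
    unfolding abs_mult[of "k / D"] using k_pos D_pos by (simp add: divide_right_mono mult_left_mono)
  also have "\<dots> = \<kappa>m / (k * D) * (3 / (128 * \<beta>))"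
    using k_pos D_pos \<beta>_pos by (simp add: C1_eq power2_eq_square field_simps)
  also have "\<dots> \<le> \<kappa>m / (k * D) * 1"
    using k_pos D_pos \<beta>_gt \<kappa>m_ge by (intro mult_left_mono) auto
  finally show ?thesis by (simp add: \<epsilon>_def)
qed

definition inner_lyap :: "real \<Rightarrow> real \<Rightarrow> real" where
  "inner_lyap \<xi> \<eta> = fast_lyap ((k1 * \<xi> + k * \<eta>) / D) (k / D * \<eta>)"

text \<open>In this sublevel set |z| \<le> 400 \<epsilon> and |H| \<le> 1000 \<epsilon>. Since
  \<open>D * \<epsilon> = \<kappa>m / k\<close>, undoing the scaling gives bounds free of
  \<open>D\<close>, and 401 \<epsilon> < 1 leaves the control unsaturated.\<close>

lemma inner_lyap_small:
  assumes "inner_lyap \<xi> \<eta> \<le> (200 * \<epsilon>)\<^sup>2"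
  shows "\<bar>\<xi>\<bar> \<le> 8000 * \<kappa>m / k^3" "\<bar>\<eta>\<bar> \<le> 1000 * \<kappa>m / k\<^sup>2"
    and "D * sat (k1 / D * \<xi> + k / D * \<eta> + C2 / D * sat y2) = k1 * \<xi> + k * \<eta> + C2 * sat y2"
proof -
  define z where "z = (k1 * \<xi> + k * \<eta>) / D"
  define H where "H = k / D * \<eta>"
  have b: "\<bar>z\<bar> \<le> 2 * (200 * \<epsilon>)" "\<bar>H\<bar> \<le> 5 * (200 * \<epsilon>)"
    using fast_lyap_small[of z H "200 * \<epsilon>"] assms \<epsilon>_pos \<epsilon>_le by (auto simp: inner_lyap_def z_def H_def)
  have "\<eta> = D / k * H" using k_pos D_pos by (simp add: H_def)
  then have "\<bar>\<eta>\<bar> = D / k * \<bar>H\<bar>" using k_pos D_pos by (simp add: abs_mult)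
  also have "\<dots> \<le> D / k * (1000 * \<epsilon>)" using b k_pos D_pos by (intro mult_left_mono) auto
  also have "\<dots> = 1000 * \<kappa>m / k\<^sup>2" using k_pos D_pos by (simp add: \<epsilon>_def power2_eq_square)
  finally show "\<bar>\<eta>\<bar> \<le> 1000 * \<kappa>m / k\<^sup>2" .
  have "z - H = k1 * \<xi> / D" by (simp add: z_def H_def add_divide_distrib)
  then have "\<xi> = D / k1 * (z - H)" using k1_pos D_pos by simp
  then have "\<bar>\<xi>\<bar> = D / k1 * \<bar>z - H\<bar>" using k1_pos D_pos by (simp add: abs_mult)
  \<comment> \<open>400 + 1000 = 1400 is rounded up to 1500, so that the factor 16/3 in
    \<open>1 / k1\<close> yields the whole number 8000.\<close>
  also have "\<dots> \<le> D / k1 * (1500 * \<epsilon>)" using b \<epsilon>_pos k1_pos D_pos by (intro mult_left_mono) auto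
  also have "\<dots> = 8000 * \<kappa>m / k^3"
    using k_pos D_pos by (simp add: \<epsilon>_def k1_def power2_eq_square power3_eq_cube)
  finally show "\<bar>\<xi>\<bar> \<le> 8000 * \<kappa>m / k^3" .
  have eq: "k1 / D * \<xi> + k / D * \<eta> + C2 / D * sat y2 = z + C2 / D * sat y2"
    by (simp add: z_def add_divide_distrib)
  have "\<bar>z + C2 / D * sat y2\<bar> \<le> 1"
    using b \<epsilon>_le disturbance_y2_le[of y2] by linarith
  then show "D * sat (k1 / D * \<xi> + k / D * \<eta> + C2 / D * sat y2) = k1 * \<xi> + k * \<eta> + C2 * sat y2"
    unfolding eq using D_pos by (simp add: sat_eq z_def distrib_left[of D "_ / D"])
qed

text \<open>
  The choice \<open>a = 3/16\<close> gives the linear steering loop the eigenvalues \<open>- k/4\<close> and \<open>- 3k/4\<close>; the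
  coordinates \<open>k/4 \<xi> + \<eta>\<close> and \<open>3/4 k \<xi> + \<eta>\<close> diagonalise it.
\<close>

definition outer_lyap :: "real \<Rightarrow> real \<Rightarrow> real \<Rightarrow> real \<Rightarrow> real" where
  "outer_lyap y1 y2 \<xi> \<eta> = (y1\<^sup>2 + y2\<^sup>2) / 2 + y2 * (\<eta> + k * \<xi>) / k1 + k / k1 * C1 * sat_prim y1
     + ((k / 4 * \<xi> + \<eta>)\<^sup>2 + (3/4 * k * \<xi> + \<eta>)\<^sup>2) / 2"

text \<open>The smallness conditions consumed by the estimates near the origin. The orders are
  1/(\<beta> k^2) for \<open>C1\<close>, 1/(\<beta> k^3) for \<open>C2 / k1\<close>, and, after
  capture, \<kappa>m/k^3 for \<open>\<xi>\<close> and \<kappa>m/k^2 for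
  \<open>\<eta>\<close>.\<close>

lemma k_ineqs:
  "64 * k * \<kappa>m\<^sup>2 * C1 \<le> 1"
  "(8000 * \<kappa>m / k^3)\<^sup>2 / 2 \<le> C1 / 8"
  "22 * \<kappa>m / k^3 \<le> C1 / 8"
  "6 * \<kappa>m * C1 / k \<le> 1 / 8"
  "8 * C2\<^sup>2 / k \<le> C2 / k1 / 4"
  "(8000 * \<kappa>m / k^3)^3 \<le> C2 / k1 / 8"
  "6 * \<kappa>m * C1\<^sup>2 / k \<le> C2 / k1 / 8"
  "8000 * \<kappa>m / k^3 \<le> 1 / k\<^sup>2"
  "13000 * \<kappa>m / k\<^sup>2 \<le> 1 / k"
proof -
  have k0: "0 < k" by (rule k_pos)
  have b0: "0 < \<beta>" by (rule \<beta>_pos)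
  have c2: "C2 / k1 = 8 / (3 * \<beta> * k^3)"
    using k0 b0 by (simp add: C2_def k1_def power2_eq_square power3_eq_cube field_simps)
  have bk: "20000 * \<beta> \<le> k"
  proof -
    have "\<beta> * 1 \<le> \<beta> * \<kappa>m" using \<kappa>m_ge b0 by (intro mult_left_mono) auto
    then show ?thesis using k_ge_\<beta> by linarith
  qed
  show i9: "13000 * \<kappa>m / k\<^sup>2 \<le> 1 / k"
    using k_ge_\<kappa>m k0 \<kappa>m_ge by (simp add: field_simps power2_eq_square)
  have "8000 * \<kappa>m \<le> k" using k_ge_\<kappa>m \<kappa>m_ge by linarith
  then show i8: "8000 * \<kappa>m / k^3 \<le> 1 / k\<^sup>2"
    using k0 by (simp add: divide_simps power2_eq_square power3_eq_cube)
  have n8: "0 \<le> 8000 * \<kappa>m / k^3" using k0 \<kappa>m_ge by simp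
  have "3 * \<kappa>m\<^sup>2 \<le> 2 * \<beta> * k"
  proof -
    have "3 * \<kappa>m\<^sup>2 \<le> k" using k_ge_\<kappa>m2 zero_le_power2[of \<kappa>m] by linarith
    also have "\<dots> \<le> 2 * \<beta> * k" using \<beta>_gt k0 by simp
    finally show ?thesis .
  qed
  then show "64 * k * \<kappa>m\<^sup>2 * C1 \<le> 1"
    using k0 b0 by (simp add: C1_eq power2_eq_square field_simps)
  have "(8000 * \<kappa>m / k^3)\<^sup>2 \<le> (1 / k\<^sup>2)\<^sup>2" using i8 n8 by (rule power_mono)
  moreover have "(1 / k\<^sup>2)\<^sup>2 / 2 \<le> C1 / 8"
  proof -
    have "512 * \<beta> \<le> 3 * k" using bk k0 by linarith
    also have "\<dots> \<le> 3 * (k * k)" using k_big by simp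
    finally show ?thesis using k0 b0 by (simp add: C1_eq power2_eq_square field_simps)
  qed
  ultimately show "(8000 * \<kappa>m / k^3)\<^sup>2 / 2 \<le> C1 / 8" by linarith
  have "22528 * (\<beta> * \<kappa>m) \<le> 3 * k"
    using k_ge_\<beta> k0 by simp
  then show "22 * \<kappa>m / k^3 \<le> C1 / 8"
    using k0 b0 by (simp add: C1_eq power2_eq_square power3_eq_cube field_simps)
  have "\<kappa>m * C1 / k \<le> 1 / 48"
  proof -
    have "\<kappa>m / k \<le> 1 / 48" using k_ge_\<kappa>m k0 \<kappa>m_ge by (simp add: field_simps)
    then have "C1 * (\<kappa>m / k) \<le> 1 * (1/48)" using C1_pos C1_le_one \<kappa>m_ge k0 by (intro mult_mono) auto
    then show ?thesis by (simp add: mult.commute)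
  qed
  moreover have "6 * \<kappa>m * C1 / k = 6 * (\<kappa>m * C1 / k)" by simp
  ultimately show "6 * \<kappa>m * C1 / k \<le> 1 / 8" by linarith
  \<comment> \<open>Both sides are of order k^-3, so the size of \<open>k\<close> cannot help: after
    cancelling, the claim reads 3 \<le> \<beta>.\<close>
  show "8 * C2\<^sup>2 / k \<le> C2 / k1 / 4"
    unfolding c2 using k0 b0 \<beta>_gt by (simp add: C2_def power2_eq_square power3_eq_cube field_simps)
  have "(8000 * \<kappa>m / k^3)^3 \<le> (1 / k\<^sup>2)^3" using i8 n8 by (rule power_mono)
  moreover have "(1 / k\<^sup>2)^3 \<le> C2 / k1 / 8"
  proof -
    have "3 * \<beta> \<le> k" using bk b0 by linarith
    also have "\<dots> \<le> k^3" using k_big by (simp add: power_increasing[of 1 3 k, simplified])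
    finally have "3 * \<beta> \<le> k^3" .
    then have "3 * \<beta> * k^3 \<le> k^3 * k^3" using k0 by (intro mult_right_mono) auto
    also have "\<dots> = k^6" by (simp add: power_add[symmetric])
    finally have "3 * \<beta> * k^3 \<le> k^6" .
    then have "1 / k^6 \<le> 1 / (3 * \<beta> * k^3)" using k0 b0 by (intro divide_left_mono) auto
    then show ?thesis unfolding c2 by (simp add: power_divide power_mult[symmetric])
  qed
  ultimately show "(8000 * \<kappa>m / k^3)^3 \<le> C2 / k1 / 8" by linarith
  have "6 * \<kappa>m * C1\<^sup>2 / k \<le> 6 * k * C1\<^sup>2 / k"
    using k_ge_\<kappa>m k0 \<kappa>m_ge by (intro divide_right_mono mult_right_mono) auto
  also have "\<dots> = 6 * C1\<^sup>2" using k0 by simp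
  also have "\<dots> = 54 / (16384 * \<beta>\<^sup>2 * k^4)"
    by (simp add: C1_eq power_divide power_mult_distrib power_mult[symmetric])
  also have "\<dots> \<le> 1 / (3 * \<beta> * k^3)"
  proof -
    have "162 * (\<beta> * k^3) \<le> 16384 * (\<beta> * \<beta>) * (k * k^3)"
    proof -
      have "162 \<le> 16384 * (\<beta> * k)" using k_big \<beta>_gt mult_mono[of 1 \<beta> 1 k] by simp
      then have "162 * (\<beta> * k^3) \<le> 16384 * (\<beta> * k) * (\<beta> * k^3)"
        using b0 k0 by (intro mult_right_mono) auto
      then show ?thesis by (simp add: algebra_simps)
    qed
    then show ?thesis using k0 b0 
      by (simp add: divide_simps power2_eq_square numeral_eq_Suc algebra_simps)
  qed
  also have "\<dots> = C2 / k1 / 8" by (simp add: c2)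
  finally show "6 * \<kappa>m * C1\<^sup>2 / k \<le> C2 / k1 / 8" .
qed

end

section \<open>Decay of the full error once the steering loop is unsaturated\<close>

lemma one_minus_cos_le: "1 - cos x \<le> x\<^sup>2 / 2" for x :: real
proof -
  have "1 - cos x = 2 * (sin (x / 2))\<^sup>2"
    using cos_double_sin[of "x / 2"] by simp
  also have "\<dots> \<le> 2 * (x / 2)\<^sup>2"
    using abs_sin_x_le_abs_x[of "x / 2"] by (simp only: abs_le_square_iff)
  finally show ?thesis by (simp add: power_divide)
qed

lemma abs_sin_minus_self_le: "\<bar>sin x - x\<bar> \<le> \<bar>x\<bar> ^ 3" for x :: real
proof -
  have "\<bar>sin x - (\<Sum>m<3. sin_coeff m * x ^ m)\<bar> \<le> inverse (fact 3) * \<bar>x\<bar> ^ 3"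
    by (rule Maclaurin_sin_bound)
  moreover have "(\<Sum>m<3. sin_coeff m * x ^ m) = x"
    by (simp add: sin_coeff_def numeral_3_eq_3)
  moreover have "inverse (fact 3) * \<bar>x\<bar> ^ 3 \<le> 1 * \<bar>x\<bar> ^ 3"
    by (intro mult_right_mono) (auto simp: fact_numeral)
  ultimately show ?thesis by simp
qed

text \<open>Young's inequality as long as \<open>sat y = y\<close>. For |y| > 1 the term
  \<open>y * sat y\<close> grows only linearly, but then the bound on \<open>n\<close> is
  enough.\<close>

lemma abs_mult_le_sat:
  fixes y n k :: real
  assumes "0 \<le> n" "n \<le> 1 / k" "0 < k"
  shows "\<bar>y\<bar> * n \<le> y * sat y / k + k * n\<^sup>2"
proof (cases "\<bar>y\<bar> \<le> 1")
  case True
  have "0 \<le> (\<bar>y\<bar> - k * n)\<^sup>2" by simp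
  then have "\<bar>y\<bar> * n * k * 2 \<le> y * y + k * n * (k * n)"
    by (simp add: power2_eq_square algebra_simps)
  moreover have "0 \<le> y * y + k * n * (k * n)" by simp
  ultimately have "\<bar>y\<bar> * n * k \<le> y * y + k * n * (k * n)" by linarith
  then show ?thesis using True assms by (simp add: sat_eq field_simps power2_eq_square)
next
  case False
  then have "y * sat y = \<bar>y\<bar>" by (auto simp: sat_clamp)
  moreover have "\<bar>y\<bar> * n \<le> \<bar>y\<bar> * (1 / k)" using assms by (intro mult_left_mono) auto
  ultimately show ?thesis using assms by (simp add: add_increasing2)
qed

context tracking_gains
begin

text \<open>Bounds the forcing of one diagonal steering coordinate \<open>w\<close> by the saturated
  position errors. Each of the two products spends \<open>k / 16 * w\<^sup>2\<close>; the quadratic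
  terms left over are small by the first and fifth of \<open>k_ineqs\<close>.\<close>

lemma mult_fast_le:
  "\<bar>w\<bar> * (k * \<kappa>m * C1 * \<bar>s1\<bar> + C2 * \<bar>s2\<bar>)
    \<le> k / 8 * w\<^sup>2 + C1 * s1\<^sup>2 / 16 + C2 / k1 / 8 * s2\<^sup>2" for s1 s2 w :: real
proof -
  have "0 \<le> k / 16 * (\<bar>w\<bar> - 8 * (\<kappa>m * C1 * \<bar>s1\<bar>))\<^sup>2" using k_pos by simp
  then have 1: "\<bar>w\<bar> * (k * \<kappa>m * C1 * \<bar>s1\<bar>) \<le> k / 16 * w\<^sup>2 + 4 * k * (\<kappa>m * C1 * s1)\<^sup>2"
    by (simp add: power2_diff power_mult_distrib algebra_simps)
  have "4 * k * (\<kappa>m * C1 * s1)\<^sup>2 = (64 * k * \<kappa>m\<^sup>2 * C1) * (C1 * s1\<^sup>2 / 16)"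
    by (simp add: power2_eq_square)
  also have "\<dots> \<le> 1 * (C1 * s1\<^sup>2 / 16)"
    using k_ineqs(1) C1_pos by (intro mult_right_mono) auto
  finally have 2: "4 * k * (\<kappa>m * C1 * s1)\<^sup>2 \<le> C1 * s1\<^sup>2 / 16" by simp
  have "0 \<le> (k * \<bar>w\<bar> - 8 * (C2 * \<bar>s2\<bar>))\<^sup>2" by simp
  then have "16 * k * (\<bar>w\<bar> * (C2 * \<bar>s2\<bar>)) \<le> k\<^sup>2 * w\<^sup>2 + 64 * C2\<^sup>2 * s2\<^sup>2"
    by (simp add: power2_diff power_mult_distrib mult_ac)
  then have 3: "\<bar>w\<bar> * (C2 * \<bar>s2\<bar>) \<le> k / 16 * w\<^sup>2 + 4 * C2\<^sup>2 / k * s2\<^sup>2"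
    using k_pos by (simp add: field_simps power2_eq_square)
  have "4 * C2\<^sup>2 / k * s2\<^sup>2 = (8 * C2\<^sup>2 / k) * (s2\<^sup>2 / 2)" by simp
  also have "\<dots> \<le> (C2 / k1 / 4) * (s2\<^sup>2 / 2)" by (intro mult_right_mono k_ineqs(5)) auto
  finally have 4: "4 * C2\<^sup>2 / k * s2\<^sup>2 \<le> C2 / k1 / 8 * s2\<^sup>2" by simp
  have "\<bar>w\<bar> * (k * \<kappa>m * C1 * \<bar>s1\<bar> + C2 * \<bar>s2\<bar>)
      = \<bar>w\<bar> * (k * \<kappa>m * C1 * \<bar>s1\<bar>) + \<bar>w\<bar> * (C2 * \<bar>s2\<bar>)" by (simp add: distrib_left)
  then show ?thesis using 1 2 3 4 by linarith
qed

text \<open>The left side is the derivative of \<open>outer_lyap\<close> along the unsaturated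
  field. The remainders \<open>T1\<close> to \<open>T6\<close> and the forcing inside
  \<open>T7\<close> are charged to fractions of \<open>C1 * (y1 * s1)\<close> and
  \<open>b * (y2 * s2)\<close> and to multiples of \<open>N\<^sup>2\<close>; the dissipation of the
  steering coordinates carries a factor \<open>k\<close> and outweighs the latter.\<close>

lemma outer_dissipation:
  fixes y1 y2 \<xi> \<eta> \<kappa> :: real
  defines "s1 \<equiv> sat y1" and "s2 \<equiv> sat y2"
    and "wa \<equiv> k / 4 * \<xi> + \<eta>" and "wb \<equiv> 3/4 * k * \<xi> + \<eta>"
  defines "f1 \<equiv> - C1 * s1 + (cos \<xi> - 1) + \<kappa> * (1 + C1 * s1) * y2"
    and "f2 \<equiv> sin \<xi> - \<kappa> * (1 + C1 * s1) * y1"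
    and "f3 \<equiv> \<eta> - \<kappa> * C1 * s1"
    and "f4 \<equiv> - (k1 * \<xi> + k * \<eta> + C2 * s2)"
  assumes \<xi>: "\<bar>\<xi>\<bar> \<le> 8000 * \<kappa>m / k^3" and \<eta>: "\<bar>\<eta>\<bar> \<le> 1000 * \<kappa>m / k\<^sup>2" and \<kappa>: "\<bar>\<kappa>\<bar> \<le> \<kappa>m"
  shows "y1 * f1 + y2 * f2 + (f2 * (\<eta> + k * \<xi>) + y2 * (f4 + k * f3)) / k1 + k / k1 * C1 * (s1 * f1)
      + wa * (k / 4 * f3 + f4) + wb * (3/4 * k * f3 + f4)
    \<le> - (C1 / 2) * (y1 * s1) - (C2 / k1 / 2) * (y2 * s2) - k / 16 * (wa\<^sup>2 + wb\<^sup>2)"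
    (is "?G \<le> _")
proof -
  define N where "N = sqrt (wa\<^sup>2 + wb\<^sup>2)"
  define b where "b = C2 / k1"
  define P where "P = \<eta> + k * \<xi>"
  have k0: "0 < k" by (rule k_pos)
  have N2: "N\<^sup>2 = wa\<^sup>2 + wb\<^sup>2" and N0: "0 \<le> N" by (auto simp: N_def)
  have wN: "\<bar>wa\<bar> \<le> N" "\<bar>wb\<bar> \<le> N"
    by (auto simp: N_def intro!: real_le_rsqrt)
  have kxi: "k * \<xi> = 2 * (wb - wa)" by (simp add: wa_def wb_def algebra_simps)
  have "\<bar>k * \<xi>\<bar> \<le> 4 * N" unfolding kxi by (intro abs_leI) (use wN in \<open>auto simp: abs_le_iff\<close>)
  then have xiN: "\<bar>\<xi>\<bar> \<le> 4 * N / k" using k0 by (simp add: abs_mult field_simps)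
  have "2 * P = 3 * wb - wa" by (simp add: P_def wa_def wb_def algebra_simps)
  then have PN: "\<bar>P\<bar> \<le> 2 * N" using wN by linarith
  have b0: "0 < b" using C2_pos k1_pos by (simp add: b_def)
  have s1y: "s1\<^sup>2 \<le> y1 * s1" "0 \<le> y1 * s1" and s2y: "s2\<^sup>2 \<le> y2 * s2" "0 \<le> y2 * s2"
    by (auto simp: s1_def s2_def sat_sq_le sat_nonneg)
  have a1: "\<bar>s1\<bar> \<le> 1" and a2: "\<bar>s2\<bar> \<le> 1" by (auto simp: s1_def s2_def abs_sat_le_one)
  have "\<bar>\<xi>\<bar> \<le> 1 / k\<^sup>2" using \<xi> k_ineqs(8) by linarith
  moreover have "1 / k\<^sup>2 \<le> 1" using k_big by simp
  ultimately have xi1: "\<bar>\<xi>\<bar> \<le> 1" by linarith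
  have xi2N: "\<xi>\<^sup>2 \<le> N\<^sup>2 / 2"
  proof -
    have "\<bar>\<xi>\<bar> \<le> N / 2"
    proof -
      have "4 * N / k \<le> N / 2" using k_big N0 mult_left_mono[of 8 k N] by (simp add: field_simps)
      then show ?thesis using xiN by linarith
    qed
    then have "\<bar>\<xi>\<bar>\<^sup>2 \<le> (N / 2)\<^sup>2" by (intro power_mono) auto
    then have "\<xi>\<^sup>2 \<le> N\<^sup>2 / 4" by (simp add: power_divide)
    then show ?thesis using zero_le_power2[of N] by linarith
  qed
  have xi2: "\<xi>\<^sup>2 / 2 \<le> C1 / 8"
  proof -
    have "\<bar>\<xi>\<bar>\<^sup>2 \<le> (8000 * \<kappa>m / k^3)\<^sup>2" using \<xi> by (intro power_mono) auto
    then show ?thesis using k_ineqs(2) by simp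
  qed
  have xi3: "\<bar>\<xi>\<bar>^3 \<le> b / 8"
  proof -
    have "\<bar>\<xi>\<bar>^3 \<le> (8000 * \<kappa>m / k^3)^3" using \<xi> by (intro power_mono) auto
    then show ?thesis using k_ineqs(6) by (simp add: b_def)
  qed
  have xi3N: "\<bar>\<xi>\<bar>^3 \<le> N\<^sup>2 / 2"
  proof -
    have "\<bar>\<xi>\<bar>^3 \<le> \<bar>\<xi>\<bar>^2" using xi1 by (intro power_decreasing) auto
    then show ?thesis using xi2N by simp
  qed
  \<comment> \<open>The side condition of \<open>abs_mult_le_sat\<close>, for the product of |y1|
    and \<open>N\<close> in \<open>T4\<close>. |wa| and |wb| add up to at most 10000 \<kappa>m/k^2,
    within the 13000 covered by \<open>k_ineqs\<close>.\<close>
  have Nk: "N \<le> 1 / k"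
  proof -
    have "\<bar>k * \<xi>\<bar> \<le> 8000 * \<kappa>m / k\<^sup>2"
    proof -
      have "k * \<bar>\<xi>\<bar> \<le> k * (8000 * \<kappa>m / k^3)" using \<xi> k0 by (intro mult_left_mono) auto
      also have "\<dots> = 8000 * \<kappa>m / k\<^sup>2" using k0 by (simp add: power2_eq_square power3_eq_cube)
      finally show ?thesis using k0 by (simp add: abs_mult)
    qed
    then have "\<bar>k * \<xi>\<bar> \<le> 8000 * (\<kappa>m / k\<^sup>2)" "\<bar>\<eta>\<bar> \<le> 1000 * (\<kappa>m / k\<^sup>2)" using \<eta> by simp_all
    moreover have "wa = (k * \<xi>) / 4 + \<eta>" "wb = 3 * (k * \<xi>) / 4 + \<eta>" by (simp_all add: wa_def wb_def)
    ultimately have "\<bar>wa\<bar> \<le> 3000 * (\<kappa>m / k\<^sup>2)" "\<bar>wb\<bar> \<le> 7000 * (\<kappa>m / k\<^sup>2)" by linarith+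
    moreover have "N \<le> \<bar>wa\<bar> + \<bar>wb\<bar>" by (simp add: N_def sqrt_sum_squares_le_sum_abs)
    moreover have "0 \<le> \<kappa>m / k\<^sup>2" using \<kappa>m_ge by simp
    ultimately have "N \<le> 13000 * (\<kappa>m / k\<^sup>2)" by linarith
    then show ?thesis using k_ineqs(9) by simp
  qed
  have co: "0 \<le> 1 - cos \<xi>" "1 - cos \<xi> \<le> \<xi>\<^sup>2 / 2" using one_minus_cos_le by auto
  \<comment> \<open>After |y1| \<le> y1 s1 + 1, two bounds on \<open>\<xi>\<^sup>2\<close> are used:
    the a priori one turns the first part into a fraction of the dissipation, the one by
    \<open>N\<^sup>2\<close> handles the constant, whose contribution must vanish at the origin.
    \<open>T2\<close> does the same with |\<xi>|^3.\<close>
  have T1: "y1 * (cos \<xi> - 1) \<le> C1 / 8 * (y1 * s1) + N\<^sup>2 / 4"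
  proof -
    have "y1 * (cos \<xi> - 1) \<le> \<bar>y1\<bar> * (1 - cos \<xi>)"
      using co abs_ge_self[of "y1 * (cos \<xi> - 1)"] by (simp add: abs_mult)
    also have "\<dots> \<le> (y1 * s1 + 1) * (\<xi>\<^sup>2 / 2)"
      using co abs_le_mult_sat[of y1] s1y unfolding s1_def by (intro mult_mono) auto
    also have "\<dots> = y1 * s1 * (\<xi>\<^sup>2 / 2) + \<xi>\<^sup>2 / 2" by (simp add: algebra_simps)
    also have "\<dots> \<le> y1 * s1 * (C1 / 8) + N\<^sup>2 / 4"
      using xi2 xi2N s1y by (intro add_mono mult_left_mono) auto
    finally show ?thesis by (simp add: mult.commute)
  qed
  have T2: "y2 * (sin \<xi> - \<xi>) \<le> b / 8 * (y2 * s2) + N\<^sup>2 / 2"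
  proof -
    have "y2 * (sin \<xi> - \<xi>) \<le> \<bar>y2\<bar> * \<bar>sin \<xi> - \<xi>\<bar>" unfolding abs_mult[symmetric] by simp
    also have "\<dots> \<le> (y2 * s2 + 1) * \<bar>\<xi>\<bar>^3"
      using abs_sin_minus_self_le abs_le_mult_sat[of y2] s2y unfolding s2_def by (intro mult_mono) auto
    also have "\<dots> = y2 * s2 * \<bar>\<xi>\<bar>^3 + \<bar>\<xi>\<bar>^3" by (simp add: algebra_simps)
    also have "\<dots> \<le> y2 * s2 * (b / 8) + N\<^sup>2 / 2"
      using xi3 xi3N s2y by (intro add_mono mult_left_mono) auto
    finally show ?thesis by (simp add: mult.commute)
  qed
  have k1i: "1 / k1 = 16 / (3 * k\<^sup>2)" by (simp add: k1_def)
  have T3: "sin \<xi> * P / k1 \<le> N\<^sup>2"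
  proof -
    have "sin \<xi> * P \<le> \<bar>sin \<xi>\<bar> * \<bar>P\<bar>" unfolding abs_mult[symmetric] by simp
    also have "\<dots> \<le> (4 * N / k) * (2 * N)"
      using PN xiN abs_sin_x_le_abs_x[of \<xi>] N0 k0 by (intro mult_mono) auto
    also have "\<dots> = 8 / k * N\<^sup>2" by (simp add: power2_eq_square)
    also have "\<dots> \<le> k1 * N\<^sup>2"
    proof (rule mult_right_mono)
      have "1 \<le> k1" using k_big power_mono[of 160000 k 2] by (simp add: k1_def)
      moreover have "8 / k \<le> 1" using k_big by simp
      ultimately show "8 / k \<le> k1" by linarith
    qed simp
    finally show ?thesis using k1_pos by (simp add: field_simps)
  qed
  have mu: "\<bar>\<kappa> * (1 + C1 * s1)\<bar> \<le> 2 * \<kappa>m"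
  proof -
    have "\<bar>C1 * s1\<bar> \<le> 1 * 1" unfolding abs_mult using C1_le_one C1_pos a1 by (intro mult_mono) auto
    then have "\<bar>1 + C1 * s1\<bar> \<le> 2" by linarith
    then have "\<bar>\<kappa>\<bar> * \<bar>1 + C1 * s1\<bar> \<le> \<kappa>m * 2" using \<kappa> \<kappa>m_ge by (intro mult_mono) auto
    then show ?thesis by (simp add: abs_mult)
  qed
  have T4: "- (\<kappa> * (1 + C1 * s1) * y1 * P / k1) \<le> C1 / 8 * (y1 * s1) + N\<^sup>2"
  proof -
    have "- (\<kappa> * (1 + C1 * s1) * y1 * P) \<le> \<bar>\<kappa> * (1 + C1 * s1)\<bar> * \<bar>y1\<bar> * \<bar>P\<bar>"
      unfolding abs_mult[symmetric] by simp
    also have "\<dots> \<le> (2 * \<kappa>m) * \<bar>y1\<bar> * (2 * N)"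
      using mu PN \<kappa>m_ge by (intro mult_mono) auto
    also have "\<dots> = 4 * \<kappa>m * (\<bar>y1\<bar> * N)" by simp
    also have "\<dots> \<le> 4 * \<kappa>m * (y1 * s1 / k + k * N\<^sup>2)"
      using abs_mult_le_sat[OF N0 Nk k0, of y1] \<kappa>m_ge unfolding s1_def by (intro mult_left_mono) auto
    finally have "- (\<kappa> * (1 + C1 * s1) * y1 * P) * (1 / k1) \<le> 4 * \<kappa>m * (y1 * s1 / k + k * N\<^sup>2) * (1 / k1)"
      using k1_pos by (intro mult_right_mono) auto
    also have "\<dots> = (64 / 3 * \<kappa>m / k^3) * (y1 * s1) + (64/3 * \<kappa>m / k) * N\<^sup>2"
      unfolding k1i using k0 by (simp add: field_simps power2_eq_square power3_eq_cube)
    also have "\<dots> \<le> (C1 / 8) * (y1 * s1) + 1 * N\<^sup>2"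
    proof (intro add_mono mult_right_mono)
      have "64 / 3 * \<kappa>m / k^3 \<le> 22 * \<kappa>m / k^3"
        using k0 \<kappa>m_ge by (intro divide_right_mono mult_right_mono) auto
      then show "64 / 3 * \<kappa>m / k^3 \<le> C1 / 8" using k_ineqs(3) by linarith
      show "64/3 * \<kappa>m / k \<le> 1" using k_ge_\<kappa>m k0 \<kappa>m_ge by (simp add: field_simps)
    qed (use s1y in auto)
    finally show ?thesis by simp
  qed
  have T5: "k / k1 * \<kappa> * C1\<^sup>2 * s1\<^sup>2 * y2 \<le> b / 8 * (y2 * s2) + C1 / 8 * (y1 * s1)"
  proof -
    have kk: "k / k1 \<le> 6 / k" using k0 by (simp add: k1_def field_simps power2_eq_square)
    have "k / k1 * \<kappa> * C1\<^sup>2 * s1\<^sup>2 * y2 \<le> \<bar>k / k1 * \<kappa> * C1\<^sup>2 * s1\<^sup>2 * y2\<bar>" by (rule abs_ge_self)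
    also have "\<dots> = k / k1 * \<bar>\<kappa>\<bar> * C1\<^sup>2 * s1\<^sup>2 * \<bar>y2\<bar>" using k0 k1_pos by (simp add: abs_mult)
    also have "\<dots> \<le> (6 / k) * \<kappa>m * C1\<^sup>2 * s1\<^sup>2 * (y2 * s2 + 1)"
      using kk \<kappa> k0 k1_pos \<kappa>m_ge abs_le_mult_sat[of y2] unfolding s2_def by (intro mult_mono) auto
    also have "\<dots> = (6 * \<kappa>m * C1\<^sup>2 / k) * (s1\<^sup>2 * (y2 * s2)) + (6 * \<kappa>m * C1 / k) * (C1 * s1\<^sup>2)"
      by (simp add: power2_eq_square algebra_simps add_divide_distrib)
    also have "\<dots> \<le> (b / 8) * (1 * (y2 * s2)) + (1 / 8) * (C1 * (y1 * s1))"
    proof (rule add_mono)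
      have "s1\<^sup>2 * (y2 * s2) \<le> 1 * (y2 * s2)"
        using a1 s2y by (intro mult_right_mono) (auto simp: abs_square_le_1)
      then show "(6 * \<kappa>m * C1\<^sup>2 / k) * (s1\<^sup>2 * (y2 * s2)) \<le> (b / 8) * (1 * (y2 * s2))"
        by (rule mult_mono[rotated]) (use k_ineqs(7) b0 s2y in \<open>auto simp: b_def\<close>)
      have "C1 * s1\<^sup>2 \<le> C1 * (y1 * s1)" using C1_pos s1y by (intro mult_left_mono) auto
      then show "(6 * \<kappa>m * C1 / k) * (C1 * s1\<^sup>2) \<le> (1 / 8) * (C1 * (y1 * s1))"
        by (rule mult_mono[rotated]) (use k_ineqs(4) C1_pos in auto)
    qed
    finally show ?thesis by simp
  qed
  have T6: "k / k1 * C1 * (s1 * (cos \<xi> - 1)) \<le> N\<^sup>2"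
  proof -
    have "s1 * (cos \<xi> - 1) \<le> \<bar>s1\<bar> * (1 - cos \<xi>)"
      using co abs_ge_self[of "s1 * (cos \<xi> - 1)"] by (simp add: abs_mult)
    also have "\<dots> \<le> 1 * (\<xi>\<^sup>2 / 2)" using a1 co by (intro mult_mono) auto
    also have "\<dots> \<le> N\<^sup>2" using xi2N zero_le_power2[of N] by linarith
    finally have 1: "s1 * (cos \<xi> - 1) \<le> N\<^sup>2" .
    have kk: "k / k1 \<le> 1" using k_big by (simp add: k1_def field_simps power2_eq_square)
    have "k / k1 * C1 \<le> 1 * 1" using kk C1_le_one C1_pos k0 k1_pos by (intro mult_mono) auto
    then have "k / k1 * C1 * N\<^sup>2 \<le> 1 * N\<^sup>2" by (intro mult_right_mono) auto
    moreover have "k / k1 * C1 * (s1 * (cos \<xi> - 1)) \<le> k / k1 * C1 * N\<^sup>2"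
      using 1 C1_pos k0 k1_pos by (intro mult_left_mono) auto
    ultimately show ?thesis by simp
  qed
  have fast: "- (w * (c * k * \<kappa> * C1 * s1 + C2 * s2)) \<le> k / 8 * w\<^sup>2 + C1 * s1\<^sup>2 / 16 + b / 8 * s2\<^sup>2"
    if c: "0 \<le> c" "c \<le> 1" for c w
  proof -
    have "- (w * (c * k * \<kappa> * C1 * s1 + C2 * s2)) \<le> \<bar>w\<bar> * \<bar>c * k * \<kappa> * C1 * s1 + C2 * s2\<bar>"
      unfolding abs_mult[symmetric] by simp
    also have "\<dots> \<le> \<bar>w\<bar> * (k * \<kappa>m * C1 * \<bar>s1\<bar> + C2 * \<bar>s2\<bar>)"
    proof (intro mult_left_mono)
      have "\<bar>c * k * \<kappa> * C1 * s1\<bar> \<le> 1 * k * \<kappa>m * C1 * \<bar>s1\<bar>"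
        unfolding abs_mult using c k0 C1_pos \<kappa> \<kappa>m_ge by (intro mult_mono) auto
      moreover have "\<bar>C2 * s2\<bar> = C2 * \<bar>s2\<bar>" using C2_pos by (simp add: abs_mult)
      ultimately show "\<bar>c * k * \<kappa> * C1 * s1 + C2 * s2\<bar> \<le> k * \<kappa>m * C1 * \<bar>s1\<bar> + C2 * \<bar>s2\<bar>" by linarith
    qed simp
    also note mult_fast_le
    finally show ?thesis by (simp add: b_def)
  qed
  \<comment> \<open>\<open>wa\<close> and \<open>wb\<close> are left eigenvectors of the linear
    steering loop for the eigenvalues -3k/4 and -k/4, so each is forced by \<open>s1\<close> and
    \<open>s2\<close> alone.\<close>
  have wa': "wa * (k / 4 * f3 + f4) = - (3/4) * k * wa\<^sup>2 - wa * (1/4 * k * \<kappa> * C1 * s1 + C2 * s2)"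
    by (simp add: wa_def f3_def f4_def k1_def power2_eq_square field_simps)
  have wb': "wb * (3/4 * k * f3 + f4) = - (1/4) * k * wb\<^sup>2 - wb * (3/4 * k * \<kappa> * C1 * s1 + C2 * s2)"
    by (simp add: wb_def f3_def f4_def k1_def power2_eq_square field_simps)
  have T7: "wa * (k / 4 * f3 + f4) + wb * (3/4 * k * f3 + f4)
      \<le> - (k / 8) * N\<^sup>2 + C1 / 8 * s1\<^sup>2 + b / 4 * s2\<^sup>2"
  proof -
    have "- (3/4) * k * wa\<^sup>2 \<le> - (1/4) * k * wa\<^sup>2" using k0 by simp
    then show ?thesis
      using fast[of "1/4" wa] fast[of "3/4" wb] unfolding wa' wb' N2 by (simp add: algebra_simps)
  qed
  \<comment> \<open>The rotation drops out of \<open>y1 * f1 + y2 * f2\<close>. In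
    \<open>y2 * (f4 + k * f3) / k1\<close> the terms with \<open>\<eta>\<close> drop out and
    \<open>- y2 * \<xi>\<close> meets \<open>y2 * sin \<xi>\<close>. The remaining
    \<open>- k / k1 * \<kappa> * C1 * s1 * y2\<close> is matched by the \<open>sat_prim\<close> part
    up to the factor \<open>1 + C1 * s1\<close>, whose second summand leaves the term of
    \<open>T5\<close>.\<close>
  have id: "y1 * f1 + y2 * f2 + (f2 * P + y2 * (f4 + k * f3)) / k1 + k / k1 * C1 * (s1 * f1)
      = - C1 * (y1 * s1) + y1 * (cos \<xi> - 1) + y2 * (sin \<xi> - \<xi>) + sin \<xi> * P / k1
        + - (\<kappa> * (1 + C1 * s1) * y1 * P / k1) - b * (y2 * s2) + k / k1 * \<kappa> * C1\<^sup>2 * s1\<^sup>2 * y2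
        - k / k1 * C1\<^sup>2 * s1\<^sup>2 + k / k1 * C1 * (s1 * (cos \<xi> - 1))"
    using k1_pos by (simp add: f1_def f2_def f3_def f4_def b_def field_simps power2_eq_square)
  have neg: "0 \<le> k / k1 * C1\<^sup>2 * s1\<^sup>2" using k0 k1_pos by simp
  have big: "15/4 * N\<^sup>2 \<le> k / 16 * N\<^sup>2" using k_big by (intro mult_right_mono) auto
  have c1: "C1 / 8 * s1\<^sup>2 \<le> C1 / 8 * (y1 * s1)" using C1_pos s1y by (intro mult_left_mono) auto
  have c2: "b / 4 * s2\<^sup>2 \<le> b / 4 * (y2 * s2)" using b0 s2y by (intro mult_left_mono) auto
  \<comment> \<open>Totals: 4/8 of \<open>C1 * (y1 * s1)\<close> from \<open>T1\<close>,
    \<open>T4\<close>, \<open>T5\<close>, \<open>T7\<close>; 1/8 + 1/8 + 1/4 of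
    \<open>b * (y2 * s2)\<close> from \<open>T2\<close>, \<open>T5\<close>, \<open>T7\<close>; and
    1/4 + 1/2 + 1 + 1 + 1 = 15/4 of \<open>N\<^sup>2\<close>, which \<open>big\<close> compares with
    k/16.\<close>
  have "?G \<le> - C1 * (y1 * s1) + (C1 / 8 * (y1 * s1) + N\<^sup>2 / 4) + (b / 8 * (y2 * s2) + N\<^sup>2 / 2) + N\<^sup>2
     + (C1 / 8 * (y1 * s1) + N\<^sup>2) - b * (y2 * s2) + (b / 8 * (y2 * s2) + C1 / 8 * (y1 * s1)) + N\<^sup>2
     + (- (k / 8) * N\<^sup>2 + C1 / 8 * (y1 * s1) + b / 4 * (y2 * s2))"
    unfolding P_def[symmetric] using id T1 T2 T3 T4 T5 T6 T7 neg c1 c2 by linarith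
  also have "\<dots> = - (C1 / 2) * (y1 * s1) - (b / 2) * (y2 * s2) + 15/4 * N\<^sup>2 - k / 8 * N\<^sup>2"
    by (simp add: field_simps)
  also have "\<dots> \<le> - (C1 / 2) * (y1 * s1) - (b / 2) * (y2 * s2) - k / 16 * N\<^sup>2"
    using big by (simp add: field_simps)
  finally show ?thesis unfolding N2 b_def .
qed

end

lemma fast_lyap_has_derivative:
  assumes Z: "(Z has_real_derivative Z') (at t within S)" and H: "(H has_real_derivative H') (at t within S)"
  shows "((\<lambda>t. fast_lyap (Z t) (H t)) has_real_derivative
      3/16 * H t * H' + sat (Z t) * Z' - 1/10 * (H' * arctan (Z t) + H t * (1 / (1 + (Z t)\<^sup>2) * Z')))
      (at t within S)"
  unfolding fast_lyap_def
  by (rule derivative_eq_intros DERIV_chain2[OF DERIV_sat_prim] Z H refl)+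
    (simp add: field_simps)

context tracking_gains
begin

definition dissipation :: "real \<Rightarrow> real \<Rightarrow> real \<Rightarrow> real \<Rightarrow> real" where
  "dissipation y1 y2 \<xi> \<eta> = C1 / 2 * (y1 * sat y1) + C2 / k1 / 2 * (y2 * sat y2)
     + k / 16 * ((k / 4 * \<xi> + \<eta>)\<^sup>2 + (3/4 * k * \<xi> + \<eta>)\<^sup>2)"

lemma dissipation_nonneg: "0 \<le> dissipation y1 y2 \<xi> \<eta>"
proof -
  have "0 \<le> C1 / 2 * (y1 * sat y1)" "0 \<le> C2 / k1 / 2 * (y2 * sat y2)"
    by (rule mult_nonneg_nonneg[OF _ sat_nonneg]; use C1_pos C2_pos k1_pos in simp)+
  moreover have "0 \<le> k / 16 * ((k / 4 * \<xi> + \<eta>)\<^sup>2 + (3/4 * k * \<xi> + \<eta>)\<^sup>2)"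
    using k_pos by simp
  ultimately show ?thesis unfolding dissipation_def by linarith
qed

lemma outer_lyap_has_derivative:
  assumes "(y1 has_real_derivative p * f1) (at t within S)" "(y2 has_real_derivative p * f2) (at t within S)"
    "(\<xi> has_real_derivative p * f3) (at t within S)" "(\<eta> has_real_derivative p * f4) (at t within S)"
  shows "((\<lambda>t. outer_lyap (y1 t) (y2 t) (\<xi> t) (\<eta> t)) has_real_derivative
      p * (y1 t * f1 + y2 t * f2 + (f2 * (\<eta> t + k * \<xi> t) + y2 t * (f4 + k * f3)) / k1
        + k / k1 * C1 * (sat (y1 t) * f1)
        + (k / 4 * \<xi> t + \<eta> t) * (k / 4 * f3 + f4) + (3/4 * k * \<xi> t + \<eta> t) * (3/4 * k * f3 + f4)))
      (at t within S)"
proof -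
  have eq: "outer_lyap a b c d = 1/2 * (a * a + b * b) + 1 / k1 * (b * (d + k * c)) + k / k1 * C1 * sat_prim a
     + 1/2 * ((k / 4 * c + d) * (k / 4 * c + d) + (3/4 * k * c + d) * (3/4 * k * c + d))" for a b c d
    by (simp add: outer_lyap_def power2_eq_square)
  show ?thesis
    unfolding eq
    by (rule derivative_eq_intros assms DERIV_chain2[OF DERIV_sat_prim] refl)+
      (use k1_pos in \<open>simp add: field_simps\<close>)
qed

text \<open>The division by \<open>k1\<close> makes the cross term a small perturbation, so that
  \<open>outer_lyap\<close> is equivalent to the sum of squares with constants independent of
  \<open>k\<close>.\<close>

lemma outer_lyap_bounds:
  fixes y1 y2 \<xi> \<eta> :: real
  defines "w \<equiv> (k / 4 * \<xi> + \<eta>)\<^sup>2 + (3/4 * k * \<xi> + \<eta>)\<^sup>2"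
  shows "y1\<^sup>2 + y2\<^sup>2 + w \<le> 4 * outer_lyap y1 y2 \<xi> \<eta>"
    and "outer_lyap y1 y2 \<xi> \<eta> \<le> y1\<^sup>2 + y2\<^sup>2 + w"
proof -
  define P where "P = \<eta> + k * \<xi>"
  define wa where "wa = k / 4 * \<xi> + \<eta>"
  define wb where "wb = 3/4 * k * \<xi> + \<eta>"
  have w: "w = wa\<^sup>2 + wb\<^sup>2" by (simp add: w_def wa_def wb_def)
  have P: "P = 3/2 * wb - 1/2 * wa" by (simp add: P_def wa_def wb_def algebra_simps)
  have k1: "16 \<le> k1" using k_big power_mono[of 160000 k 2] by (simp add: k1_def)
  \<comment> \<open>This is the defect in the Cauchy-Schwarz inequality for \<open>P\<close>, whose
    constant is (3/2)^2 + (1/2)^2 = 5/2.\<close>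
  have "0 \<le> (3 * wa + wb)\<^sup>2 / 4" by simp
  then have P2: "P\<^sup>2 \<le> 5/2 * w" unfolding P w by (simp add: power2_eq_square field_simps)
  have "0 \<le> (\<bar>y2\<bar> - \<bar>P\<bar>)\<^sup>2" by simp
  then have yP: "2 * \<bar>y2 * P\<bar> \<le> y2\<^sup>2 + 5/2 * w" using P2 by (simp add: power2_diff abs_mult)
  have "\<bar>y2 * P / k1\<bar> \<le> \<bar>y2 * P\<bar> / 16"
    unfolding abs_divide using k1 by (intro frac_le) auto
  then have x: "\<bar>y2 * P / k1\<bar> \<le> 1/32 * y2\<^sup>2 + 5/64 * w" using yP by linarith
  have kk: "0 \<le> k / k1 * C1" "k / k1 * C1 \<le> 1/2"
  proof -
    have "k / k1 \<le> 1 / 2" using k_big by (simp add: k1_def field_simps power2_eq_square)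
    then have "k / k1 * C1 \<le> 1/2 * 1" using C1_le_one C1_pos k_pos k1_pos by (intro mult_mono) auto
    then show "k / k1 * C1 \<le> 1/2" by simp
  qed (use C1_pos k_pos k1_pos in simp)
  have s: "0 \<le> k / k1 * C1 * sat_prim y1" by (rule mult_nonneg_nonneg[OF kk(1) sat_prim_nonneg])
  have "k / k1 * C1 * sat_prim y1 \<le> 1/2 * (y1\<^sup>2 / 2)"
    using kk sat_prim_nonneg sat_prim_le by (intro mult_mono) auto
  then have s': "k / k1 * C1 * sat_prim y1 \<le> 1/4 * y1\<^sup>2" by simp
  have eq: "outer_lyap y1 y2 \<xi> \<eta> = (y1\<^sup>2 + y2\<^sup>2) / 2 + y2 * P / k1 + k / k1 * C1 * sat_prim y1 + w / 2"
    by (simp add: outer_lyap_def P_def w_def)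
  have nn: "0 \<le> y1\<^sup>2" "0 \<le> y2\<^sup>2" "0 \<le> w" by (auto simp: w)
  have x': "- (1/32 * y2\<^sup>2 + 5/64 * w) \<le> y2 * P / k1" "y2 * P / k1 \<le> 1/32 * y2\<^sup>2 + 5/64 * w"
    using x by (simp_all only: abs_le_iff minus_le_iff)
  show "y1\<^sup>2 + y2\<^sup>2 + w \<le> 4 * outer_lyap y1 y2 \<xi> \<eta>"
    unfolding eq using nn x' s by argo
  show "outer_lyap y1 y2 \<xi> \<eta> \<le> y1\<^sup>2 + y2\<^sup>2 + w"
    unfolding eq using nn x' s' by argo
qed

lemma fast_coords_norm:
  fixes \<xi> \<eta> :: real
  defines "w \<equiv> (k / 4 * \<xi> + \<eta>)\<^sup>2 + (3/4 * k * \<xi> + \<eta>)\<^sup>2"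
  shows "\<xi>\<^sup>2 + \<eta>\<^sup>2 \<le> 12 * w" and "w \<le> 4 * k\<^sup>2 * (\<xi>\<^sup>2 + \<eta>\<^sup>2)"
proof -
  define x where "x = k * \<xi>"
  have w: "w = (x / 4 + \<eta>)\<^sup>2 + (3/4 * x + \<eta>)\<^sup>2" by (simp add: w_def x_def mult.assoc)
  have "1\<^sup>2 \<le> k\<^sup>2" using k_big by (intro power_mono) auto
  then have k2: "1 \<le> k\<^sup>2" by simp
  have x2: "x\<^sup>2 = k\<^sup>2 * \<xi>\<^sup>2" by (simp add: x_def power_mult_distrib)
  have "1 * \<xi>\<^sup>2 \<le> k\<^sup>2 * \<xi>\<^sup>2" using k2 by (intro mult_right_mono) auto
  then have xi: "\<xi>\<^sup>2 \<le> x\<^sup>2" by (simp add: x2)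
  \<comment> \<open>Completing the square, with w = 5/8 x^2 + 2 x \<eta> + 2 \<eta>^2, certifies
    that the difference is nonnegative.\<close>
  have "12 * w - (x\<^sup>2 + \<eta>\<^sup>2) = 13/2 * (x + 24/13 * \<eta>)\<^sup>2 + 11/13 * \<eta>\<^sup>2"
    unfolding w by (simp add: power2_eq_square field_simps)
  moreover have "0 \<le> 13/2 * (x + 24/13 * \<eta>)\<^sup>2 + 11/13 * \<eta>\<^sup>2" by simp
  ultimately show "\<xi>\<^sup>2 + \<eta>\<^sup>2 \<le> 12 * w" using xi by linarith
  have "0 \<le> (x - \<eta>)\<^sup>2" by simp
  then have "w \<le> 4 * (x\<^sup>2 + \<eta>\<^sup>2)"
    unfolding w using zero_le_square[of x] zero_le_square[of \<eta>]
    by (simp add: power2_eq_square field_simps del: zero_le_square)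
  moreover have "1 * \<eta>\<^sup>2 \<le> k\<^sup>2 * \<eta>\<^sup>2" using k2 by (intro mult_right_mono) auto
  ultimately show "w \<le> 4 * k\<^sup>2 * (\<xi>\<^sup>2 + \<eta>\<^sup>2)" unfolding x2 by (simp add: algebra_simps)
qed

end

section \<open>Decay of the Lyapunov functions along a run\<close>

locale tracking_run = tracking_gains +
  fixes t0 vm :: real and v \<kappa> y1 y2 \<xi> \<eta> :: "real \<Rightarrow> real"
  assumes vm_pos: "0 < vm" and v_ge: "\<And>t. t0 \<le> t \<Longrightarrow> vm \<le> v t"
    and \<kappa>_le: "\<And>t. t0 \<le> t \<Longrightarrow> \<bar>\<kappa> t\<bar> \<le> \<kappa>m"
    and y1_deriv: "\<And>t. t0 \<le> t \<Longrightarrow> (y1 has_real_derivative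
      v t * (- C1 * sat (y1 t) + (cos (\<xi> t) - 1) + \<kappa> t * (1 + C1 * sat (y1 t)) * y2 t)) (at t within {t0..})"
    and y2_deriv: "\<And>t. t0 \<le> t \<Longrightarrow> (y2 has_real_derivative
      v t * (sin (\<xi> t) - \<kappa> t * (1 + C1 * sat (y1 t)) * y1 t)) (at t within {t0..})"
    and \<xi>_deriv: "\<And>t. t0 \<le> t \<Longrightarrow> (\<xi> has_real_derivative
      v t * (\<eta> t - \<kappa> t * C1 * sat (y1 t))) (at t within {t0..})"
    and \<eta>_deriv: "\<And>t. t0 \<le> t \<Longrightarrow> (\<eta> has_real_derivative
      v t * (- D * sat (k1 / D * \<xi> t + k / D * \<eta> t + C2 / D * sat (y2 t)))) (at t within {t0..})"
begin

definition V :: "real \<Rightarrow> real" where "V t = inner_lyap (\<xi> t) (\<eta> t)"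
definition U :: "real \<Rightarrow> real" where "U t = outer_lyap (y1 t) (y2 t) (\<xi> t) (\<eta> t)"

text \<open>In the coordinates \<open>z\<close> and \<open>H\<close> the steering loop is the double
  integrator of \<open>fast_lyap_decrease\<close> run at speed \<open>v t * k\<close>; the lower
  bound \<open>vm\<close> makes the decay rate uniform in time.\<close>

lemma V_decreasing:
  obtains V' m where "0 < m"
    and "\<And>t. t0 \<le> t \<Longrightarrow> (V has_real_derivative V' t) (at t within {t0..})"
    and "\<And>t. t0 \<le> t \<Longrightarrow> (200 * \<epsilon>)\<^sup>2 < V t \<Longrightarrow> V' t \<le> - m"
proof -
  define z where "z t = (k1 * \<xi> t + k * \<eta> t) / D" for t
  define H where "H t = k / D * \<eta> t" for t
  define d where "d t = C2 / D * sat (y2 t)" for t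
  define \<delta> where "\<delta> t = k / D * (\<kappa> t * C1 * sat (y1 t))" for t
  define G where "G t = 3/16 * H t * (sat (z t) - sat (z t + d t)) - 3/16 * \<delta> t * sat (z t) - sat (z t) * sat (z t + d t)
      + 1/10 * sat (z t + d t) * arctan (z t)
      - 1/10 * H t * (1 / (1 + (z t)\<^sup>2) * (3/16 * (H t - \<delta> t) - sat (z t + d t)))" for t
  have V: "V t = fast_lyap (z t) (H t)" for t by (simp add: V_def inner_lyap_def z_def H_def)
  have arg: "k1 / D * \<xi> t + k / D * \<eta> t + C2 / D * sat (y2 t) = z t + d t" for t
    by (simp add: z_def d_def add_divide_distrib)
  have Hd: "(H has_real_derivative v t * k * - sat (z t + d t)) (at t within {t0..})" if "t0 \<le> t" for t
    unfolding H_def using \<eta>_deriv[OF that, unfolded arg] D_pos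
    by (auto intro!: derivative_eq_intros)
  have zd: "(z has_real_derivative v t * k * (3/16 * (H t - \<delta> t) - sat (z t + d t))) (at t within {t0..})"
    if "t0 \<le> t" for t
  proof -
    have alg: "(k1 * (p * (e - x)) + k * (p * (- D * S))) / D = p * k * (3/16 * (k / D * e - k / D * x) - S)"
      for p e x S
      using D_pos by (simp add: k1_def power2_eq_square field_simps)
    have "((\<lambda>t. (k1 * \<xi> t + k * \<eta> t) / D) has_real_derivative
        (k1 * (v t * (\<eta> t - \<kappa> t * C1 * sat (y1 t))) + k * (v t * (- D * sat (z t + d t)))) / D) (at t within {t0..})"
      by (intro DERIV_cdivide DERIV_add DERIV_cmult \<xi>_deriv \<eta>_deriv[unfolded arg] that)
    then show ?thesis unfolding alg H_def \<delta>_def z_def[abs_def, symmetric] .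
  qed
  have der: "(V has_real_derivative v t * k * G t) (at t within {t0..})" if "t0 \<le> t" for t
  proof -
    have alg: "3/16 * h * (p * - S) + s * (p * (3/16 * (h - x) - S)) - 1/10 * (p * - S * g + h * (q * (p * (3/16 * (h - x) - S))))
        = p * (3/16 * h * (s - S) - 3/16 * x * s - s * S + 1/10 * S * g - 1/10 * h * (q * (3/16 * (h - x) - S)))"
      for h p S s x g q :: real
      by (simp add: field_simps)
    have "V = (\<lambda>t. fast_lyap (z t) (H t))" using V by blast
    then show ?thesis
      using fast_lyap_has_derivative[OF zd[OF that] Hd[OF that], unfolded alg] by (simp add: G_def)
  qed
  have "v t * k * G t \<le> - (vm * k * (104 * \<epsilon>\<^sup>2))" if t: "t0 \<le> t" and V': "(200 * \<epsilon>)\<^sup>2 < V t" for t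
  proof -
    have "G t \<le> - 104 * \<epsilon>\<^sup>2"
      unfolding G_def
      by (rule fast_lyap_decrease)
        (use disturbance_y2_le disturbance_y1_le[OF \<kappa>_le[OF t]] \<epsilon>_le V' V in \<open>auto simp: d_def \<delta>_def\<close>)
    then have "v t * k * G t \<le> v t * k * (- 104 * \<epsilon>\<^sup>2)"
      using v_ge[OF t] vm_pos k_pos by (intro mult_left_mono) auto
    also have "\<dots> \<le> - (vm * k * (104 * \<epsilon>\<^sup>2))"
      using v_ge[OF t] k_pos by (simp add: mult_right_mono)
    finally show ?thesis .
  qed
  moreover have "0 < vm * k * (104 * \<epsilon>\<^sup>2)" using vm_pos k_pos \<epsilon>_pos by simp
  ultimately show thesis by (intro that[of _ "\<lambda>t. v t * k * G t"] der)
qed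

lemma U_decreasing:
  obtains U' where
    "\<And>t. t0 \<le> t \<Longrightarrow> (U has_real_derivative U' t) (at t within {t0..})"
    and "\<And>t. t0 \<le> t \<Longrightarrow> V t \<le> (200 * \<epsilon>)\<^sup>2 \<Longrightarrow>
      U' t \<le> - vm * dissipation (y1 t) (y2 t) (\<xi> t) (\<eta> t)"
proof -
  define f1 where "f1 t = - C1 * sat (y1 t) + (cos (\<xi> t) - 1) + \<kappa> t * (1 + C1 * sat (y1 t)) * y2 t" for t
  define f2 where "f2 t = sin (\<xi> t) - \<kappa> t * (1 + C1 * sat (y1 t)) * y1 t" for t
  define f3 where "f3 t = \<eta> t - \<kappa> t * C1 * sat (y1 t)" for t
  define f4 where "f4 t = - D * sat (k1 / D * \<xi> t + k / D * \<eta> t + C2 / D * sat (y2 t))" for t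
  define G where "G t = y1 t * f1 t + y2 t * f2 t + (f2 t * (\<eta> t + k * \<xi> t) + y2 t * (f4 t + k * f3 t)) / k1
      + k / k1 * C1 * (sat (y1 t) * f1 t)
      + (k / 4 * \<xi> t + \<eta> t) * (k / 4 * f3 t + f4 t) + (3/4 * k * \<xi> t + \<eta> t) * (3/4 * k * f3 t + f4 t)" for t
  have der: "(U has_real_derivative v t * G t) (at t within {t0..})" if t: "t0 \<le> t" for t
    unfolding U_def[abs_def] G_def
    by (rule outer_lyap_has_derivative)
      (use y1_deriv[OF t] y2_deriv[OF t] \<xi>_deriv[OF t] \<eta>_deriv[OF t] in \<open>simp_all only: f1_def f2_def f3_def f4_def\<close>)
  define W where "W t = dissipation (y1 t) (y2 t) (\<xi> t) (\<eta> t)" for t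
  have "v t * G t \<le> - vm * W t" if t: "t0 \<le> t" and Vt: "V t \<le> (200 * \<epsilon>)\<^sup>2" for t
  proof -
    note small = inner_lyap_small[OF Vt[unfolded V_def]]
    have f4: "f4 t = - (k1 * \<xi> t + k * \<eta> t + C2 * sat (y2 t))"
      unfolding f4_def using small(3)[of "y2 t"] by simp
    have "G t \<le> - W t"
      using outer_dissipation[OF small(1,2) \<kappa>_le[OF t], of "y1 t" "y2 t"]
      unfolding G_def W_def dissipation_def f1_def f2_def f3_def f4 by linarith
    then have "v t * G t \<le> v t * (- W t)"
      using v_ge[OF t] vm_pos by (intro mult_left_mono) auto
    also have "\<dots> \<le> - vm * W t"
      using v_ge[OF t] dissipation_nonneg by (simp add: W_def mult_right_mono)
    finally show ?thesis .
  qed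
  then show thesis by (intro that[of "\<lambda>t. v t * G t"] der) (simp_all add: W_def)
qed

lemma capture:
  obtains T where "t0 \<le> T" "\<And>t. T \<le> t \<Longrightarrow> V t \<le> (200 * \<epsilon>)\<^sup>2"
proof -
  obtain V' m where V': "0 < m"
    "\<And>t. t0 \<le> t \<Longrightarrow> (V has_real_derivative V' t) (at t within {t0..})"
    "\<And>t. t0 \<le> t \<Longrightarrow> (200 * \<epsilon>)\<^sup>2 < V t \<Longrightarrow> V' t \<le> - m"
    by (rule V_decreasing) (rule that)
  show thesis
  proof (rule sublevel_reached[where f = V and f' = V' and m = m and c = "(200 * \<epsilon>)\<^sup>2" and ?t0.0 = t0])
    fix T assume "t0 \<le> T" "\<And>t. T \<le> t \<Longrightarrow> V t \<le> (200 * \<epsilon>)\<^sup>2"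
    then show thesis by (rule that)
  qed (rule V'; assumption)+
qed

lemma capture_invariant:
  assumes "V t0 \<le> (200 * \<epsilon>)\<^sup>2" "t0 \<le> t"
  shows "V t \<le> (200 * \<epsilon>)\<^sup>2"
proof -
  obtain V' m where V': "0 < m"
    "\<And>t. t0 \<le> t \<Longrightarrow> (V has_real_derivative V' t) (at t within {t0..})"
    "\<And>t. t0 \<le> t \<Longrightarrow> (200 * \<epsilon>)\<^sup>2 < V t \<Longrightarrow> V' t \<le> - m"
    by (rule V_decreasing) (rule that)
  show ?thesis
    by (rule sublevel_invariant[where f = V and f' = V' and ?t0.0 = t0]) (use V' assms in force)+
qed

lemma U_antimono:
  assumes T: "t0 \<le> T" "\<And>t. T \<le> t \<Longrightarrow> V t \<le> (200 * \<epsilon>)\<^sup>2" and "T \<le> t"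
  shows "U t \<le> U T"
proof -
  obtain U' where U': "\<And>t. t0 \<le> t \<Longrightarrow> (U has_real_derivative U' t) (at t within {t0..})"
    "\<And>t. t0 \<le> t \<Longrightarrow> V t \<le> (200 * \<epsilon>)\<^sup>2 \<Longrightarrow>
      U' t \<le> - vm * dissipation (y1 t) (y2 t) (\<xi> t) (\<eta> t)"
    by (rule U_decreasing) (rule that)
  show ?thesis
  proof (rule sublevel_invariant[where f = U and f' = U' and ?t0.0 = T])
    fix s assume s: "T \<le> s"
    show "(U has_real_derivative U' s) (at s within {T..})"
      using U'(1)[of s] s T by (auto intro: DERIV_subset)
    have "0 \<le> vm * dissipation (y1 s) (y2 s) (\<xi> s) (\<eta> s)"
      using vm_pos dissipation_nonneg by simp
    then show "U' s \<le> 0"  using U'(2)[of s] T(2)[OF s] T(1) s by linarith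
  qed (use assms in auto)
qed

text \<open>The dissipation grows only linearly in \<open>y1\<close> and \<open>y2\<close>, while
  \<open>U\<close> grows quadratically, so the rate depends on the run: after capture
  \<open>U\<close> stays below \<open>U T\<close>, and on that bounded set the dissipation dominates
  \<open>r * U\<close>.\<close>

lemma U_tendsto_zero: "(U \<longlongrightarrow> 0) at_top"
proof -
  obtain T where T: "t0 \<le> T" "\<And>t. T \<le> t \<Longrightarrow> V t \<le> (200 * \<epsilon>)\<^sup>2" by (rule capture) (rule that)
  obtain U' where U': "\<And>t. t0 \<le> t \<Longrightarrow> (U has_real_derivative U' t) (at t within {t0..})"
    "\<And>t. t0 \<le> t \<Longrightarrow> V t \<le> (200 * \<epsilon>)\<^sup>2 \<Longrightarrow>
      U' t \<le> - vm * dissipation (y1 t) (y2 t) (\<xi> t) (\<eta> t)"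
    by (rule U_decreasing) (rule that)
  define w where "w t = (k / 4 * \<xi> t + \<eta> t)\<^sup>2 + (3/4 * k * \<xi> t + \<eta> t)\<^sup>2" for t
  have bounds: "(y1 t)\<^sup>2 + (y2 t)\<^sup>2 + w t \<le> 4 * U t" "U t \<le> (y1 t)\<^sup>2 + (y2 t)\<^sup>2 + w t" for t
    unfolding U_def w_def by (rule outer_lyap_bounds)+
  \<comment> \<open>By |y| \<le> 1 + y^2, the bound y^2 \<le> 4 U T implies max 1 |y| \<le> M, and
    \<open>y * sat y\<close> is y^2 / max 1 |y|.\<close>
  define M where "M = 1 + 4 * U T"
  have w0: "0 \<le> w t" for t by (simp add: w_def)
  have U0: "0 \<le> U t" for t
    using bounds(1)[of t] w0[of t] zero_le_power2[of "y1 t"] zero_le_power2[of "y2 t"] by linarith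
  have M: "1 \<le> M" using U0[of T] by (simp add: M_def)
  have sat_ge: "y\<^sup>2 / M \<le> y * sat y" if "y\<^sup>2 \<le> 4 * U T" for y
  proof -
    have "\<bar>y\<bar> \<le> 1 + y\<^sup>2"
    proof -
      have "0 \<le> (\<bar>y\<bar> - 1)\<^sup>2" by simp
      then show ?thesis using zero_le_power2[of y] by (simp add: power2_diff)
    qed
    then have "max 1 \<bar>y\<bar> \<le> M" using that M by (auto simp: M_def)
    then have "y\<^sup>2 / M \<le> y\<^sup>2 / max 1 \<bar>y\<bar>" by (intro divide_left_mono) (auto simp: M_def max_def)
    then show ?thesis by (simp add: sat_def power2_eq_square)
  qed
  define r where "r = min (C1 / 2 / M) (min (C2 / k1 / 2 / M) (k / 16))"
  have r: "0 < r" "r \<le> C1 / 2 / M" "r \<le> C2 / k1 / 2 / M" "r \<le> k / 16"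
    using C1_pos C2_pos k1_pos k_pos M by (auto simp: r_def)
  have rate: "U' t \<le> - vm * (r * U t)" if t: "T \<le> t" for t
  proof -
    have "U t \<le> U T" using U_antimono[OF T t] .
    then have "(y1 t)\<^sup>2 + (y2 t)\<^sup>2 + w t \<le> 4 * U T" using bounds(1)[of t] by simp
    then have y: "(y1 t)\<^sup>2 \<le> 4 * U T" "(y2 t)\<^sup>2 \<le> 4 * U T"
      using w0[of t] zero_le_power2[of "y1 t"] zero_le_power2[of "y2 t"] by linarith+
    have "r * (y1 t)\<^sup>2 \<le> C1 / 2 / M * (y1 t)\<^sup>2" using r by (intro mult_right_mono) auto
    also have "\<dots> = C1 / 2 * ((y1 t)\<^sup>2 / M)" by simp
    also have "\<dots> \<le> C1 / 2 * (y1 t * sat (y1 t))" using sat_ge[OF y(1)] C1_pos by (intro mult_left_mono) auto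
    finally have 1: "r * (y1 t)\<^sup>2 \<le> C1 / 2 * (y1 t * sat (y1 t))" .
    have "r * (y2 t)\<^sup>2 \<le> C2 / k1 / 2 / M * (y2 t)\<^sup>2" using r by (intro mult_right_mono) auto
    also have "\<dots> = C2 / k1 / 2 * ((y2 t)\<^sup>2 / M)" by simp
    also have "\<dots> \<le> C2 / k1 / 2 * (y2 t * sat (y2 t))"
      using sat_ge[OF y(2)] C2_pos k1_pos by (intro mult_left_mono) auto
    finally have 2: "r * (y2 t)\<^sup>2 \<le> C2 / k1 / 2 * (y2 t * sat (y2 t))" .
    have 3: "r * w t \<le> k / 16 * w t" using r w0 by (intro mult_right_mono) auto
    have "r * U t \<le> r * ((y1 t)\<^sup>2 + (y2 t)\<^sup>2 + w t)" using bounds(2)[of t] r by (intro mult_left_mono) auto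
    also have "\<dots> \<le> C1 / 2 * (y1 t * sat (y1 t)) + C2 / k1 / 2 * (y2 t * sat (y2 t)) + k / 16 * w t"
      using 1 2 3 unfolding distrib_left by linarith
    also have "\<dots> = dissipation (y1 t) (y2 t) (\<xi> t) (\<eta> t)" by (simp add: dissipation_def w_def)
    finally have "vm * (r * U t) \<le> vm * dissipation (y1 t) (y2 t) (\<xi> t) (\<eta> t)"
      using vm_pos by (intro mult_left_mono) auto
    then show ?thesis  using U'(2)[of t] T(2)[OF t] T(1) t by linarith
  qed
  show ?thesis
  proof (rule order_tendstoI)
    fix a :: real assume "a < 0"
    then show "\<forall>\<^sub>F t in at_top. a < U t" using U0 by (intro always_eventually allI) (meson less_le_trans)
  next
    fix a :: real assume a: "0 < a"
    \<comment> \<open>Above the level \<open>a / 2\<close> the decay rate is bounded away from zero,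
      so that level is reached for good; halving \<open>a\<close> leaves the inequality
      strict.\<close>
    obtain S where "T \<le> S" "\<And>t. S \<le> t \<Longrightarrow> U t \<le> a / 2"
    proof (rule sublevel_reached[where f = U and f' = U' and ?t0.0 = T and c = "a / 2" and m = "vm * (r * (a / 2))"])
      fix s assume s: "T \<le> s"
      show "(U has_real_derivative U' s) (at s within {T..})"
        using U'(1)[of s] s T by (auto intro: DERIV_subset)
      assume "a / 2 < U s"
      then have "vm * (r * (a / 2)) \<le> vm * (r * U s)" using vm_pos r by (intro mult_left_mono) auto
      then show "U' s \<le> - (vm * (r * (a / 2)))" using rate[OF s] by simp
    qed (use a vm_pos r in auto)
    then show "\<forall>\<^sub>F t in at_top. U t < a"
      using a by (intro eventually_at_top_linorderI[of S]) fastforce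
  qed
qed

lemma state_sq_le: "(y1 t)\<^sup>2 + (y2 t)\<^sup>2 + (\<xi> t)\<^sup>2 + (\<eta> t)\<^sup>2 \<le> 48 * U t"
proof -
  define w where "w = (k / 4 * \<xi> t + \<eta> t)\<^sup>2 + (3/4 * k * \<xi> t + \<eta> t)\<^sup>2"
  have "(y1 t)\<^sup>2 + (y2 t)\<^sup>2 + w \<le> 4 * U t" unfolding U_def w_def by (rule outer_lyap_bounds)
  moreover have "(\<xi> t)\<^sup>2 + (\<eta> t)\<^sup>2 \<le> 12 * w" unfolding w_def by (rule fast_coords_norm)
  ultimately show ?thesis using zero_le_power2[of "y1 t"] zero_le_power2[of "y2 t"] by linarith
qed

lemma U_le_state_sq: "U t \<le> 4 * k\<^sup>2 * ((y1 t)\<^sup>2 + (y2 t)\<^sup>2 + (\<xi> t)\<^sup>2 + (\<eta> t)\<^sup>2)"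
proof -
  define w where "w = (k / 4 * \<xi> t + \<eta> t)\<^sup>2 + (3/4 * k * \<xi> t + \<eta> t)\<^sup>2"
  have "1\<^sup>2 \<le> k\<^sup>2" using k_big by (intro power_mono) auto
  then have "1 * ((y1 t)\<^sup>2 + (y2 t)\<^sup>2) \<le> (4 * k\<^sup>2) * ((y1 t)\<^sup>2 + (y2 t)\<^sup>2)" by (intro mult_right_mono) auto
  moreover have "U t \<le> (y1 t)\<^sup>2 + (y2 t)\<^sup>2 + w" unfolding U_def w_def by (rule outer_lyap_bounds)
  moreover have "w \<le> 4 * k\<^sup>2 * ((\<xi> t)\<^sup>2 + (\<eta> t)\<^sup>2)" unfolding w_def by (rule fast_coords_norm)
  ultimately show ?thesis by (simp add: algebra_simps)
qed

lemma states_tendsto_zero: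
  "(y1 \<longlongrightarrow> 0) at_top" "(y2 \<longlongrightarrow> 0) at_top" "(\<xi> \<longlongrightarrow> 0) at_top" "(\<eta> \<longlongrightarrow> 0) at_top"
proof -
  have lim: "((\<lambda>t. sqrt (48 * U t)) \<longlongrightarrow> 0) at_top"
    using tendsto_real_sqrt[OF tendsto_mult_left[OF U_tendsto_zero, of 48]] by simp
  have *: "(f \<longlongrightarrow> 0) at_top" if "\<And>t. (f t)\<^sup>2 \<le> 48 * U t" for f :: "real \<Rightarrow> real"
    by (rule Lim_null_comparison[OF _ lim]) (use that in \<open>auto intro!: always_eventually real_le_rsqrt\<close>)
  have "(y1 t)\<^sup>2 \<le> 48 * U t" "(y2 t)\<^sup>2 \<le> 48 * U t" "(\<xi> t)\<^sup>2 \<le> 48 * U t" "(\<eta> t)\<^sup>2 \<le> 48 * U t" for t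
    using state_sq_le[of t] zero_le_power2[of "y1 t"] zero_le_power2[of "y2 t"] zero_le_power2[of "\<xi> t"]
      zero_le_power2[of "\<eta> t"] by linarith+
  then show "(y1 \<longlongrightarrow> 0) at_top" "(y2 \<longlongrightarrow> 0) at_top" "(\<xi> \<longlongrightarrow> 0) at_top" "(\<eta> \<longlongrightarrow> 0) at_top"
    by (auto intro!: *)
qed

end

section \<open>Existence of solutions\<close>

lemma at_within_atLeast_eq:
  fixes t0 t T :: real
  assumes "t < T"
  shows "at t within {t0..} = at t within {t0..T}"
  by (rule at_within_nhd[of t "{..<T}"]) (use assms in auto)

lemma integral_has_vector_derivative_atLeast:
  fixes g :: "real \<Rightarrow> 'a::banach"
  assumes "continuous_on {t0..} g" "t0 \<le> t"
  shows "((\<lambda>u. c + integral {t0..u} g) has_vector_derivative g t) (at t within {t0..})"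
proof -
  have "continuous_on {t0..t + 1} g" by (rule continuous_on_subset[OF assms(1)]) auto
  then have "((\<lambda>u. integral {t0..u} g) has_vector_derivative g t) (at t within {t0..t + 1})"
    by (rule integral_has_vector_derivative) (use assms in auto)
  then have "((\<lambda>u. c + integral {t0..u} g) has_vector_derivative 0 + g t) (at t within {t0..t + 1})"
    by (intro has_vector_derivative_add has_vector_derivative_const)
  then show ?thesis using at_within_atLeast_eq[of t "t + 1" t0] by simp
qed

lemma continuous_on_atLeastI:
  fixes x :: "real \<Rightarrow> 'a::topological_space"
  assumes "\<And>T. continuous_on {t0..T} x"
  shows "continuous_on {t0..} x"
  unfolding continuous_on_eq_continuous_within
proof
  fix t assume "t \<in> {t0..}"
  then have "continuous (at t within {t0..t + 1}) x"
    using assms[of "t + 1"] by (auto simp: continuous_on_eq_continuous_within)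
  then show "continuous (at t within {t0..}) x"
    using at_within_atLeast_eq[of t "t + 1" t0] by simp
qed

text \<open>Picard iteration on the whole half-line. On \<open>{t0..T}\<close>, measured with the
  weight \<open>exp (2 * L T * (t - t0))\<close>, the bound on the distance of consecutive iterates
  halves at each step, so the convergence is uniform on compact intervals of any length. Continuity
  of the field is asked along continuous curves, as the integrals require.\<close>

lemma solution_exists_lipschitz:
  fixes f :: "real \<Rightarrow> 'a \<Rightarrow> 'a::banach"
  assumes cont: "\<And>x. continuous_on {t0..} x \<Longrightarrow> continuous_on {t0..} (\<lambda>t. f t (x t))"
    and lip: "\<And>t x y. t0 \<le> t \<Longrightarrow> norm (f t x - f t y) \<le> L t * norm (x - y)"
    and L_mono: "\<And>s t. t0 \<le> s \<Longrightarrow> s \<le> t \<Longrightarrow> L s \<le> L t" and L_pos: "0 < L t0"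
  shows "\<exists>x. solution_from f t0 x \<and> x t0 = x0"
proof -
  define \<phi> where "\<phi> = rec_nat (\<lambda>_. x0) (\<lambda>_ \<phi> t. x0 + integral {t0..t} (\<lambda>s. f s (\<phi> s)))"
  have \<phi>0: "\<phi> 0 t = x0" for t by (simp add: \<phi>_def)
  have \<phi>S: "\<phi> (Suc n) t = x0 + integral {t0..t} (\<lambda>s. f s (\<phi> n s))" for n t by (simp add: \<phi>_def)
  have contS: "continuous_on {t0..} (\<lambda>t. x0 + integral {t0..t} g)" if "continuous_on {t0..} g" for g
    by (rule continuous_on_vector_derivative)
      (use integral_has_vector_derivative_atLeast[OF that] in auto)
  have cont\<phi>: "continuous_on {t0..} (\<phi> n)" for n
  proof (induction n)
    case 0
    then show ?case by (simp add: \<phi>0[abs_def])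
  next
    case (Suc n)
    then show ?case unfolding \<phi>S[abs_def] by (intro contS cont)
  qed
  have contf: "continuous_on {t0..T} (\<lambda>s. f s (\<phi> n s))" for n T
    by (rule continuous_on_subset[OF cont[OF cont\<phi>]]) auto
  have Lp: "0 < L t" if "t0 \<le> t" for t using L_mono[of t0 t] L_pos that by linarith
  have step: "\<exists>M. \<forall>n. \<forall>t\<in>{t0..T}. norm (\<phi> (Suc n) t - \<phi> n t) \<le> M * (1/2)^n * exp (2 * L T * (t - t0))" for T
  proof -
    have "compact ((\<lambda>t. \<phi> 1 t - \<phi> 0 t) ` {t0..T})"
      by (intro compact_continuous_image continuous_on_diff continuous_on_subset[OF cont\<phi>]) auto
    then obtain M where M: "0 < M" "\<forall>y \<in> (\<lambda>t. \<phi> 1 t - \<phi> 0 t) ` {t0..T}. norm y \<le> M"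
      using bounded_pos compact_imp_bounded by metis
    define E where "E t = exp (2 * L T * (t - t0))" for t
    have "norm (\<phi> (Suc n) t - \<phi> n t) \<le> M * (1/2)^n * E t" if "t \<in> {t0..T}" for n t
      using that
    proof (induction n arbitrary: t)
      case 0
      then have "norm (\<phi> 1 t - \<phi> 0 t) \<le> M * 1" using M(2) by auto
      also have "\<dots> \<le> M * E t"
        using M(1) 0 Lp[of T] by (intro mult_left_mono) (auto simp: E_def)
      finally show ?case by simp
    next
      case (Suc n)
      then have LT: "0 < L T" using Lp[of T] by auto
      \<comment> \<open>\<open>E / 2\<close> is an antiderivative of \<open>L T * E\<close>: this is
        the factor 1/2 gained at each step.\<close>
      have int: "((\<lambda>s. L T * E s) has_integral (E t / 2 - E t0 / 2)) {t0..t}"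
        by (rule fundamental_theorem_of_calculus)
          (use Suc.prems in \<open>auto simp: E_def has_real_derivative_iff_has_vector_derivative[symmetric]
            intro!: derivative_eq_intros\<close>)
      have int': "((\<lambda>s. M * (1/2)^n * (L T * E s)) has_integral M * (1/2)^n * (E t / 2 - E t0 / 2)) {t0..t}"
        by (intro has_integral_mult_right int)
      have "\<phi> (Suc (Suc n)) t - \<phi> (Suc n) t
          = integral {t0..t} (\<lambda>s. f s (\<phi> (Suc n) s)) - integral {t0..t} (\<lambda>s. f s (\<phi> n s))"
        by (simp add: \<phi>S)
      also have "\<dots> = integral {t0..t} (\<lambda>s. f s (\<phi> (Suc n) s) - f s (\<phi> n s))"
        by (intro integral_diff[symmetric] integrable_continuous_real contf)
      also have "norm \<dots> \<le> integral {t0..t} (\<lambda>s. M * (1/2)^n * (L T * E s))"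
      proof (rule integral_norm_bound_integral)
        show "(\<lambda>s. f s (\<phi> (Suc n) s) - f s (\<phi> n s)) integrable_on {t0..t}"
          by (intro integrable_continuous_real continuous_on_diff contf)
        show "(\<lambda>s. M * (1/2)^n * (L T * E s)) integrable_on {t0..t}"
          using int' by (rule has_integral_integrable)
        fix s assume s: "s \<in> {t0..t}"
        then have "norm (f s (\<phi> (Suc n) s) - f s (\<phi> n s)) \<le> L s * norm (\<phi> (Suc n) s - \<phi> n s)"
          by (intro lip) auto
        also have "\<dots> \<le> L T * (M * (1/2)^n * E s)"
          using s Suc L_mono[of s T] LT by (intro mult_mono) auto
        finally show "norm (f s (\<phi> (Suc n) s) - f s (\<phi> n s)) \<le> M * (1/2)^n * (L T * E s)"
          by (simp add: mult_ac)
      qed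
      also have "\<dots> = M * (1/2)^n * (E t / 2 - E t0 / 2)" using int' by (rule integral_unique)
      also have "\<dots> \<le> M * (1/2)^n * (E t / 2)"
        using M(1) by (intro mult_left_mono) (auto simp: E_def)
      finally show ?case by simp
    qed
    then show ?thesis unfolding E_def by blast
  qed
  \<comment> \<open>The limit is written as a telescoping series so that the Weierstrass M-test
    applies.\<close>
  define x where "x t = x0 + (\<Sum>n. \<phi> (Suc n) t - \<phi> n t)" for t
  have ul: "uniform_limit {t0..T} \<phi> x sequentially" for T
  proof -
    obtain M where M: "\<And>n t. t \<in> {t0..T} \<Longrightarrow> norm (\<phi> (Suc n) t - \<phi> n t) \<le> M * (1/2)^n * exp (2 * L T * (t - t0))"
      using step by blast
    define M' where "M' = \<bar>M\<bar> * exp (2 * L T * (T - t0))"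
    have "uniform_limit {t0..T} (\<lambda>n t. \<Sum>i<n. \<phi> (Suc i) t - \<phi> i t) (\<lambda>t. \<Sum>n. \<phi> (Suc n) t - \<phi> n t) sequentially"
    proof (rule Weierstrass_m_test)
      show "summable (\<lambda>n. M' * (1/2)^n)" by (intro summable_mult summable_geometric) simp
      fix n t assume t: "t \<in> {t0..T}"
      have "norm (\<phi> (Suc n) t - \<phi> n t) \<le> M * (1/2)^n * exp (2 * L T * (t - t0))" by (rule M[OF t])
      also have "\<dots> \<le> \<bar>M\<bar> * (1/2)^n * exp (2 * L T * (T - t0))"
        using t Lp[of T] by (intro mult_mono) auto
      finally show "norm (\<phi> (Suc n) t - \<phi> n t) \<le> M' * (1/2)^n" by (simp add: M'_def mult_ac)
    qed
    then have "uniform_limit {t0..T} (\<lambda>n t. x0 + (\<Sum>i<n. \<phi> (Suc i) t - \<phi> i t)) x sequentially"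
      unfolding x_def by (intro uniform_limit_intros)
    moreover have "x0 + (\<Sum>i<n. \<phi> (Suc i) t - \<phi> i t) = \<phi> n t" for n t
      using sum_lessThan_telescope[of "\<lambda>i. \<phi> i t" n] by (simp add: \<phi>0 algebra_simps)
    ultimately show ?thesis by simp
  qed
  have contx: "continuous_on {t0..} x"
  proof (rule continuous_on_atLeastI)
    fix T
    show "continuous_on {t0..T} x"
      by (rule uniform_limit_theorem[OF _ ul])
        (auto intro!: always_eventually continuous_on_subset[OF cont\<phi>])
  qed
  \<comment> \<open>The Lipschitz bound carries the uniform convergence of the iterates over to the
    integrands, so the recursion passes to the limit under the integral.\<close>
  have fix_eq: "x t = x0 + integral {t0..t} (\<lambda>s. f s (x s))" if t: "t0 \<le> t" for t
  proof -
    have ulf: "uniform_limit {t0..t} (\<lambda>n s. f s (\<phi> n s)) (\<lambda>s. f s (x s)) sequentially"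
    proof (rule uniform_limitI)
      fix e :: real assume e: "0 < e"
      have "\<forall>\<^sub>F n in sequentially. \<forall>s\<in>{t0..t}. dist (\<phi> n s) (x s) < e / L t"
        using uniform_limitD[OF ul] e Lp[OF t] by simp
      then show "\<forall>\<^sub>F n in sequentially. \<forall>s\<in>{t0..t}. dist (f s (\<phi> n s)) (f s (x s)) < e"
      proof (rule eventually_mono, intro ballI)
        fix n s assume *: "\<forall>s\<in>{t0..t}. dist (\<phi> n s) (x s) < e / L t" and s: "s \<in> {t0..t}"
        have "dist (f s (\<phi> n s)) (f s (x s)) \<le> L s * norm (\<phi> n s - x s)"
          unfolding dist_norm using s by (intro lip) auto
        also have "\<dots> \<le> L t * norm (\<phi> n s - x s)" using L_mono[of s t] s by (intro mult_right_mono) auto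
        also have "\<dots> < L t * (e / L t)"
          using *[rule_format, OF s] Lp[OF t] by (intro mult_strict_left_mono) (auto simp: dist_norm)
        finally show "dist (f s (\<phi> n s)) (f s (x s)) < e" using Lp[OF t] by simp
      qed
    qed
    obtain I J where I: "\<And>n. ((\<lambda>s. f s (\<phi> n s)) has_integral I n) {t0..t}"
      and J: "((\<lambda>s. f s (x s)) has_integral J) {t0..t}" and IJ: "(I \<longlongrightarrow> J) sequentially"
      by (rule uniform_limit_integral[OF ulf contf trivial_limit_sequentially]) (rule that)
    have "\<phi> (Suc n) t = x0 + I n" for n using I[of n] by (simp add: \<phi>S integral_unique)
    then have "(\<lambda>n. \<phi> (Suc n) t) \<longlonglongrightarrow> x0 + J" using IJ by (simp add: tendsto_add)
    moreover have "(\<lambda>n. \<phi> (Suc n) t) \<longlonglongrightarrow> x t"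
      using tendsto_uniform_limitI[OF ul[of t], of t] t by (intro LIMSEQ_Suc) simp
    ultimately have "x t = x0 + J" by (rule LIMSEQ_unique[rotated])
    then show ?thesis using J by (simp add: integral_unique)
  qed
  have "(x has_vector_derivative f t (x t)) (at t within {t0..})" if t: "t0 \<le> t" for t
    by (rule has_vector_derivative_transform[OF _ _ integral_has_vector_derivative_atLeast[where c = x0]])
      (use t fix_eq cont[OF contx] in auto)
  moreover have "x t0 = x0" using fix_eq[of t0] by simp
  ultimately show ?thesis unfolding solution_from_def by blast
qed

section \<open>Truncation and global existence for the error system\<close>

definition clip :: "real \<Rightarrow> real \<Rightarrow> real" where
  "clip r x = max (- r) (min r x)"

lemma clip_eq: "\<bar>x\<bar> \<le> r \<Longrightarrow> clip r x = x"
  by (simp add: clip_def)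

lemma abs_clip_le: "0 \<le> r \<Longrightarrow> \<bar>clip r x\<bar> \<le> r" "0 \<le> r \<Longrightarrow> \<bar>clip r x\<bar> \<le> \<bar>x\<bar>"
  by (auto simp: clip_def max_def min_def)

lemma clip_lipschitz: "\<bar>clip r x - clip r y\<bar> \<le> \<bar>x - y\<bar>"
  by (auto simp: clip_def max_def min_def)

lemma sat_mult_clip_lipschitz:
  assumes "0 \<le> r"
  shows "\<bar>sat x * clip r y - sat x' * clip r y'\<bar> \<le> r * \<bar>x - x'\<bar> + \<bar>y - y'\<bar>"
proof -
  have "sat x * clip r y - sat x' * clip r y' = (sat x - sat x') * clip r y + sat x' * (clip r y - clip r y')"
    by (simp add: algebra_simps)
  also have "\<bar>\<dots>\<bar> \<le> \<bar>sat x - sat x'\<bar> * \<bar>clip r y\<bar> + \<bar>sat x'\<bar> * \<bar>clip r y - clip r y'\<bar>"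
    unfolding abs_mult[symmetric] by (rule abs_triangle_ineq)
  also have "\<dots> \<le> \<bar>x - x'\<bar> * r + 1 * \<bar>y - y'\<bar>"
    using assms by (intro add_mono mult_mono sat_lipschitz abs_clip_le abs_sat_le_one clip_lipschitz) auto
  finally show ?thesis by (simp add: mult.commute)
qed

lemma cos_lipschitz: "\<bar>cos x - cos y\<bar> \<le> \<bar>x - y\<bar>" for x y :: real
proof -
  have "\<bar>cos x - cos y\<bar> = 2 * (\<bar>sin ((x + y) / 2)\<bar> * \<bar>sin ((y - x) / 2)\<bar>)"
    by (simp add: cos_diff_cos abs_mult)
  also have "\<dots> \<le> 2 * (1 * \<bar>(y - x) / 2\<bar>)"
    by (intro mult_left_mono mult_mono abs_sin_x_le_abs_x) auto
  finally show ?thesis by simp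
qed

lemma sin_lipschitz: "\<bar>sin x - sin y\<bar> \<le> \<bar>x - y\<bar>" for x y :: real
  using cos_lipschitz[of "pi / 2 - x" "pi / 2 - y"] by (simp add: cos_diff)

lemma norm_quadruple_sq: "(norm (a, b, c, d))\<^sup>2 = a\<^sup>2 + b\<^sup>2 + c\<^sup>2 + d\<^sup>2" for a b c d :: real
  by (simp add: norm_Pair)

lemma norm_quadruple_le: "norm (a, b, c, d) \<le> \<bar>a\<bar> + \<bar>b\<bar> + \<bar>c\<bar> + \<bar>d\<bar>" for a b c d :: real
  using norm_Pair_le[of a "(b, c, d)"] norm_Pair_le[of b "(c, d)"] norm_Pair_le[of c d] by simp

lemma abs_component_le_norm:
  fixes a b c d :: real
  shows "\<bar>a\<bar> \<le> norm (a, b, c, d)" "\<bar>b\<bar> \<le> norm (a, b, c, d)" "\<bar>c\<bar> \<le> norm (a, b, c, d)" "\<bar>d\<bar> \<le> norm (a, b, c, d)"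
  by (simp_all add: norm_Pair real_le_rsqrt)

lemma has_derivative_components:
  fixes x :: "real \<Rightarrow> real \<times> real \<times> real \<times> real"
  assumes "(x has_vector_derivative (a, b, c, d)) F"
  shows "((\<lambda>t. fst (x t)) has_vector_derivative a) F" "((\<lambda>t. fst (snd (x t))) has_vector_derivative b) F"
    "((\<lambda>t. fst (snd (snd (x t)))) has_vector_derivative c) F" "((\<lambda>t. snd (snd (snd (x t)))) has_vector_derivative d) F"
  using bounded_linear.has_vector_derivative[OF bounded_linear_fst assms]
    bounded_linear.has_vector_derivative[OF bounded_linear_compose[OF bounded_linear_fst bounded_linear_snd] assms]
    bounded_linear.has_vector_derivative[OF bounded_linear_compose[OF bounded_linear_fst
      bounded_linear_compose[OF bounded_linear_snd bounded_linear_snd]] assms]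
    bounded_linear.has_vector_derivative[OF bounded_linear_compose[OF bounded_linear_snd
      bounded_linear_compose[OF bounded_linear_snd bounded_linear_snd]] assms]
  by simp_all

context tracking_gains
begin

text \<open>
  The product \<open>sat y1 * y\<close> is only locally Lipschitz. Clipping its second factor at an a priori bound
  \<open>R t\<close> for the solution makes the field Lipschitz in the state without changing the solution.
\<close>

definition truncated_system ::
  "(real \<Rightarrow> real) \<Rightarrow> (real \<Rightarrow> real) \<Rightarrow> real \<Rightarrow> real \<times> real \<times> real \<times> real \<Rightarrow> real \<times> real \<times> real \<times> real" where
  "truncated_system \<kappa>r R t = (\<lambda>(y1, y2, \<xi>, \<eta>).
     (- C1 * sat y1 + (cos \<xi> - 1) + \<kappa>r t * (y2 + C1 * (sat y1 * clip (R t) y2)),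
      sin \<xi> - \<kappa>r t * (y1 + C1 * (sat y1 * clip (R t) y1)),
      \<eta> - \<kappa>r t * C1 * sat y1,
      - D * sat (k1 / D * \<xi> + k / D * \<eta> + C2 / D * sat y2)))"

lemma truncated_system_lipschitz:
  assumes \<kappa>: "\<bar>\<kappa>r t\<bar> \<le> \<kappa>m" and R: "0 \<le> R t"
  shows "norm (truncated_system \<kappa>r R t x - truncated_system \<kappa>r R t x')
    \<le> (4 + \<kappa>m * (5 + 2 * R t) + k1 + k + C2) * norm (x - x')"
proof -
  obtain y1 y2 \<xi> \<eta> where x: "x = (y1, y2, \<xi>, \<eta>)" by (cases x)
  obtain z1 z2 \<zeta> \<theta> where x': "x' = (z1, z2, \<zeta>, \<theta>)" by (cases x')
  define n where "n = norm (x - x')"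
  have n: "\<bar>y1 - z1\<bar> \<le> n" "\<bar>y2 - z2\<bar> \<le> n" "\<bar>\<xi> - \<zeta>\<bar> \<le> n" "\<bar>\<eta> - \<theta>\<bar> \<le> n"
    unfolding n_def x x' diff_Pair by (rule abs_component_le_norm)+
  have n0: "0 \<le> n" by (simp add: n_def)
  have s1: "\<bar>sat y1 - sat z1\<bar> \<le> n" and s2: "\<bar>sat y2 - sat z2\<bar> \<le> n"
    using sat_lipschitz n by (meson order_trans)+
  have C1s: "\<bar>C1 * (sat y1 - sat z1)\<bar> \<le> n"
  proof -
    have "\<bar>C1\<bar> * \<bar>sat y1 - sat z1\<bar> \<le> 1 * n" using C1_pos C1_le_one s1 by (intro mult_mono) auto
    then show ?thesis by (simp add: abs_mult)
  qed
  have clip: "\<bar>y - z + C1 * (sat y1 * clip (R t) y - sat z1 * clip (R t) z)\<bar> \<le> (2 + R t) * n"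
    if "\<bar>y - z\<bar> \<le> n" for y z
  proof -
    have "\<bar>sat y1 * clip (R t) y - sat z1 * clip (R t) z\<bar> \<le> R t * \<bar>y1 - z1\<bar> + \<bar>y - z\<bar>"
      by (rule sat_mult_clip_lipschitz[OF R])
    also have "\<dots> \<le> R t * n + n" using n that R by (intro add_mono mult_left_mono) auto
    finally have "\<bar>C1\<bar> * \<bar>sat y1 * clip (R t) y - sat z1 * clip (R t) z\<bar> \<le> 1 * (R t * n + n)"
      using C1_pos C1_le_one by (intro mult_mono) auto
    then have "\<bar>C1 * (sat y1 * clip (R t) y - sat z1 * clip (R t) z)\<bar> \<le> R t * n + n" by (simp add: abs_mult)
    then show ?thesis
      using that abs_triangle_ineq[of "y - z" "C1 * (sat y1 * clip (R t) y - sat z1 * clip (R t) z)"]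
      unfolding distrib_right by linarith
  qed
  have \<kappa>clip: "\<bar>\<kappa>r t * (y - z + C1 * (sat y1 * clip (R t) y - sat z1 * clip (R t) z))\<bar> \<le> \<kappa>m * ((2 + R t) * n)"
    if "\<bar>y - z\<bar> \<le> n" for y z
    unfolding abs_mult using clip[OF that] \<kappa> \<kappa>m_ge by (intro mult_mono) auto
  define a b c d where
    "a = - (C1 * (sat y1 - sat z1)) + (cos \<xi> - cos \<zeta>)
      + \<kappa>r t * (y2 - z2 + C1 * (sat y1 * clip (R t) y2 - sat z1 * clip (R t) z2))" and
    "b = sin \<xi> - sin \<zeta> - \<kappa>r t * (y1 - z1 + C1 * (sat y1 * clip (R t) y1 - sat z1 * clip (R t) z1))" and
    "c = \<eta> - \<theta> - \<kappa>r t * (C1 * (sat y1 - sat z1))" and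
    "d = - D * (sat (k1 / D * \<xi> + k / D * \<eta> + C2 / D * sat y2) - sat (k1 / D * \<zeta> + k / D * \<theta> + C2 / D * sat z2))"
  have eq: "truncated_system \<kappa>r R t x - truncated_system \<kappa>r R t x' = (a, b, c, d)"
    by (simp add: truncated_system_def x x' a_def b_def c_def d_def algebra_simps)
  have a: "\<bar>a\<bar> \<le> n + n + \<kappa>m * ((2 + R t) * n)"
    unfolding a_def using C1s cos_lipschitz[of \<xi> \<zeta>] n(3) \<kappa>clip[OF n(2)] by linarith
  have b: "\<bar>b\<bar> \<le> n + \<kappa>m * ((2 + R t) * n)"
    unfolding b_def using sin_lipschitz[of \<xi> \<zeta>] n(3) \<kappa>clip[OF n(1)] by linarith
  have "\<bar>\<kappa>r t * (C1 * (sat y1 - sat z1))\<bar> \<le> \<kappa>m * n"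
    unfolding abs_mult[of "\<kappa>r t"] using C1s \<kappa> \<kappa>m_ge by (intro mult_mono) auto
  then have c: "\<bar>c\<bar> \<le> n + \<kappa>m * n" unfolding c_def using n(4) by linarith
  have "\<bar>d\<bar> = D * \<bar>sat (k1 / D * \<xi> + k / D * \<eta> + C2 / D * sat y2) - sat (k1 / D * \<zeta> + k / D * \<theta> + C2 / D * sat z2)\<bar>"
    unfolding d_def abs_mult using D_pos by simp
  also have "\<dots> \<le> D * \<bar>(k1 / D * \<xi> + k / D * \<eta> + C2 / D * sat y2) - (k1 / D * \<zeta> + k / D * \<theta> + C2 / D * sat z2)\<bar>"
    using D_pos by (intro mult_left_mono sat_lipschitz) auto
  also have "\<dots> = \<bar>D * ((k1 / D * \<xi> + k / D * \<eta> + C2 / D * sat y2) - (k1 / D * \<zeta> + k / D * \<theta> + C2 / D * sat z2))\<bar>"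
    using D_pos by (simp add: abs_mult)
  also have "\<dots> = \<bar>k1 * (\<xi> - \<zeta>) + k * (\<eta> - \<theta>) + C2 * (sat y2 - sat z2)\<bar>"
    using D_pos by (simp add: algebra_simps)
  also have "\<dots> \<le> k1 * \<bar>\<xi> - \<zeta>\<bar> + k * \<bar>\<eta> - \<theta>\<bar> + C2 * \<bar>sat y2 - sat z2\<bar>"
  proof -
    have "\<bar>k1 * (\<xi> - \<zeta>)\<bar> = k1 * \<bar>\<xi> - \<zeta>\<bar>" "\<bar>k * (\<eta> - \<theta>)\<bar> = k * \<bar>\<eta> - \<theta>\<bar>"
      "\<bar>C2 * (sat y2 - sat z2)\<bar> = C2 * \<bar>sat y2 - sat z2\<bar>"
      using k1_pos k_pos C2_pos by (simp_all add: abs_mult)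
    then show ?thesis
      using abs_triangle_ineq[of "k1 * (\<xi> - \<zeta>) + k * (\<eta> - \<theta>)" "C2 * (sat y2 - sat z2)"]
        abs_triangle_ineq[of "k1 * (\<xi> - \<zeta>)" "k * (\<eta> - \<theta>)"] by linarith
  qed
  also have "\<dots> \<le> k1 * n + k * n + C2 * n"
    using k1_pos k_pos C2_pos n s2 by (intro add_mono mult_left_mono) auto
  finally have d: "\<bar>d\<bar> \<le> k1 * n + k * n + C2 * n" .
  have "norm (a, b, c, d) \<le> (n + n + \<kappa>m * ((2 + R t) * n)) + (n + \<kappa>m * ((2 + R t) * n)) + (n + \<kappa>m * n) + (k1 * n + k * n + C2 * n)"
    using norm_quadruple_le[of a b c d] a b c d by linarith
  also have "\<dots> = (4 + \<kappa>m * (5 + 2 * R t) + k1 + k + C2) * n" by (simp add: algebra_simps)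
  finally show ?thesis unfolding eq n_def .
qed

end

lemma continuous_on_clip [continuous_intros]:
  "continuous_on S r \<Longrightarrow> continuous_on S f \<Longrightarrow> continuous_on S (\<lambda>x. clip (r x) (f x))"
  unfolding clip_def by (intro continuous_intros)

context tracking_gains
begin

lemma continuous_on_truncated_system:
  assumes "continuous_on S \<kappa>r" "continuous_on S R" "continuous_on S x"
  shows "continuous_on S (\<lambda>t. truncated_system \<kappa>r R t (x t))"
  unfolding truncated_system_def case_prod_beta using D_pos
  by (intro continuous_intros assms) auto

text \<open>The bound does not involve the clipping radius, because |clip r y| \<le> |y|; the radius
  can therefore be defined from it without circularity. Clipping may spoil the exact cancellation of
  the rotation, and so only quadratic growth is claimed.\<close>

lemma truncated_growth:
  fixes y1 y2 \<xi> \<kappa> r :: real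
  assumes \<kappa>: "\<bar>\<kappa>\<bar> \<le> \<kappa>m" and r: "0 \<le> r"
  shows "2 * y1 * (- C1 * sat y1 + (cos \<xi> - 1) + \<kappa> * (y2 + C1 * (sat y1 * clip r y2)))
      + 2 * y2 * (sin \<xi> - \<kappa> * (y1 + C1 * (sat y1 * clip r y1)))
    \<le> (4 + 4 * \<kappa>m) * (y1\<^sup>2 + y2\<^sup>2 + 1)"
proof -
  have C1s: "\<bar>C1 * sat y1\<bar> \<le> 1"
    unfolding abs_mult using C1_pos C1_le_one abs_sat_le_one[of y1] mult_mono[of "\<bar>C1\<bar>" 1 "\<bar>sat y1\<bar>" 1] by auto
  have clip: "\<bar>\<kappa> * (y + C1 * (sat y1 * clip r y))\<bar> \<le> \<kappa>m * (2 * \<bar>y\<bar>)" for y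
  proof -
    have "\<bar>C1 * (sat y1 * clip r y)\<bar> = \<bar>C1 * sat y1\<bar> * \<bar>clip r y\<bar>" by (simp add: abs_mult)
    also have "\<dots> \<le> 1 * \<bar>y\<bar>" using C1s abs_clip_le(2)[OF r] by (intro mult_mono) auto
    finally have "\<bar>y + C1 * (sat y1 * clip r y)\<bar> \<le> 2 * \<bar>y\<bar>" by linarith
    then show ?thesis unfolding abs_mult[of \<kappa>] using \<kappa> \<kappa>m_ge by (intro mult_mono) auto
  qed
  define f1 where "f1 = - C1 * sat y1 + (cos \<xi> - 1) + \<kappa> * (y2 + C1 * (sat y1 * clip r y2))"
  define f2 where "f2 = sin \<xi> - \<kappa> * (y1 + C1 * (sat y1 * clip r y1))"
  have f1: "\<bar>f1\<bar> \<le> 3 + \<kappa>m * (2 * \<bar>y2\<bar>)"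
    unfolding f1_def using C1s clip[of y2] cos_ge_minus_one[of \<xi>] cos_le_one[of \<xi>] by linarith
  have f2: "\<bar>f2\<bar> \<le> 1 + \<kappa>m * (2 * \<bar>y1\<bar>)"
    unfolding f2_def using clip[of y1] sin_ge_minus_one[of \<xi>] sin_le_one[of \<xi>] by linarith
  have "y1 * f1 \<le> \<bar>y1\<bar> * (3 + \<kappa>m * (2 * \<bar>y2\<bar>))"
  proof -
    have "y1 * f1 \<le> \<bar>y1\<bar> * \<bar>f1\<bar>" unfolding abs_mult[symmetric] by simp
    also have "\<dots> \<le> \<bar>y1\<bar> * (3 + \<kappa>m * (2 * \<bar>y2\<bar>))" using f1 by (intro mult_left_mono) auto
    finally show ?thesis .
  qed
  moreover have "y2 * f2 \<le> \<bar>y2\<bar> * (1 + \<kappa>m * (2 * \<bar>y1\<bar>))"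
  proof -
    have "y2 * f2 \<le> \<bar>y2\<bar> * \<bar>f2\<bar>" unfolding abs_mult[symmetric] by simp
    also have "\<dots> \<le> \<bar>y2\<bar> * (1 + \<kappa>m * (2 * \<bar>y1\<bar>))" using f2 by (intro mult_left_mono) auto
    finally show ?thesis .
  qed
  moreover have "2 * (\<bar>y1\<bar> * (3 + \<kappa>m * (2 * \<bar>y2\<bar>))) + 2 * (\<bar>y2\<bar> * (1 + \<kappa>m * (2 * \<bar>y1\<bar>)))
      = 6 * \<bar>y1\<bar> + 2 * \<bar>y2\<bar> + 4 * \<kappa>m * (2 * \<bar>y1\<bar> * \<bar>y2\<bar>)" by (simp add: algebra_simps)
  moreover have "4 * \<kappa>m * (2 * \<bar>y1\<bar> * \<bar>y2\<bar>) \<le> 4 * \<kappa>m * (y1\<^sup>2 + y2\<^sup>2)"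
    using sum_squares_bound[of "\<bar>y1\<bar>" "\<bar>y2\<bar>"] \<kappa>m_ge by (intro mult_left_mono) auto
  moreover have "2 * \<bar>y1\<bar> \<le> y1\<^sup>2 + 1" "2 * \<bar>y2\<bar> \<le> y2\<^sup>2 + 1"
    using sum_squares_bound[of "\<bar>y1\<bar>" 1] sum_squares_bound[of "\<bar>y2\<bar>" 1] by auto
  moreover have "(4 + 4 * \<kappa>m) * (y1\<^sup>2 + y2\<^sup>2 + 1) = 4 * y1\<^sup>2 + 4 * y2\<^sup>2 + 4 + 4 * \<kappa>m * (y1\<^sup>2 + y2\<^sup>2) + 4 * \<kappa>m"
    by (simp add: algebra_simps)
  moreover have "0 \<le> y1\<^sup>2" "0 \<le> y2\<^sup>2" by simp_all
  ultimately have "2 * (y1 * f1) + 2 * (y2 * f2) \<le> (4 + 4 * \<kappa>m) * (y1\<^sup>2 + y2\<^sup>2 + 1)"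
    using \<kappa>m_ge by linarith
  then show ?thesis by (simp add: f1_def f2_def mult.assoc)
qed

lemma error_system_solution_exists:
  assumes cont: "continuous_on {0..} \<kappa>r" and \<kappa>: "\<And>t. 0 \<le> t \<Longrightarrow> \<bar>\<kappa>r t\<bar> \<le> \<kappa>m" and t0: "0 \<le> t0"
  shows "\<exists>x. solution_from (error_system D k1 k C1 C2 \<kappa>r) t0 x \<and> x t0 = x0"
proof -
  define B where "B = 4 + 4 * \<kappa>m"
  define Q where "Q p = (fst p)\<^sup>2 + (fst (snd p))\<^sup>2 + 1" for p :: "real \<times> real \<times> real \<times> real"
  \<comment> \<open>The bound that Gronwall's inequality gives with the rate \<open>B\<close> of
    \<open>truncated_growth\<close>; it serves both as clipping radius and as a priori
    bound.\<close>
  define R where "R t = Q x0 * exp (B * (t - t0))" for t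
  define L where "L t = 4 + \<kappa>m * (5 + 2 * R t) + k1 + k + C2" for t
  have B0: "0 < B" using \<kappa>m_ge by (simp add: B_def)
  have Q0: "0 < Q p" for p by (simp add: Q_def add_nonneg_pos)
  have R0: "0 \<le> R t" for t using Q0[of x0] by (simp add: R_def)
  have \<kappa>': "\<bar>\<kappa>r t\<bar> \<le> \<kappa>m" if "t0 \<le> t" for t using \<kappa>[of t] t0 that by simp
  have "\<exists>x. solution_from (truncated_system \<kappa>r R) t0 x \<and> x t0 = x0"
  proof (rule solution_exists_lipschitz[where L = L])
    fix x :: "real \<Rightarrow> real \<times> real \<times> real \<times> real"
    assume "continuous_on {t0..} x"
    moreover have "continuous_on {t0..} \<kappa>r" by (rule continuous_on_subset[OF cont]) (use t0 in auto)
    moreover have "continuous_on {t0..} R" unfolding R_def by (intro continuous_intros)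
    ultimately show "continuous_on {t0..} (\<lambda>t. truncated_system \<kappa>r R t (x t))"
      by (intro continuous_on_truncated_system)
  next
    fix t x y assume "t0 \<le> t"
    then show "norm (truncated_system \<kappa>r R t x - truncated_system \<kappa>r R t y) \<le> L t * norm (x - y)"
      unfolding L_def by (intro truncated_system_lipschitz \<kappa>' R0)
  next
    fix s t assume "t0 \<le> s" "s \<le> t"
    then have "R s \<le> R t" using Q0[of x0] B0 by (simp add: R_def)
    then show "L s \<le> L t" using \<kappa>m_ge by (simp add: L_def)
  next
    show "0 < L t0"
      using k1_pos k_pos C2_pos \<kappa>m_ge R0[of t0] by (simp add: L_def add_pos_pos add_nonneg_pos)
  qed
  then obtain x where x: "solution_from (truncated_system \<kappa>r R) t0 x" "x t0 = x0" by blast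
  define y1 y2 \<xi> \<eta> where "y1 t = fst (x t)" and "y2 t = fst (snd (x t))"
    and "\<xi> t = fst (snd (snd (x t)))" and "\<eta> t = snd (snd (snd (x t)))" for t
  have xt: "x t = (y1 t, y2 t, \<xi> t, \<eta> t)" for t by (simp add: y1_def y2_def \<xi>_def \<eta>_def)
  define f1 where "f1 t = - C1 * sat (y1 t) + (cos (\<xi> t) - 1) + \<kappa>r t * (y2 t + C1 * (sat (y1 t) * clip (R t) (y2 t)))" for t
  define f2 where "f2 t = sin (\<xi> t) - \<kappa>r t * (y1 t + C1 * (sat (y1 t) * clip (R t) (y1 t)))" for t
  have d12: "(y1 has_real_derivative f1 t) (at t within {t0..})" "(y2 has_real_derivative f2 t) (at t within {t0..})"
    if "t0 \<le> t" for t
  proof -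
    have "(x has_vector_derivative truncated_system \<kappa>r R t (x t)) (at t within {t0..})"
      using x that by (simp add: solution_from_def)
    note components = has_derivative_components[OF this[unfolded truncated_system_def case_prod_beta]]
    show "(y1 has_real_derivative f1 t) (at t within {t0..})" "(y2 has_real_derivative f2 t) (at t within {t0..})"
      using components(1,2)
      by (simp_all add: has_real_derivative_iff_has_vector_derivative f1_def f2_def
          y1_def[abs_def] y2_def[abs_def] \<xi>_def)
  qed
  have bound: "Q (x t) \<le> R t" if t: "t0 \<le> t" for t
  proof -
    \<comment> \<open>Gronwall by an integrating factor: \<open>g\<close> has a nonpositive
      derivative.\<close>
    define g where "g t = ((y1 t)\<^sup>2 + (y2 t)\<^sup>2 + 1) * exp (- B * (t - t0))" for t
    have "g t \<le> Q x0"
    proof (rule sublevel_invariant[where f = g and ?t0.0 = t0 and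
          f' = "\<lambda>t. (2 * y1 t * f1 t + 2 * y2 t * f2 t - B * ((y1 t)\<^sup>2 + (y2 t)\<^sup>2 + 1)) * exp (- B * (t - t0))"])
      fix s assume s: "t0 \<le> s"
      show "(g has_real_derivative (2 * y1 s * f1 s + 2 * y2 s * f2 s - B * ((y1 s)\<^sup>2 + (y2 s)\<^sup>2 + 1)) * exp (- B * (s - t0)))
          (at s within {t0..})"
        unfolding g_def by (rule derivative_eq_intros d12[OF s] refl)+ (simp add: algebra_simps)
      show "(2 * y1 s * f1 s + 2 * y2 s * f2 s - B * ((y1 s)\<^sup>2 + (y2 s)\<^sup>2 + 1)) * exp (- B * (s - t0)) \<le> 0"
        using truncated_growth[OF \<kappa>'[OF s] R0, of "y1 s" "\<xi> s" "y2 s" s]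
        unfolding B_def f1_def f2_def by (intro mult_nonpos_nonneg) auto
    next
      show "g t0 \<le> Q x0" using x(2) by (simp add: g_def Q_def y1_def y2_def)
    qed (rule t)
    then have "Q (x t) * exp (- B * (t - t0)) \<le> Q x0" by (simp add: g_def Q_def xt)
    moreover have "exp (- B * (t - t0)) = 1 / exp (B * (t - t0))" by (simp add: exp_minus inverse_eq_divide)
    ultimately have "Q (x t) / exp (B * (t - t0)) \<le> Q x0" by simp
    then show ?thesis unfolding R_def by (simp only: pos_divide_le_eq exp_gt_zero)
  qed
  have "solution_from (error_system D k1 k C1 C2 \<kappa>r) t0 x"
    unfolding solution_from_def
  proof (intro allI impI)
    fix t assume t: "t0 \<le> t"
    \<comment> \<open>The summand 1 in \<open>Q\<close> turns the bound on the squares into one on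
      |y1| and |y2| themselves, so that clipping at \<open>R t\<close> changes nothing.\<close>
    have "2 * \<bar>y1 t\<bar> \<le> (y1 t)\<^sup>2 + 1" "2 * \<bar>y2 t\<bar> \<le> (y2 t)\<^sup>2 + 1"
      using sum_squares_bound[of "\<bar>y1 t\<bar>" 1] sum_squares_bound[of "\<bar>y2 t\<bar>" 1] by auto
    moreover have "(y1 t)\<^sup>2 + (y2 t)\<^sup>2 + 1 \<le> R t" using bound[OF t] by (simp add: Q_def xt)
    ultimately have "\<bar>y1 t\<bar> \<le> R t" "\<bar>y2 t\<bar> \<le> R t"
      using zero_le_power2[of "y1 t"] zero_le_power2[of "y2 t"] by linarith+
    then have "error_system D k1 k C1 C2 \<kappa>r t (x t) = truncated_system \<kappa>r R t (x t)"
      by (simp add: error_system_def truncated_system_def xt Let_def clip_eq algebra_simps)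
    then show "(x has_vector_derivative error_system D k1 k C1 C2 \<kappa>r t (x t)) (at t within {t0..})"
      using x(1) t by (simp add: solution_from_def)
  qed
  then show ?thesis using x(2) by blast
qed

section \<open>Global asymptotic stability of the error system\<close>

lemma inner_lyap_le: "inner_lyap \<xi> \<eta> \<le> (3 * k\<^sup>2 + 2 * k1\<^sup>2) / D\<^sup>2 * (\<xi>\<^sup>2 + \<eta>\<^sup>2)"
proof -
  define z where "z = (k1 * \<xi> + k * \<eta>) / D"
  define H where "H = k / D * \<eta>"
  have "2 * (\<bar>H\<bar> * \<bar>z\<bar>) \<le> H\<^sup>2 + z\<^sup>2"
    using sum_squares_bound[of "\<bar>H\<bar>" "\<bar>z\<bar>"] by (simp add: mult.assoc)
  then have "inner_lyap \<xi> \<eta> \<le> H\<^sup>2 + z\<^sup>2"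
    using fast_lyap_upper[of z H] zero_le_power2[of H] zero_le_power2[of z]
    unfolding inner_lyap_def z_def[symmetric] H_def[symmetric] by argo
  also have "z\<^sup>2 \<le> (2 * (k1\<^sup>2 * \<xi>\<^sup>2) + 2 * (k\<^sup>2 * \<eta>\<^sup>2)) / D\<^sup>2"
  proof -
    have "(k1 * \<xi> + k * \<eta>)\<^sup>2 \<le> 2 * (k1 * \<xi>)\<^sup>2 + 2 * (k * \<eta>)\<^sup>2"
      using sum_squares_bound[of "k1 * \<xi>" "k * \<eta>"] by (simp add: power2_sum)
    then show ?thesis by (simp add: z_def power_divide power_mult_distrib divide_right_mono)
  qed
  also have "H\<^sup>2 + (2 * (k1\<^sup>2 * \<xi>\<^sup>2) + 2 * (k\<^sup>2 * \<eta>\<^sup>2)) / D\<^sup>2 = (2 * (k1\<^sup>2 * \<xi>\<^sup>2) + 3 * (k\<^sup>2 * \<eta>\<^sup>2)) / D\<^sup>2"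
    by (simp add: H_def power_mult_distrib power_divide add_divide_distrib)
  also have "\<dots> \<le> (3 * k\<^sup>2 + 2 * k1\<^sup>2) * (\<xi>\<^sup>2 + \<eta>\<^sup>2) / D\<^sup>2"
    by (intro divide_right_mono) (simp_all add: algebra_simps)
  finally show ?thesis by simp
qed

lemma run_of_solution:
  assumes sol: "solution_from (error_system D k1 k C1 C2 \<kappa>r) t0 x"
    and \<kappa>: "\<And>t. 0 \<le> t \<Longrightarrow> \<bar>\<kappa>r t\<bar> \<le> \<kappa>m" and t0: "0 \<le> t0"
  shows "tracking_run D k \<beta> \<kappa>m t0 1 (\<lambda>_. 1) \<kappa>r (\<lambda>t. fst (x t)) (\<lambda>t. fst (snd (x t)))
    (\<lambda>t. fst (snd (snd (x t)))) (\<lambda>t. snd (snd (snd (x t))))"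
proof unfold_locales
  fix t assume t: "t0 \<le> t"
  show "\<bar>\<kappa>r t\<bar> \<le> \<kappa>m" using \<kappa> t t0 by simp
  have "(x has_vector_derivative error_system D k1 k C1 C2 \<kappa>r t (x t)) (at t within {t0..})"
    using sol t by (simp add: solution_from_def)
  note components = has_derivative_components[OF this[unfolded error_system_def Let_def case_prod_beta]]
  show "((\<lambda>t. fst (x t)) has_real_derivative 1 * (- C1 * sat (fst (x t)) + (cos (fst (snd (snd (x t)))) - 1)
      + \<kappa>r t * (1 + C1 * sat (fst (x t))) * fst (snd (x t)))) (at t within {t0..})"
    using components(1) by (simp add: has_real_derivative_iff_has_vector_derivative)
  show "((\<lambda>t. fst (snd (x t))) has_real_derivative 1 * (sin (fst (snd (snd (x t))))
      - \<kappa>r t * (1 + C1 * sat (fst (x t))) * fst (x t))) (at t within {t0..})"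
    using components(2) by (simp add: has_real_derivative_iff_has_vector_derivative)
  show "((\<lambda>t. fst (snd (snd (x t)))) has_real_derivative
      1 * (snd (snd (snd (x t))) - \<kappa>r t * C1 * sat (fst (x t)))) (at t within {t0..})"
    using components(3) by (simp add: has_real_derivative_iff_has_vector_derivative)
  show "((\<lambda>t. snd (snd (snd (x t)))) has_real_derivative
      1 * (- D * sat (k1 / D * fst (snd (snd (x t))) + k / D * snd (snd (snd (x t))) + C2 / D * sat (fst (snd (x t))))))
      (at t within {t0..})"
    using components(4) by (simp add: has_real_derivative_iff_has_vector_derivative)
qed simp_all

text \<open>Attractivity is the limit along a run with time factor 1. For stability the initial
  state is taken so small that the steering loop starts inside the captured set, whence
  \<open>U\<close>, which is equivalent to the squared norm, decreases from \<open>t0\<close>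
  on.\<close>

theorem error_system_stable:
  assumes cont: "continuous_on {0..} \<kappa>r" and \<kappa>: "\<And>t. 0 \<le> t \<Longrightarrow> \<bar>\<kappa>r t\<bar> \<le> \<kappa>m"
  shows "globally_asymptotically_stable (error_system D k1 k C1 C2 \<kappa>r)"
  unfolding globally_asymptotically_stable_def
proof (intro allI impI conjI)
  fix t0 :: real and x0 assume "0 \<le> t0"
  then show "\<exists>x. solution_from (error_system D k1 k C1 C2 \<kappa>r) t0 x \<and> x t0 = x0"
    using error_system_solution_exists[OF cont \<kappa>] by blast
next
  fix t0 e :: real assume t0: "0 \<le> t0" and e: "0 < e"
  define c where "c = (3 * k\<^sup>2 + 2 * k1\<^sup>2) / D\<^sup>2"
  \<comment> \<open>For \<open>n = norm (x t0)\<close>, the first entry gives V t0 \<le> c n^2 \<le>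
    ((1 + c) n)^2 \<le> (200 \<epsilon>)^2; the second rests on 48 * 4 k^2 n^2 \<le> (14 k n)^2, as
    192 \<le> 196.\<close>
  define \<delta> where "\<delta> = min (200 * \<epsilon> / (1 + c)) (e / (14 * k))"
  have c0: "0 \<le> c" by (simp add: c_def)
  have \<delta>: "0 < \<delta>" using \<epsilon>_pos c0 e k_pos by (simp add: \<delta>_def)
  have "norm (x t) < e"
    if sol: "solution_from (error_system D k1 k C1 C2 \<kappa>r) t0 x" and small: "norm (x t0) < \<delta>" and t: "t0 \<le> t" for x t
  proof -
    define y1 y2 \<xi> \<eta> where "y1 t = fst (x t)" and "y2 t = fst (snd (x t))"
      and "\<xi> t = fst (snd (snd (x t)))" and "\<eta> t = snd (snd (snd (x t)))" for t
    have xt: "x t = (y1 t, y2 t, \<xi> t, \<eta> t)" for t by (simp add: y1_def y2_def \<xi>_def \<eta>_def)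
    interpret tracking_run D k \<beta> \<kappa>m t0 1 "\<lambda>_. 1" \<kappa>r y1 y2 \<xi> \<eta>
      using run_of_solution[OF sol \<kappa> t0] by (simp add: y1_def[abs_def] y2_def[abs_def] \<xi>_def[abs_def] \<eta>_def[abs_def])
    define n where "n = norm (x t0)"
    have n0: "0 \<le> n" by (simp add: n_def)
    have n: "(1 + c) * n \<le> 200 * \<epsilon>" "14 * k * n < e"
      using small c0 k_pos unfolding n_def \<delta>_def by (auto simp: field_simps)
    have n2: "n\<^sup>2 = (y1 t0)\<^sup>2 + (y2 t0)\<^sup>2 + (\<xi> t0)\<^sup>2 + (\<eta> t0)\<^sup>2" unfolding n_def xt norm_quadruple_sq ..
    have "V t0 \<le> c * ((\<xi> t0)\<^sup>2 + (\<eta> t0)\<^sup>2)" unfolding V_def c_def by (rule inner_lyap_le)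
    also have "\<dots> \<le> c * n\<^sup>2" unfolding n2 using c0 by (intro mult_left_mono) auto
    also have "\<dots> \<le> ((1 + c) * n)\<^sup>2"
    proof -
      have "c * n\<^sup>2 \<le> (1 + c)\<^sup>2 * n\<^sup>2" using c0 by (intro mult_right_mono) (auto simp: power2_eq_square algebra_simps)
      then show ?thesis by (simp add: power_mult_distrib)
    qed
    also have "\<dots> \<le> (200 * \<epsilon>)\<^sup>2" using n c0 n0 by (intro power_mono) auto
    finally have V0: "V t0 \<le> (200 * \<epsilon>)\<^sup>2" .
    have "U t \<le> U t0" by (rule U_antimono) (use capture_invariant[OF V0] t in auto)
    then have "(norm (x t))\<^sup>2 \<le> 48 * U t0"
      unfolding xt[of t] norm_quadruple_sq using state_sq_le[of t] by linarith
    also have "\<dots> \<le> 48 * (4 * k\<^sup>2 * n\<^sup>2)" using U_le_state_sq[of t0] unfolding n2 by simp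
    also have "\<dots> \<le> (14 * k * n)\<^sup>2" by (simp add: power_mult_distrib)
    finally have "norm (x t) \<le> 14 * k * n" using k_pos n0 by (simp add: power2_le_iff_abs_le)
    then show ?thesis using n by simp
  qed
  then show "\<exists>\<delta>>0. \<forall>x. solution_from (error_system D k1 k C1 C2 \<kappa>r) t0 x \<and> norm (x t0) < \<delta>
      \<longrightarrow> (\<forall>t\<ge>t0. norm (x t) < e)"
    using \<delta> by blast
next
  fix t0 :: real and x assume t0: "0 \<le> t0" and sol: "solution_from (error_system D k1 k C1 C2 \<kappa>r) t0 x"
  interpret tracking_run D k \<beta> \<kappa>m t0 1 "\<lambda>_. 1" \<kappa>r "\<lambda>t. fst (x t)" "\<lambda>t. fst (snd (x t))"
    "\<lambda>t. fst (snd (snd (x t)))" "\<lambda>t. snd (snd (snd (x t)))"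
    by (rule run_of_solution[OF sol \<kappa> t0])
  have "((\<lambda>t. (fst (x t), fst (snd (x t)), fst (snd (snd (x t))), snd (snd (snd (x t))))) \<longlongrightarrow> (0, 0, 0, 0)) at_top"
    by (intro tendsto_Pair states_tendsto_zero)
  then show "(x \<longlongrightarrow> 0) at_top" by (simp add: zero_prod_def)
qed

end

section \<open>From the vehicle to the error system\<close>

text \<open>The vector (1, w) has length sqrt (1 + w^2) and polar angle \<open>arctan w\<close>;
  these are its components after a rotation by \<open>p\<close>.\<close>

lemma sqrt_mult_cos_sin_add_arctan:
  fixes p w :: real
  shows "sqrt (1 + w\<^sup>2) * cos (p + arctan w) = cos p - w * sin p"
    and "sqrt (1 + w\<^sup>2) * sin (p + arctan w) = sin p + w * cos p"
proof -
  define r where "r = sqrt (1 + w\<^sup>2)"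
  have "r \<noteq> 0" by (simp add: r_def add_pos_nonneg less_imp_neq[symmetric])
  then show "sqrt (1 + w\<^sup>2) * cos (p + arctan w) = cos p - w * sin p"
    and "sqrt (1 + w\<^sup>2) * sin (p + arctan w) = sin p + w * cos p"
    unfolding cos_add sin_add cos_arctan sin_arctan r_def[symmetric] by (simp_all add: field_simps)
qed

text \<open>With \<open>w\<close> the vehicle curvature times \<open>d\<close>, the velocity of the
  target point is the vehicle speed times the vector (1, w) rotated by the vehicle heading;
  \<open>target_speed\<close> and \<open>target_heading\<close> are its polar coordinates.\<close>

lemma target_point_deriv:
  assumes veh: "vehicle Vmin Vmax m" and t: "0 \<le> t"
  shows "(target_p d m has_real_derivative target_speed d m t * cos (target_heading d m t)) (at t within {0..})"
    and "(target_q d m has_real_derivative target_speed d m t * sin (target_heading d m t)) (at t within {0..})"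
proof -
  define w where "w = veh_curv m t * d"
  have ders: "(veh_x m has_real_derivative veh_speed m t * cos (veh_heading m t)) (at t within {0..})"
    "(veh_y m has_real_derivative veh_speed m t * sin (veh_heading m t)) (at t within {0..})"
    "(veh_heading m has_real_derivative veh_speed m t * veh_curv m t) (at t within {0..})"
    using veh t by (auto simp: vehicle_def)
  have "target_speed d m t * cos (target_heading d m t)
      = veh_speed m t * (cos (veh_heading m t) - w * sin (veh_heading m t))"
    unfolding target_speed_def target_heading_def w_def mult.assoc[of "veh_speed m t"] sqrt_mult_cos_sin_add_arctan ..
  moreover have "target_speed d m t * sin (target_heading d m t)
      = veh_speed m t * (sin (veh_heading m t) + w * cos (veh_heading m t))"
    unfolding target_speed_def target_heading_def w_def mult.assoc[of "veh_speed m t"] sqrt_mult_cos_sin_add_arctan ..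
  moreover have "(target_p d m has_real_derivative veh_speed m t * (cos (veh_heading m t) - w * sin (veh_heading m t)))
      (at t within {0..})"
    unfolding target_p_def[abs_def]
    by (rule derivative_eq_intros ders refl)+ (simp add: w_def algebra_simps)
  moreover have "(target_q d m has_real_derivative veh_speed m t * (sin (veh_heading m t) + w * cos (veh_heading m t)))
      (at t within {0..})"
    unfolding target_q_def[abs_def]
    by (rule derivative_eq_intros ders refl)+ (simp add: w_def algebra_simps)
  ultimately show "(target_p d m has_real_derivative target_speed d m t * cos (target_heading d m t)) (at t within {0..})"
    and "(target_q d m has_real_derivative target_speed d m t * sin (target_heading d m t)) (at t within {0..})"
    by simp_all
qed

lemma target_speed_ge:
  assumes "vehicle Vmin Vmax m" "0 \<le> t" "0 < Vmin"
  shows "Vmin \<le> target_speed d m t"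
proof -
  have V: "Vmin \<le> veh_speed m t" using assms by (simp add: vehicle_def)
  have "veh_speed m t * 1 \<le> veh_speed m t * sqrt (1 + (veh_curv m t * d)\<^sup>2)"
    using V assms by (intro mult_left_mono) auto
  then show ?thesis using V by (simp add: target_speed_def)
qed

context tracking_gains
begin

text \<open>The errors are differentiated in the moving frame of the path. Time is not rescaled: the
  target speed stays in front of the field as the time factor and is at least
  \<open>Vmin\<close>.\<close>

lemma run_of_motion:
  assumes path: "arclength_path s0 \<Gamma>" and curv: "\<And>s. s0 \<le> s \<Longrightarrow> \<bar>path_curv \<Gamma> s\<bar> \<le> \<kappa>m"
    and Vmin: "0 < Vmin" and veh: "vehicle Vmin Vmax m"
    and loop: "closed_loop \<Gamma> s0 d D k1 k C1 C2 m"
  shows "tracking_run D k \<beta> \<kappa>m 0 Vmin (target_speed d m) (\<lambda>t. path_curv \<Gamma> (ref_arc m t))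
    (err_y1 \<Gamma> d m) (err_y2 \<Gamma> d m) (err_xi \<Gamma> d m) (err_eta \<Gamma> m)"
proof -
  define S where "S = ref_arc m"
  define u1 where "u1 t = C1 * sat (err_y1 \<Gamma> d m t)" for t
  define vd where "vd = target_speed d m"
  have vd: "Vmin \<le> vd t" if "0 \<le> t" for t
    unfolding vd_def using target_speed_ge[OF veh that Vmin] .
  have Sd: "(S has_real_derivative vd t * (1 + u1 t)) (at t within {0..})"
    and \<theta>d: "(target_heading d m has_real_derivative vd t * target_curv m t) (at t within {0..})"
    and \<omega>d: "(target_curv m has_real_derivative vd t * (path_curv_rate \<Gamma> (S t) * (1 + u1 t)
      - D * sat (k1 / D * err_xi \<Gamma> d m t + k / D * err_eta \<Gamma> m t + C2 / D * sat (err_y2 \<Gamma> d m t)))) (at t within {0..})"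
    if "0 \<le> t" for t
    using loop that by (auto simp: closed_loop_def Let_def control_u1_def control_u2_def S_def u1_def vd_def)
  \<comment> \<open>From C1 \<le> 1. It keeps the virtual vehicle from moving backwards past
    \<open>s0\<close>, below which neither the path equations nor the curvature bound are
    available.\<close>
  have u1: "0 \<le> 1 + u1 t" for t
  proof -
    have "\<bar>u1 t\<bar> \<le> 1 * 1"
      unfolding u1_def abs_mult using C1_pos C1_le_one abs_sat_le_one by (intro mult_mono) auto
    then show ?thesis by linarith
  qed
  have S_ge: "s0 \<le> S t" if t: "0 \<le> t" for t
  proof -
    have "- S t \<le> - s0"
    proof (rule sublevel_invariant[where f = "\<lambda>t. - S t" and ?t0.0 = 0 and f' = "\<lambda>t. - (vd t * (1 + u1 t))"])
      fix s :: real assume s: "0 \<le> s"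
      show "((\<lambda>t. - S t) has_real_derivative - (vd s * (1 + u1 s))) (at s within {0..})"
        by (intro DERIV_minus Sd s)
      show "- (vd s * (1 + u1 s)) \<le> 0" using vd[OF s] Vmin u1[of s] by simp
    qed (use loop t in \<open>auto simp: closed_loop_def S_def\<close>)
    then show ?thesis by simp
  qed
  \<comment> \<open>At \<open>S t = s0\<close> only a one-sided derivative of the path is given; it
    suffices because \<open>S\<close> stays in \<open>{s0..}\<close>.\<close>
  have chain: "((\<lambda>t. g (S t)) has_real_derivative g' * (vd t * (1 + u1 t))) (at t within {0..})"
    if t: "0 \<le> t" and g: "(g has_real_derivative g') (at (S t) within {s0..})" for g g' t
  proof -
    have "(g has_real_derivative g') (at (S t) within S ` {0..})"
      by (rule DERIV_subset[OF g]) (use S_ge in auto)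
    from DERIV_image_chain[OF this Sd[OF t]] show ?thesis by (simp add: o_def)
  qed
  define \<psi> where "\<psi> t = path_heading \<Gamma> (S t)" for t
  define \<kappa> where "\<kappa> t = path_curv \<Gamma> (S t)" for t
  have pathd: "((\<lambda>t. path_p \<Gamma> (S t)) has_real_derivative cos (\<psi> t) * (vd t * (1 + u1 t))) (at t within {0..})"
    "((\<lambda>t. path_q \<Gamma> (S t)) has_real_derivative sin (\<psi> t) * (vd t * (1 + u1 t))) (at t within {0..})"
    "(\<psi> has_real_derivative \<kappa> t * (vd t * (1 + u1 t))) (at t within {0..})"
    "(\<kappa> has_real_derivative path_curv_rate \<Gamma> (S t) * (vd t * (1 + u1 t))) (at t within {0..})"
    if t: "0 \<le> t" for t
    unfolding \<psi>_def \<kappa>_def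
    by (rule chain[OF t], use path S_ge[OF t] in \<open>simp add: arclength_path_def\<close>)+
  define \<theta> where "\<theta> = target_heading d m"
  define ep where "ep t = target_p d m t - path_p \<Gamma> (S t)" for t
  define eq where "eq t = target_q d m t - path_q \<Gamma> (S t)" for t
  have y1: "err_y1 \<Gamma> d m = (\<lambda>t. ep t * cos (\<psi> t) + eq t * sin (\<psi> t))"
    by (simp add: err_y1_def err_p_def err_q_def ep_def eq_def \<psi>_def S_def fun_eq_iff)
  have y2: "err_y2 \<Gamma> d m = (\<lambda>t. - ep t * sin (\<psi> t) + eq t * cos (\<psi> t))"
    by (simp add: err_y2_def err_p_def err_q_def ep_def eq_def \<psi>_def S_def fun_eq_iff)
  have xi: "err_xi \<Gamma> d m = (\<lambda>t. \<theta> t - \<psi> t)"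
    by (simp add: err_xi_def \<theta>_def \<psi>_def S_def fun_eq_iff)
  have eta: "err_eta \<Gamma> m = (\<lambda>t. target_curv m t - \<kappa> t)"
    by (simp add: err_eta_def \<kappa>_def S_def fun_eq_iff)
  have epd: "(ep has_real_derivative vd t * cos (\<theta> t) - cos (\<psi> t) * (vd t * (1 + u1 t))) (at t within {0..})"
    and eqd: "(eq has_real_derivative vd t * sin (\<theta> t) - sin (\<psi> t) * (vd t * (1 + u1 t))) (at t within {0..})"
    if t: "0 \<le> t" for t
    unfolding ep_def eq_def vd_def \<theta>_def
    by (intro DERIV_diff target_point_deriv[OF veh t] pathd[OF t, unfolded vd_def])+
  show ?thesis
  proof unfold_locales
    fix t :: real assume t: "0 \<le> t"
    show "Vmin \<le> target_speed d m t" by (rule target_speed_ge[OF veh t Vmin])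
    show "\<bar>path_curv \<Gamma> (ref_arc m t)\<bar> \<le> \<kappa>m" using curv S_ge[OF t] by (simp add: S_def)
    have y1d: "(err_y1 \<Gamma> d m has_real_derivative
        vd t * (- u1 t + (cos (err_xi \<Gamma> d m t) - 1) + \<kappa> t * (1 + u1 t) * err_y2 \<Gamma> d m t)) (at t within {0..})"
    proof -
      \<comment> \<open>The left side is the form in which the derivative rules deliver the result.
        The identity cos^2 + sin^2 = 1 collapses the velocity of the reference point to
        \<open>- w\<close>, where \<open>w\<close> stands for \<open>1 + u1 t\<close>.\<close>
      have alg: "(vt * cos th - cos p * (vt * w)) * cos p + - sin p * (kp * (vt * w)) * e
          + ((vt * sin th - sin p * (vt * w)) * sin p + cos p * (kp * (vt * w)) * f)
          = vt * (cos (th - p) - w + kp * w * (- e * sin p + f * cos p))" for vt th p w kp e f :: real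
      proof -
        have "(vt * cos th - cos p * (vt * w)) * cos p + - sin p * (kp * (vt * w)) * e
          + ((vt * sin th - sin p * (vt * w)) * sin p + cos p * (kp * (vt * w)) * f)
          = vt * (cos th * cos p + sin th * sin p) - vt * w * (cos p * cos p + sin p * sin p)
            + vt * (kp * w * (- e * sin p + f * cos p))"
          by (simp add: algebra_simps del: sin_cos_squared_add3)
        also have "\<dots> = vt * (cos (th - p) - w + kp * w * (- e * sin p + f * cos p))"
          unfolding sin_cos_squared_add3 cos_diff by (simp add: algebra_simps)
        finally show ?thesis .
      qed
      have "((\<lambda>t. ep t * cos (\<psi> t) + eq t * sin (\<psi> t)) has_real_derivative
          vd t * (cos (\<theta> t - \<psi> t) - (1 + u1 t) + \<kappa> t * (1 + u1 t) * (- ep t * sin (\<psi> t) + eq t * cos (\<psi> t))))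
          (at t within {0..})"
        unfolding alg[symmetric]
        by (rule derivative_eq_intros epd[OF t] eqd[OF t] pathd(3)[OF t] refl)+
      then show ?thesis unfolding y1 y2 xi by (simp add: algebra_simps)
    qed
    then show "(err_y1 \<Gamma> d m has_real_derivative target_speed d m t * (- C1 * sat (err_y1 \<Gamma> d m t)
        + (cos (err_xi \<Gamma> d m t) - 1) + path_curv \<Gamma> (ref_arc m t) * (1 + C1 * sat (err_y1 \<Gamma> d m t)) * err_y2 \<Gamma> d m t))
        (at t within {0..})"
      by (simp add: u1_def vd_def \<kappa>_def S_def)
    have y2d: "(err_y2 \<Gamma> d m has_real_derivative
        vd t * (sin (err_xi \<Gamma> d m t) - \<kappa> t * (1 + u1 t) * err_y1 \<Gamma> d m t)) (at t within {0..})"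
    proof -
      have "((\<lambda>t. - ep t * sin (\<psi> t) + eq t * cos (\<psi> t)) has_real_derivative
          vd t * (sin (\<theta> t - \<psi> t) - \<kappa> t * (1 + u1 t) * (ep t * cos (\<psi> t) + eq t * sin (\<psi> t))))
          (at t within {0..})"
        by (rule derivative_eq_intros epd[OF t] eqd[OF t] pathd(3)[OF t] refl)+ (simp add: sin_diff algebra_simps)
      then show ?thesis unfolding y1 y2 xi .
    qed
    then show "(err_y2 \<Gamma> d m has_real_derivative target_speed d m t * (sin (err_xi \<Gamma> d m t)
        - path_curv \<Gamma> (ref_arc m t) * (1 + C1 * sat (err_y1 \<Gamma> d m t)) * err_y1 \<Gamma> d m t)) (at t within {0..})"
      by (simp add: u1_def vd_def \<kappa>_def S_def)
    have "(err_xi \<Gamma> d m has_real_derivative vd t * target_curv m t - \<kappa> t * (vd t * (1 + u1 t))) (at t within {0..})"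
      unfolding xi \<theta>_def by (intro DERIV_diff \<theta>d pathd t)
    moreover have "vd t * target_curv m t - \<kappa> t * (vd t * (1 + u1 t)) = vd t * (err_eta \<Gamma> m t - \<kappa> t * u1 t)"
      unfolding eta by (simp add: algebra_simps)
    ultimately show "(err_xi \<Gamma> d m has_real_derivative target_speed d m t *
        (err_eta \<Gamma> m t - path_curv \<Gamma> (ref_arc m t) * C1 * sat (err_y1 \<Gamma> d m t))) (at t within {0..})"
      by (simp add: u1_def vd_def \<kappa>_def S_def mult.assoc)
    define \<Phi> where "\<Phi> = D * sat (k1 / D * err_xi \<Gamma> d m t + k / D * err_eta \<Gamma> m t + C2 / D * sat (err_y2 \<Gamma> d m t))"
    have "(err_eta \<Gamma> m has_real_derivative vd t * (path_curv_rate \<Gamma> (S t) * (1 + u1 t) - \<Phi>)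
        - path_curv_rate \<Gamma> (S t) * (vd t * (1 + u1 t))) (at t within {0..})"
      unfolding eta \<Phi>_def by (intro DERIV_diff pathd t \<omega>d[unfolded eta])
    \<comment> \<open>The feedforward part of the control cancels the drift of the path curvature
      and leaves the saturated feedback alone.\<close>
    moreover have "vd t * (path_curv_rate \<Gamma> (S t) * (1 + u1 t) - \<Phi>) - path_curv_rate \<Gamma> (S t) * (vd t * (1 + u1 t)) = vd t * (- \<Phi>)"
      by (simp add: algebra_simps)
    ultimately show "(err_eta \<Gamma> m has_real_derivative target_speed d m t * (- D * sat (k1 / D * err_xi \<Gamma> d m t
        + k / D * err_eta \<Gamma> m t + C2 / D * sat (err_y2 \<Gamma> d m t)))) (at t within {0..})"
      by (simp add: \<Phi>_def vd_def)
  qed (rule Vmin)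
qed

text \<open>The position errors are recovered from \<open>err_y1\<close> and \<open>err_y2\<close>
  by the inverse rotation, whose coefficients are bounded by 1 whatever the path heading does. The
  run is in the original time, so the limits require no change of variable.\<close>

theorem motion_tracks:
  assumes path: "arclength_path s0 \<Gamma>" and curv: "\<And>s. s0 \<le> s \<Longrightarrow> \<bar>path_curv \<Gamma> s\<bar> \<le> \<kappa>m"
    and Vmin: "0 < Vmin" and veh: "vehicle Vmin Vmax m"
    and loop: "closed_loop \<Gamma> s0 d D k1 k C1 C2 m"
  shows "tracks_asymptotically \<Gamma> d m"
proof -
  interpret tracking_run D k \<beta> \<kappa>m 0 Vmin "target_speed d m" "\<lambda>t. path_curv \<Gamma> (ref_arc m t)"
    "err_y1 \<Gamma> d m" "err_y2 \<Gamma> d m" "err_xi \<Gamma> d m" "err_eta \<Gamma> m"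
    by (rule run_of_motion[OF assms])
  define \<psi> where "\<psi> t = path_heading \<Gamma> (ref_arc m t)" for t
  have lim: "((\<lambda>t. \<bar>err_y1 \<Gamma> d m t\<bar> + \<bar>err_y2 \<Gamma> d m t\<bar>) \<longlongrightarrow> 0) at_top"
    using tendsto_add[OF tendsto_rabs_zero[OF states_tendsto_zero(1)] tendsto_rabs_zero[OF states_tendsto_zero(2)]] by simp
  have trig: "\<bar>a * c + b * s\<bar> \<le> \<bar>a\<bar> + \<bar>b\<bar>" if "\<bar>c\<bar> \<le> 1" "\<bar>s\<bar> \<le> 1" for a b c s :: real
  proof -
    have "\<bar>a\<bar> * \<bar>c\<bar> \<le> \<bar>a\<bar> * 1" "\<bar>b\<bar> * \<bar>s\<bar> \<le> \<bar>b\<bar> * 1" 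
      by (intro mult_left_mono that abs_ge_zero)+
    then show ?thesis using abs_triangle_ineq[of "a * c" "b * s"] by (simp add: abs_mult)
  qed
  have p: "err_p \<Gamma> d m t = err_y1 \<Gamma> d m t * cos (\<psi> t) + err_y2 \<Gamma> d m t * (- sin (\<psi> t))" for t
  proof -
    have "err_y1 \<Gamma> d m t * cos (\<psi> t) + err_y2 \<Gamma> d m t * (- sin (\<psi> t))
        = err_p \<Gamma> d m t * (cos (\<psi> t) * cos (\<psi> t) + sin (\<psi> t) * sin (\<psi> t))"
      unfolding err_y1_def err_y2_def \<psi>_def
      by (simp add: algebra_simps del: sin_cos_squared_add3)
    then show ?thesis by (simp only: sin_cos_squared_add3 mult_1_right)
  qed
  have q: "err_q \<Gamma> d m t = err_y1 \<Gamma> d m t * sin (\<psi> t) + err_y2 \<Gamma> d m t * cos (\<psi> t)" for t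
  proof -
    have "err_y1 \<Gamma> d m t * sin (\<psi> t) + err_y2 \<Gamma> d m t * cos (\<psi> t)
        = err_q \<Gamma> d m t * (cos (\<psi> t) * cos (\<psi> t) + sin (\<psi> t) * sin (\<psi> t))"
      unfolding err_y1_def err_y2_def \<psi>_def
      by (simp add: algebra_simps del: sin_cos_squared_add3)
    then show ?thesis by (simp only: sin_cos_squared_add3 mult_1_right)
  qed
  have "norm (err_p \<Gamma> d m t) \<le> \<bar>err_y1 \<Gamma> d m t\<bar> + \<bar>err_y2 \<Gamma> d m t\<bar>" for t
    unfolding real_norm_def p by (rule trig) simp_all
  then have "(err_p \<Gamma> d m \<longlongrightarrow> 0) at_top"
    by (intro Lim_null_comparison[OF always_eventually lim] allI)
  moreover have "norm (err_q \<Gamma> d m t) \<le> \<bar>err_y1 \<Gamma> d m t\<bar> + \<bar>err_y2 \<Gamma> d m t\<bar>" for t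
    unfolding real_norm_def q by (rule trig) simp_all
  then have "(err_q \<Gamma> d m \<longlongrightarrow> 0) at_top"
    by (intro Lim_null_comparison[OF always_eventually lim] allI)
  ultimately show ?thesis
    unfolding tracks_asymptotically_def using states_tendsto_zero(3,4) by blast
qed

end

section \<open>Choice of the gain threshold\<close>

theorem mainTheorem1:
  fixes \<Gamma> :: planar_path and s0 \<kappa>max d Vmin Vmax \<beta> D :: real
  assumes "\<kappa>max > 0"
    and "arclength_path s0 \<Gamma>"
    and "\<forall>s\<ge>s0. \<bar>path_curv \<Gamma> s\<bar> \<le> \<kappa>max"
    and "d > 0" and "d * \<kappa>max < 1"
    and "0 < Vmin" and "Vmin \<le> Vmax"
    and "\<beta> > 8" and "D > 0"
  shows "\<exists>K>0. \<forall>k2\<ge>K.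
    (let a = 3 / 16;
         k1 = a * k2\<^sup>2;
         C2 = 1 / (2 * \<beta> * k2);
         C1 = a * C2 / (4 * k2)
     in
       (\<forall>\<kappa>r. continuous_on {0..} \<kappa>r \<and> (\<forall>t\<ge>0. \<bar>\<kappa>r t\<bar> \<le> \<kappa>max) \<longrightarrow>
          globally_asymptotically_stable (error_system D k1 k2 C1 C2 \<kappa>r)) \<and>
       (\<forall>m. vehicle Vmin Vmax m \<and> closed_loop \<Gamma> s0 d D k1 k2 C1 C2 m \<longrightarrow>
          tracks_asymptotically \<Gamma> d m))"
proof -
  \<comment> \<open>Raising the curvature bound above 1 makes it dominate constants and its own
    lower powers.\<close>
  define \<kappa>m where "\<kappa>m = 1 + \<kappa>max"
  \<comment> \<open>The first entry serves the estimates in the unsaturated regime; the second makes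
    \<open>1 / (k2 * D)\<close> small enough for the capture of the steering loop.\<close>
  define K where "K = max (20000 * \<beta> * \<kappa>m\<^sup>2) (2000 * \<kappa>m / D)"
  have \<kappa>m: "1 \<le> \<kappa>m" "\<kappa>max \<le> \<kappa>m" using assms(1) by (auto simp: \<kappa>m_def)
  have "0 < K" using \<kappa>m assms by (auto simp: K_def less_max_iff_disj)
  show ?thesis
  proof (intro exI[of _ K] conjI allI impI, rule \<open>0 < K\<close>)
    fix k2 assume k2: "K \<le> k2"
    interpret tracking_gains D k2 \<beta> \<kappa>m
    proof
      have "2000 * \<kappa>m / D \<le> k2" using k2 by (simp add: K_def)
      then show "2000 * \<kappa>m \<le> k2 * D" using assms by (simp add: field_simps)
    qed (use assms \<kappa>m k2 in \<open>auto simp: K_def\<close>)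
    have "globally_asymptotically_stable (error_system D k1 k2 C1 C2 \<kappa>r)"
      if "continuous_on {0..} \<kappa>r" "\<forall>t\<ge>0. \<bar>\<kappa>r t\<bar> \<le> \<kappa>max" for \<kappa>r
      by (rule error_system_stable) (use that \<kappa>m in force)+
    moreover have "tracks_asymptotically \<Gamma> d m"
      if "vehicle Vmin Vmax m" "closed_loop \<Gamma> s0 d D k1 k2 C1 C2 m" for m
      by (rule motion_tracks[OF assms(2) _ assms(6) that]) (use assms(3) \<kappa>m in force)
    ultimately show "let a = 3 / 16;
         k1 = a * k2\<^sup>2;
         C2 = 1 / (2 * \<beta> * k2);
         C1 = a * C2 / (4 * k2)
     in
       (\<forall>\<kappa>r. continuous_on {0..} \<kappa>r \<and> (\<forall>t\<ge>0. \<bar>\<kappa>r t\<bar> \<le> \<kappa>max) \<longrightarrow>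
          globally_asymptotically_stable (error_system D k1 k2 C1 C2 \<kappa>r)) \<and>
       (\<forall>m. vehicle Vmin Vmax m \<and> closed_loop \<Gamma> s0 d D k1 k2 C1 C2 m \<longrightarrow>
          tracks_asymptotically \<Gamma> d m)"
      unfolding Let_def C1_def C2_def k1_def by blast
  qed
qed

end
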